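(* Let $\mathcal{A}$ be the category of finitely generated modules over an artin algebra. Then $\mathcal{A}$ is a highest weight category if and only if there are objects $\Delta_1,\ldots,\Delta_n$ in $\mathcal{A}$ having the following properties: (1) $\operatorname{End}_{\mathcal{A}}(\Delta_i)$ is a division ring for all $i$. (2) $\operatorname{Hom}_{\mathcal{A}}(\Delta_i,\Delta_j)=0$ for all $i>j$. (3) $\operatorname{Ext}^1_{\mathcal{A}}(\Delta_i,\Delta_j)=0$ for all $i\ge j$. (4) A projective generator of $\operatorname{Filt}(\Delta_1,\ldots,\Delta_n)$ is also a projective generator of $\mathcal{A}$.
   Context: Modules are right modules. An abelian length category is an abelian category in which every object has a finite composition series. For objects $\Delta_1,\ldots,\Delta_n$ of an abelian category $\mathcal{A}$, $\operatorname{Filt}(\Delta_1,\ldots,\Delta_n)$ denotes the full subcategory of objects $X$ admitting a finite filtration $0=X_0\subseteq X_1\subseteq\cdots\subseteq X_t=X$ such that each factor $X_i/X_{i-1}$ is isomorphic to some $\Delta_j$ (for an empty list it consists of the zero objects). It is extension closed and is regarded as an exact category, whose exact sequences are the short exact sequences of $\mathcal{A}$ with all terms in it. A projective object $P$ of an abelian (or exact) category is a projective generator if for every object $X$ there is an exact sequence $0\to N\to P^r\to X\to 0$ in that category for some positive integer $r$. Highest weight category: an abelian length category $\mathcal{A}$ with only finitely many isomorphism classes of simple objects is called a highest weight category if there are finitely many exact sequences $0\to U_i\to P_i\to\Delta_i\to 0$ ($1\le i\le n$) in $\mathcal{A}$ such that: (1) $\operatorname{End}_{\mathcal{A}}(\Delta_i)$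 is a division ring for all $i$; (2) $\operatorname{Hom}_{\mathcal{A}}(\Delta_i,\Delta_j)=0$ for all $i>j$; (3) $U_i$ belongs to $\operatorname{Filt}(\Delta_{i+1},\ldots,\Delta_n)$ for all $i$; (4) $\bigoplus_{i=1}^n P_i$ is a projective generator of $\mathcal{A}$. The objects $\Delta_1,\ldots,\Delta_n$ are called standard objects. *)

theory Defs
  imports "HOL-Algebra.RingHom" "HOL-Algebra.Module"
begin

section \<open>Right modules over a (not necessarily commutative) ring\<close>

text \<open>The locale \<^locale>\<open>module\<close> of HOL-Algebra describes modules over commutative rings only.
  As there, the record extends \<open>'b ring\<close> so that the theory of \<^locale>\<open>abelian_group\<close> applies; the
  fields \<^const>\<open>mult\<close> and \<^const>\<open>one\<close> of a module carry no meaning, and no definition below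
  looks at them.\<close>

record ('a, 'b) rmodule = "'b ring" +
  ract :: "'b \<Rightarrow> 'a \<Rightarrow> 'b"  (infixl \<open>\<lhd>\<index>\<close> 70)

locale right_module = R?: ring R + M?: abelian_group M
  for R (structure) and M (structure) +
  assumes ract_closed: "\<lbrakk>x \<in> carrier M; a \<in> carrier R\<rbrakk> \<Longrightarrow> x \<lhd>\<^bsub>M\<^esub> a \<in> carrier M"
    and ract_add: "\<lbrakk>x \<in> carrier M; y \<in> carrier M; a \<in> carrier R\<rbrakk> \<Longrightarrow>
      (x \<oplus>\<^bsub>M\<^esub> y) \<lhd>\<^bsub>M\<^esub> a = x \<lhd>\<^bsub>M\<^esub> a \<oplus>\<^bsub>M\<^esub> y \<lhd>\<^bsub>M\<^esub> a"
    and ract_ring_add: "\<lbrakk>x \<in> carrier M; a \<in> carrier R; b \<in> carrier R\<rbrakk> \<Longrightarrow>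
      x \<lhd>\<^bsub>M\<^esub> (a \<oplus>\<^bsub>R\<^esub> b) = x \<lhd>\<^bsub>M\<^esub> a \<oplus>\<^bsub>M\<^esub> x \<lhd>\<^bsub>M\<^esub> b"
    and ract_assoc: "\<lbrakk>x \<in> carrier M; a \<in> carrier R; b \<in> carrier R\<rbrakk> \<Longrightarrow>
      x \<lhd>\<^bsub>M\<^esub> (a \<otimes>\<^bsub>R\<^esub> b) = (x \<lhd>\<^bsub>M\<^esub> a) \<lhd>\<^bsub>M\<^esub> b"
    and ract_one: "x \<in> carrier M \<Longrightarrow> x \<lhd>\<^bsub>M\<^esub> \<one>\<^bsub>R\<^esub> = x"

definition right_submodule :: "'b set \<Rightarrow> 'a ring \<Rightarrow> ('a, 'b) rmodule \<Rightarrow> bool" where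
  "right_submodule U R M \<longleftrightarrow>
     additive_subgroup U M \<and> (\<forall>x\<in>U. \<forall>a\<in>carrier R. x \<lhd>\<^bsub>M\<^esub> a \<in> U)"

definition quot_module :: "('a, 'b) rmodule \<Rightarrow> 'b set \<Rightarrow> ('a, 'b set) rmodule" where
  "quot_module M U =
     \<lparr>carrier = a_rcosets\<^bsub>M\<^esub> U, mult = undefined, one = undefined,
      zero = U, add = set_add M, ract = (\<lambda>C a. \<Union>x\<in>C. U +>\<^bsub>M\<^esub> (x \<lhd>\<^bsub>M\<^esub> a))\<rparr>"

definition direct_sum :: "'i set \<Rightarrow> ('i \<Rightarrow> ('a, 'b) rmodule) \<Rightarrow> ('a, 'i \<Rightarrow> 'b) rmodule" where
  \<comment> \<open>used for finite index sets only, where it is the full product\<close>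
  "direct_sum I M =
     \<lparr>carrier = (\<Pi>\<^sub>E i\<in>I. carrier (M i)), mult = undefined, one = undefined,
      zero = (\<lambda>i\<in>I. \<zero>\<^bsub>M i\<^esub>), add = (\<lambda>x y. \<lambda>i\<in>I. x i \<oplus>\<^bsub>M i\<^esub> y i),
      ract = (\<lambda>x a. \<lambda>i\<in>I. x i \<lhd>\<^bsub>M i\<^esub> a)\<rparr>"

definition finitely_generated :: "'a ring \<Rightarrow> ('a, 'b) rmodule \<Rightarrow> bool" where
  "finitely_generated R M \<longleftrightarrow>
     (\<exists>G. finite G \<and> G \<subseteq> carrier M \<and>
        (\<forall>U. right_submodule U R M \<and> G \<subseteq> U \<longrightarrow> U = carrier M))"


section \<open>Artin algebras\<close>

definition artinian_cring :: "'k ring \<Rightarrow> bool" where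
  "artinian_cring K \<longleftrightarrow> cring K \<and>
     (\<forall>I :: nat \<Rightarrow> 'k set. (\<forall>n. ideal (I n) K) \<and> (\<forall>n. I (Suc n) \<subseteq> I n) \<longrightarrow>
        (\<exists>N. \<forall>n\<ge>N. I n = I N))"

definition restricted_module :: "('k \<Rightarrow> 'a) \<Rightarrow> 'a ring \<Rightarrow> ('k, 'a) rmodule" where
  \<comment> \<open>a ring as a right module along a ring homomorphism into it\<close>
  "restricted_module \<phi> R =
     \<lparr>carrier = carrier R, mult = mult R, one = one R, zero = zero R, add = add R,
      ract = (\<lambda>x c. x \<otimes>\<^bsub>R\<^esub> \<phi> c)\<rparr>"

definition artin_algebra :: "'k ring \<Rightarrow> ('k \<Rightarrow> 'a) \<Rightarrow> 'a ring \<Rightarrow> bool" where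
  "artin_algebra K \<phi> R \<longleftrightarrow>
     artinian_cring K \<and> ring R \<and> \<phi> \<in> ring_hom K R \<and>
     (\<forall>c\<in>carrier K. \<forall>x\<in>carrier R. \<phi> c \<otimes>\<^bsub>R\<^esub> x = x \<otimes>\<^bsub>R\<^esub> \<phi> c) \<and>
     finitely_generated K (restricted_module \<phi> R)"


section \<open>Homomorphisms, endomorphism rings and short exact sequences\<close>

text \<open>Homomorphisms are extensional, so that equality of morphisms is equality of functions.\<close>

definition rhom :: "'a ring \<Rightarrow> ('a, 'b) rmodule \<Rightarrow> ('a, 'c) rmodule \<Rightarrow> ('b \<Rightarrow> 'c) set" where
  "rhom R M N = {f \<in> carrier M \<rightarrow>\<^sub>E carrier N.
     (\<forall>x\<in>carrier M. \<forall>y\<in>carrier M. f (x \<oplus>\<^bsub>M\<^esub> y) = f x \<oplus>\<^bsub>N\<^esub> f y) \<and>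
     (\<forall>x\<in>carrier M. \<forall>a\<in>carrier R. f (x \<lhd>\<^bsub>M\<^esub> a) = f x \<lhd>\<^bsub>N\<^esub> a)}"

definition zero_hom :: "('a, 'b) rmodule \<Rightarrow> ('a, 'c) rmodule \<Rightarrow> 'b \<Rightarrow> 'c" where
  "zero_hom M N = (\<lambda>x\<in>carrier M. \<zero>\<^bsub>N\<^esub>)"

definition riso :: "'a ring \<Rightarrow> ('a, 'b) rmodule \<Rightarrow> ('a, 'c) rmodule \<Rightarrow> ('b \<Rightarrow> 'c) set" where
  "riso R M N = {f \<in> rhom R M N. bij_betw f (carrier M) (carrier N)}"

definition isomorphic :: "'a ring \<Rightarrow> ('a, 'b) rmodule \<Rightarrow> ('a, 'c) rmodule \<Rightarrow> bool" where
  "isomorphic R M N \<longleftrightarrow> riso R M N \<noteq> {}"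

definition end_ring :: "'a ring \<Rightarrow> ('a, 'b) rmodule \<Rightarrow> ('b \<Rightarrow> 'b) ring" where
  "end_ring R M =
     \<lparr>carrier = rhom R M M, mult = compose (carrier M), one = (\<lambda>x\<in>carrier M. x),
      zero = zero_hom M M, add = (\<lambda>f g. \<lambda>x\<in>carrier M. f x \<oplus>\<^bsub>M\<^esub> g x)\<rparr>"

text \<open>As in the locale \<^locale>\<open>field\<close>, the condition on units also yields \<open>\<one> \<noteq> \<zero>\<close>.\<close>

definition division_ring :: "'a ring \<Rightarrow> bool" where
  "division_ring D \<longleftrightarrow> ring D \<and> Units D = carrier D - {\<zero>\<^bsub>D\<^esub>}"

definition short_exact ::
  "'a ring \<Rightarrow> ('a, 'b) rmodule \<Rightarrow> ('b \<Rightarrow> 'c) \<Rightarrow> ('a, 'c) rmodule \<Rightarrow> ('c \<Rightarrow> 'd) \<Rightarrow>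
   ('a, 'd) rmodule \<Rightarrow> bool" where
  "short_exact R L f M g N \<longleftrightarrow>
     f \<in> rhom R L M \<and> g \<in> rhom R M N \<and>
     inj_on f (carrier L) \<and> f ` carrier L = a_kernel M N g \<and> g ` carrier M = carrier N"


section \<open>The category of finitely generated modules\<close>

text \<open>Every finitely generated right module over a ring on \<open>'a\<close> is isomorphic to a quotient
  of a finite power of the ring, the elements of which are cosets, that is, sets of functions
  \<open>nat \<Rightarrow> 'a\<close>. The modules carried by the type \<open>(nat \<Rightarrow> 'a) set\<close> thus represent all isomorphism
  classes, and the full subcategory on them is equivalent to the category of all finitely
  generated modules.\<close>

type_synonym 'a fgm = "('a, (nat \<Rightarrow> 'a) set) rmodule"

definition fgmod :: "'a ring \<Rightarrow> 'a fgm set" where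
  "fgmod R = {M. right_module R M \<and> finitely_generated R M}"

text \<open>\<open>X\<close> has a finite filtration all of whose factors satisfy \<open>F\<close>. If these factors are finitely
  generated, then so are the members of the filtration, by induction along it.\<close>

definition filtered ::
  "'a ring \<Rightarrow> (('a, 'b set) rmodule \<Rightarrow> bool) \<Rightarrow> ('a, 'b) rmodule \<Rightarrow> bool" where
  "filtered R F X \<longleftrightarrow>
     (\<exists>t (Y :: nat \<Rightarrow> 'b set).
        Y 0 = {\<zero>\<^bsub>X\<^esub>} \<and> Y t = carrier X \<and>
        (\<forall>i\<le>t. right_submodule (Y i) R X) \<and>
        (\<forall>i<t. Y i \<subseteq> Y (Suc i) \<and> F (quot_module (X\<lparr>carrier := Y (Suc i)\<rparr>) (Y i))))"

definition simple_module :: "'a ring \<Rightarrow> ('a, 'b) rmodule \<Rightarrow> bool" where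
  "simple_module R M \<longleftrightarrow> right_module R M \<and> carrier M \<noteq> {\<zero>\<^bsub>M\<^esub>} \<and>
     (\<forall>U. right_submodule U R M \<longrightarrow> U = {\<zero>\<^bsub>M\<^esub>} \<or> U = carrier M)"

definition Filt :: "'a ring \<Rightarrow> ('i \<Rightarrow> 'a fgm) \<Rightarrow> 'i set \<Rightarrow> 'a fgm set" where
  "Filt R \<Delta> J = {X \<in> fgmod R. filtered R (\<lambda>Q. \<exists>j\<in>J. isomorphic R Q (\<Delta> j)) X}"


section \<open>Yoneda extensions\<close>

definition extensions ::
  "'a ring \<Rightarrow> 'a fgm \<Rightarrow> 'a fgm \<Rightarrow>
   (((nat \<Rightarrow> 'a) set \<Rightarrow> (nat \<Rightarrow> 'a) set) \<times> 'a fgm \<times> ((nat \<Rightarrow> 'a) set \<Rightarrow> (nat \<Rightarrow> 'a) set)) set" where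
  "extensions R X Y = {(f, E, g). E \<in> fgmod R \<and> short_exact R Y f E g X}"

definition ext_equiv where
  "ext_equiv R X Y = {((f, E, g), (f', E', g')).
     (f, E, g) \<in> extensions R X Y \<and> (f', E', g') \<in> extensions R X Y \<and>
     (\<exists>h\<in>riso R E E'. compose (carrier Y) h f = f' \<and> compose (carrier E) g' h = g)}"

definition Ext1 where
  "Ext1 R X Y = extensions R X Y // ext_equiv R X Y"

text \<open>The zero element of the group \<open>Ext\<^sup>1(X, Y)\<close> is the class of the extension with middle term
  \<open>Y \<oplus> X\<close>, which consists precisely of the split extensions. Vanishing of the group is
  \<open>Ext1 R X Y = {Ext1_zero R X Y}\<close>.\<close>

definition Ext1_zero where
  "Ext1_zero R X Y = {(f, E, g). (f, E, g) \<in> extensions R X Y \<and>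
     (\<exists>s\<in>rhom R X E. compose (carrier X) g s = (\<lambda>x\<in>carrier X. x))}"


section \<open>Projective generators and highest weight categories\<close>

text \<open>\<open>\<C>\<close> is a full subcategory of the finitely generated modules, with those short exact
  sequences as conflations that have all terms in \<open>\<C>\<close>: either \<^term>\<open>fgmod R\<close> or some \<^const>\<open>Filt\<close>.
  For \<^term>\<open>fgmod R\<close> over a right noetherian ring, these are the exact sequences of the
  abelian category.\<close>

definition projective_object :: "'a ring \<Rightarrow> 'a fgm set \<Rightarrow> 'a fgm \<Rightarrow> bool" where
  "projective_object R \<C> P \<longleftrightarrow> P \<in> \<C> \<and>
     (\<forall>A\<in>\<C>. \<forall>B\<in>\<C>. \<forall>C\<in>\<C>. \<forall>f g. short_exact R A f B g C \<longrightarrow>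
        (\<forall>h\<in>rhom R P C. \<exists>h'\<in>rhom R P B. compose (carrier P) g h' = h))"

definition projective_generator :: "'a ring \<Rightarrow> 'a fgm set \<Rightarrow> 'a fgm \<Rightarrow> bool" where
  \<comment> \<open>\<open>Q\<close> is a copy in \<open>\<C>\<close> of the power \<open>P\<^sup>r\<close>\<close>
  "projective_generator R \<C> P \<longleftrightarrow> projective_object R \<C> P \<and>
     (\<forall>X\<in>\<C>. \<exists>r::nat. r > 0 \<and>
        (\<exists>N\<in>\<C>. \<exists>Q\<in>\<C>. isomorphic R Q (direct_sum {1..r} (\<lambda>_. P)) \<and>
           (\<exists>f g. short_exact R N f Q g X)))"

definition length_category :: "'a ring \<Rightarrow> bool" where
  "length_category R \<longleftrightarrow> (\<forall>X\<in>fgmod R. filtered R (simple_module R) X)"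

definition finitely_many_simples :: "'a ring \<Rightarrow> bool" where
  "finitely_many_simples R \<longleftrightarrow>
     finite ({S \<in> fgmod R. simple_module R S} //
       {(S, T). S \<in> fgmod R \<and> T \<in> fgmod R \<and> isomorphic R S T})"

text \<open>The following says that the category of finitely generated right \<open>R\<close>-modules is a highest
  weight category (its standard objects are the \<open>\<Delta> i\<close>). It is not demanded separately
  that this category be abelian: \<^const>\<open>length_category\<close> makes \<open>R\<close> right noetherian, hence
  finitely generated modules closed under submodules.\<close>

definition highest_weight_category :: "'a ring \<Rightarrow> bool" where
  "highest_weight_category R \<longleftrightarrow>
     length_category R \<and> finitely_many_simples R \<and>
     (\<exists>(n::nat) U P \<Delta> f g.
        (\<forall>i\<in>{1..n}. U i \<in> fgmod R \<and> P i \<in> fgmod R \<and> \<Delta> i \<in> fgmod R \<and>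
           short_exact R (U i) (f i) (P i) (g i) (\<Delta> i)) \<and>
        (\<forall>i\<in>{1..n}. division_ring (end_ring R (\<Delta> i))) \<and>
        (\<forall>i\<in>{1..n}. \<forall>j\<in>{1..n}. i > j \<longrightarrow> rhom R (\<Delta> i) (\<Delta> j) = {zero_hom (\<Delta> i) (\<Delta> j)}) \<and>
        (\<forall>i\<in>{1..n}. U i \<in> Filt R \<Delta> {i+1..n}) \<and>
        (\<exists>Q\<in>fgmod R. isomorphic R Q (direct_sum {1..n} P) \<and> projective_generator R (fgmod R) Q))"

end

theory Submission
  imports Defs
begin

text \<open>If \<open>P 1 \<oplus> \<dots> \<oplus> P n\<close> is the projective generator of a highest weight category, then
  \<open>Ext\<^sup>1(\<Delta> i, \<Delta> j)\<close> is a quotient of \<open>Hom(U i, \<Delta> j)\<close>, which vanishes for \<open>i \<ge> j\<close> since \<open>U i\<close> is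
  filtered by \<open>\<Delta> (i+1), \<dots>, \<Delta> n\<close>. By the horseshoe lemma, \<open>P 1 \<oplus> \<dots> \<oplus> P n\<close> is also a projective
  generator of the filtered modules. Any other one, \<open>P'\<close>, is a direct summand of a power of it,
  hence projective, and maps onto it with some power, hence generates.

  Conversely, the universal extensions of \<open>\<Delta> i\<close> by \<open>\<Delta> (i+1), \<dots>, \<Delta> n\<close> yield a module \<open>P i\<close> over \<open>\<Delta> i\<close>
  with \<open>Ext\<^sup>1(P i, \<Delta> j) = 0\<close> for all \<open>j\<close>, the kernel being filtered by \<open>\<Delta> (i+1), \<dots>, \<Delta> n\<close>; they exist
  because homomorphism groups are finitely generated over the artinian base ring. Then
  \<open>P 1 \<oplus> \<dots> \<oplus> P n\<close> is a projective generator of the filtered modules and so, by assumption, of all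
  finitely generated modules.\<close>

section \<open>Modules, submodules and homomorphisms\<close>

text \<open>Two choices shape everything. All members of \<open>fgmod R\<close> are carried by one
  fixed type, whereas quotients, products and powers live on others; each is brought back along an
  isomorphism, and sums are known only through their projections. Direct arguments with such
  liftings replace each piece of a long exact sequence, and one lemma links them to Yoneda classes.
  The artin algebra enters through chain conditions, stated as well-foundedness of inclusion of
  submodules so that no lengths are counted. The ascending condition has to be won from the
  descending one over the commutative base ring K; it then keeps kernels finitely generated and
  makes finitely many pushouts suffice for a universal extension. The last condition on the standard
  objects is an implication about all projective generators of the filtered modules. It has force
  because the sum of the P i shows that there is one.\<close>

locale rmod = right_module R M for R :: "'a ring" (structure) and M :: "('a, 'b) rmodule" (structure)
begin

lemma zero_ract: "a \<in> carrier R \<Longrightarrow> \<zero>\<^bsub>M\<^esub> \<lhd>\<^bsub>M\<^esub> a = \<zero>\<^bsub>M\<^esub>"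
proof -
  assume a: "a \<in> carrier R"
  have "\<zero>\<^bsub>M\<^esub> \<lhd>\<^bsub>M\<^esub> a \<oplus>\<^bsub>M\<^esub> \<zero>\<^bsub>M\<^esub> \<lhd>\<^bsub>M\<^esub> a = \<zero>\<^bsub>M\<^esub> \<lhd>\<^bsub>M\<^esub> a \<oplus>\<^bsub>M\<^esub> \<zero>\<^bsub>M\<^esub>"
    using ract_add[of "\<zero>\<^bsub>M\<^esub>" "\<zero>\<^bsub>M\<^esub>" a] a by (simp add: ract_closed)
  then show ?thesis using a by (simp add: ract_closed)
qed

lemma ract_zero: "x \<in> carrier M \<Longrightarrow> x \<lhd>\<^bsub>M\<^esub> \<zero>\<^bsub>R\<^esub> = \<zero>\<^bsub>M\<^esub>"
proof -
  assume x: "x \<in> carrier M"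
  have "x \<lhd>\<^bsub>M\<^esub> \<zero>\<^bsub>R\<^esub> \<oplus>\<^bsub>M\<^esub> x \<lhd>\<^bsub>M\<^esub> \<zero>\<^bsub>R\<^esub> = x \<lhd>\<^bsub>M\<^esub> \<zero>\<^bsub>R\<^esub> \<oplus>\<^bsub>M\<^esub> \<zero>\<^bsub>M\<^esub>"
    using ract_ring_add[of x "\<zero>\<^bsub>R\<^esub>" "\<zero>\<^bsub>R\<^esub>"] x by (simp add: ract_closed)
  then show ?thesis using x by (simp add: ract_closed)
qed

lemma ract_neg: "x \<in> carrier M \<Longrightarrow> a \<in> carrier R \<Longrightarrow> x \<lhd>\<^bsub>M\<^esub> (\<ominus>\<^bsub>R\<^esub> a) = \<ominus>\<^bsub>M\<^esub> (x \<lhd>\<^bsub>M\<^esub> a)"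
  by (rule sym, rule M.minus_equality)
    (simp_all add: ract_closed ract_ring_add[symmetric] R.l_neg ract_zero)

lemma neg_ract: "x \<in> carrier M \<Longrightarrow> a \<in> carrier R \<Longrightarrow> (\<ominus>\<^bsub>M\<^esub> x) \<lhd>\<^bsub>M\<^esub> a = \<ominus>\<^bsub>M\<^esub> (x \<lhd>\<^bsub>M\<^esub> a)"
  by (rule sym, rule M.minus_equality)
    (simp_all add: ract_closed ract_add[symmetric] M.l_neg zero_ract)

lemma minus_self: "x \<in> carrier M \<Longrightarrow> x \<ominus>\<^bsub>M\<^esub> x = \<zero>\<^bsub>M\<^esub>"
  by (simp add: M.minus_eq M.r_neg)

lemma minus_eq_zero_iff:
  "\<lbrakk>x \<in> carrier M; y \<in> carrier M\<rbrakk> \<Longrightarrow> x \<ominus>\<^bsub>M\<^esub> y = \<zero>\<^bsub>M\<^esub> \<longleftrightarrow> x = y"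
  by (simp add: M.minus_eq) (metis M.minus_equality M.minus_minus M.r_neg M.a_inv_closed)

lemma minus_add_cancel: "\<lbrakk>x \<in> carrier M; y \<in> carrier M\<rbrakk> \<Longrightarrow> (x \<ominus>\<^bsub>M\<^esub> y) \<oplus>\<^bsub>M\<^esub> y = x"
  by (simp add: M.minus_eq M.a_assoc M.l_neg)

text \<open>Closure under negation comes for free, since -x is x acted on by -1.\<close>

lemma right_submoduleI:
  assumes "U \<subseteq> carrier M" "\<zero>\<^bsub>M\<^esub> \<in> U"
    and "\<And>x y. x \<in> U \<Longrightarrow> y \<in> U \<Longrightarrow> x \<oplus>\<^bsub>M\<^esub> y \<in> U"
    and "\<And>x a. x \<in> U \<Longrightarrow> a \<in> carrier R \<Longrightarrow> x \<lhd>\<^bsub>M\<^esub> a \<in> U"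
  shows "right_submodule U R M"
proof -
  have "\<ominus>\<^bsub>M\<^esub> x \<in> U" if "x \<in> U" for x
    using assms(4)[OF that, of "\<ominus>\<^bsub>R\<^esub> \<one>\<^bsub>R\<^esub>"] assms(1) that
    by (simp add: ract_neg ract_one subset_eq)
  moreover have "m_inv (add_monoid M) = a_inv M" by (simp add: a_inv_def fun_eq_iff)
  ultimately have "subgroup U (add_monoid M)"
    using assms(1-3) by unfold_locales auto
  then show ?thesis using assms(4)
    by (simp add: right_submodule_def additive_subgroup_def)
qed

lemma right_submoduleD:
  assumes "right_submodule U R M"
  shows "x \<in> U \<Longrightarrow> x \<in> carrier M" "\<zero>\<^bsub>M\<^esub> \<in> U"
    and "x \<in> U \<Longrightarrow> y \<in> U \<Longrightarrow> x \<oplus>\<^bsub>M\<^esub> y \<in> U"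
    and "x \<in> U \<Longrightarrow> a \<in> carrier R \<Longrightarrow> x \<lhd>\<^bsub>M\<^esub> a \<in> U"
    and "x \<in> U \<Longrightarrow> \<ominus>\<^bsub>M\<^esub> x \<in> U"
    and "x \<in> U \<Longrightarrow> y \<in> U \<Longrightarrow> x \<ominus>\<^bsub>M\<^esub> y \<in> U"
proof -
  interpret U: additive_subgroup U M using assms by (simp add: right_submodule_def)
  show "x \<in> U \<Longrightarrow> x \<in> carrier M" by (rule U.a_Hcarr)
  show "\<zero>\<^bsub>M\<^esub> \<in> U" by simp
  show "x \<in> U \<Longrightarrow> y \<in> U \<Longrightarrow> x \<oplus>\<^bsub>M\<^esub> y \<in> U" by simp
  show "x \<in> U \<Longrightarrow> a \<in> carrier R \<Longrightarrow> x \<lhd>\<^bsub>M\<^esub> a \<in> U"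
    using assms by (simp add: right_submodule_def)
  show neg: "x \<in> U \<Longrightarrow> \<ominus>\<^bsub>M\<^esub> x \<in> U" for x
    by (rule U.a_inv_closed)
  show "x \<in> U \<Longrightarrow> y \<in> U \<Longrightarrow> x \<ominus>\<^bsub>M\<^esub> y \<in> U"
    by (simp add: M.minus_eq neg)
qed

lemma right_submodule_carrier: "right_submodule (carrier M) R M"
  by (rule right_submoduleI) (auto simp: ract_closed)

lemma right_submodule_zero: "right_submodule {\<zero>\<^bsub>M\<^esub>} R M"
  by (rule right_submoduleI) (auto simp: zero_ract)

lemma right_submodule_Int:
  assumes "right_submodule U R M" "right_submodule V R M"
  shows "right_submodule (U \<inter> V) R M"
  using assms by (intro right_submoduleI) (auto dest: right_submoduleD)

lemma right_submodule_sum: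
  assumes U: "right_submodule U R M" and V: "right_submodule V R M"
  shows "right_submodule {u \<oplus>\<^bsub>M\<^esub> v | u v. u \<in> U \<and> v \<in> V} R M"
proof (rule right_submoduleI, goal_cases)
  case 1
  then show ?case using right_submoduleD[OF U] right_submoduleD[OF V] by auto
next
  case 2
  then show ?case using right_submoduleD(2)[OF U] right_submoduleD(2)[OF V] by force
next
  case (3 x y)
  then obtain u v u' v' where *: "u \<in> U" "v \<in> V" "u' \<in> U" "v' \<in> V"
    "x = u \<oplus>\<^bsub>M\<^esub> v" "y = u' \<oplus>\<^bsub>M\<^esub> v'" by auto
  then have "x \<oplus>\<^bsub>M\<^esub> y = (u \<oplus>\<^bsub>M\<^esub> u') \<oplus>\<^bsub>M\<^esub> (v \<oplus>\<^bsub>M\<^esub> v')"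
    using right_submoduleD(1)[OF U] right_submoduleD(1)[OF V] by (simp add: M.a_ac)
  then show ?case using * right_submoduleD(3)[OF U] right_submoduleD(3)[OF V] by blast
next
  case (4 x a)
  then obtain u v where *: "u \<in> U" "v \<in> V" "x = u \<oplus>\<^bsub>M\<^esub> v" by auto
  then have "x \<lhd>\<^bsub>M\<^esub> a = u \<lhd>\<^bsub>M\<^esub> a \<oplus>\<^bsub>M\<^esub> v \<lhd>\<^bsub>M\<^esub> a"
    using 4 right_submoduleD(1)[OF U] right_submoduleD(1)[OF V] by (simp add: ract_add)
  then show ?case using * 4 right_submoduleD(4)[OF U] right_submoduleD(4)[OF V] by blast
qed

lemma right_submodule_cyclic:
  assumes x: "x \<in> carrier M"
  shows "right_submodule ((\<lambda>a. x \<lhd>\<^bsub>M\<^esub> a) ` carrier R) R M"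
proof (rule right_submoduleI, goal_cases)
  case 1
  then show ?case using x by (auto simp: ract_closed)
next
  case 2
  then show ?case using ract_zero[OF x] by (metis R.zero_closed image_eqI)
next
  case (3 y z)
  then show ?case using x by (auto simp: ract_ring_add[symmetric])
next
  case (4 y a)
  then show ?case using x by (auto simp: ract_assoc[symmetric])
qed

lemma right_module_sub:
  assumes U: "right_submodule U R M"
  shows "right_module R (M\<lparr>carrier := U\<rparr>)"
proof -
  note D = right_submoduleD[OF U]
  have "abelian_group (M\<lparr>carrier := U\<rparr>)"
  proof (rule abelian_groupI, goal_cases)
    case (6 x) then show ?case by (auto simp: D M.l_neg intro!: bexI[of _ "\<ominus>\<^bsub>M\<^esub> x"])
  qed (auto simp: D M.a_ac)
  then show ?thesis
    by (intro right_module.intro R.ring_axioms right_module_axioms.intro)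
      (auto simp: D ract_add ract_ring_add ract_assoc ract_one)
qed

lemma right_submodule_sub_iff:
  assumes U: "right_submodule U R M"
  shows "right_submodule V R (M\<lparr>carrier := U\<rparr>) \<longleftrightarrow> right_submodule V R M \<and> V \<subseteq> U"
proof -
  interpret S: rmod R "M\<lparr>carrier := U\<rparr>" by (rule rmod.intro, rule right_module_sub[OF U])
  show ?thesis
  proof (intro iffI conjI)
    assume V: "right_submodule V R (M\<lparr>carrier := U\<rparr>)"
    show "V \<subseteq> U" using S.right_submoduleD(1)[OF V] by auto
    then show "right_submodule V R M"
      using S.right_submoduleD(2-4)[OF V] right_submoduleD(1)[OF U]
      by (intro right_submoduleI) auto
  next
    assume V: "right_submodule V R M \<and> V \<subseteq> U"
    then show "right_submodule V R (M\<lparr>carrier := U\<rparr>)"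
      by (intro S.right_submoduleI) (auto dest: right_submoduleD)
  qed
qed

text \<open>The module axioms are equations and existence statements that pass along a surjection
  compatible with the operations. This serves for records N, such as quotients and copies, that are
  not yet known to be modules.\<close>

lemma right_module_image:
  assumes surj: "g ` carrier M = carrier N"
    and add: "\<And>x y. x \<in> carrier M \<Longrightarrow> y \<in> carrier M \<Longrightarrow> g (x \<oplus>\<^bsub>M\<^esub> y) = g x \<oplus>\<^bsub>N\<^esub> g y"
    and act: "\<And>x a. x \<in> carrier M \<Longrightarrow> a \<in> carrier R \<Longrightarrow> g (x \<lhd>\<^bsub>M\<^esub> a) = g x \<lhd>\<^bsub>N\<^esub> a"
    and zero: "g \<zero>\<^bsub>M\<^esub> = \<zero>\<^bsub>N\<^esub>"
  shows "right_module R N"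
proof -
  have rep: "\<exists>x\<in>carrier M. y = g x" if "y \<in> carrier N" for y using surj that by auto
  have cl: "g x \<in> carrier N" if "x \<in> carrier M" for x using surj that by auto
  have "abelian_group N"
  proof (rule abelian_groupI, goal_cases)
    case (1 x y) then show ?case by (auto dest!: rep simp: add[symmetric] cl)
  next
    case 2 then show ?case by (auto simp: zero[symmetric] cl)
  next
    case (3 x y z) then show ?case by (auto dest!: rep simp: add[symmetric] M.a_assoc)
  next
    case (4 x y) then show ?case by (auto dest!: rep simp: add[symmetric] M.a_comm)
  next
    case (5 x) then show ?case by (auto dest!: rep simp: add[symmetric] zero[symmetric])
  next
    case (6 x)
    then obtain y where y: "y \<in> carrier M" "x = g y" by (auto dest!: rep)
    then have "g (\<ominus>\<^bsub>M\<^esub> y) \<oplus>\<^bsub>N\<^esub> x = \<zero>\<^bsub>N\<^esub>" by (simp add: add[symmetric] zero[symmetric] M.l_neg)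
    then show ?case using y by (auto intro!: cl bexI[of _ "g (\<ominus>\<^bsub>M\<^esub> y)"])
  qed
  then show ?thesis
  proof (intro right_module.intro R.ring_axioms right_module_axioms.intro, goal_cases)
    case (2 x a) then show ?case by (auto dest!: rep simp: act[symmetric] cl ract_closed)
  next
    case (3 x y a) then show ?case
      by (auto dest!: rep simp: act[symmetric] add[symmetric] ract_closed ract_add)
  next
    case (4 x a b) then show ?case
      by (auto dest!: rep simp: act[symmetric] add[symmetric] ract_closed ract_ring_add)
  next
    case (5 x a b) then show ?case
      by (auto dest!: rep simp: act[symmetric] ract_closed ract_assoc)
  next
    case (6 x) then show ?case by (auto dest!: rep simp: act[symmetric] ract_one)
  qed
qed

lemma finitely_generated_image:
  assumes surj: "g ` carrier M = carrier N"
    and add: "\<And>x y. x \<in> carrier M \<Longrightarrow> y \<in> carrier M \<Longrightarrow> g (x \<oplus>\<^bsub>M\<^esub> y) = g x \<oplus>\<^bsub>N\<^esub> g y"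
    and act: "\<And>x a. x \<in> carrier M \<Longrightarrow> a \<in> carrier R \<Longrightarrow> g (x \<lhd>\<^bsub>M\<^esub> a) = g x \<lhd>\<^bsub>N\<^esub> a"
    and zero: "g \<zero>\<^bsub>M\<^esub> = \<zero>\<^bsub>N\<^esub>"
    and fg: "finitely_generated R M"
  shows "finitely_generated R N"
proof -
  interpret N: rmod R N by (rule rmod.intro, rule right_module_image[OF surj add act zero])
  obtain G where G: "finite G" "G \<subseteq> carrier M"
    "\<And>U. right_submodule U R M \<Longrightarrow> G \<subseteq> U \<Longrightarrow> U = carrier M"
    using fg by (auto simp: finitely_generated_def)
  show ?thesis unfolding finitely_generated_def
  proof (intro exI[of _ "g ` G"] conjI allI impI)
    show "finite (g ` G)" "g ` G \<subseteq> carrier N" using G surj by auto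
    fix U assume U: "right_submodule U R N \<and> g ` G \<subseteq> U"
    let ?V = "{x \<in> carrier M. g x \<in> U}"
    have "right_submodule ?V R M"
      using U by (intro right_submoduleI) (auto simp: add act zero N.right_submoduleD ract_closed)
    then have "?V = carrier M" using G U by auto
    then have "g ` carrier M \<subseteq> U" by auto
    then have "carrier N \<subseteq> U" using surj by simp
    then show "U = carrier N" using U N.right_submoduleD(1) by blast
  qed
qed

end

lemma rhomD:
  assumes "f \<in> rhom R M N"
  shows "x \<in> carrier M \<Longrightarrow> f x \<in> carrier N"
    and "x \<in> carrier M \<Longrightarrow> y \<in> carrier M \<Longrightarrow> f (x \<oplus>\<^bsub>M\<^esub> y) = f x \<oplus>\<^bsub>N\<^esub> f y"
    and "x \<in> carrier M \<Longrightarrow> a \<in> carrier R \<Longrightarrow> f (x \<lhd>\<^bsub>M\<^esub> a) = f x \<lhd>\<^bsub>N\<^esub> a"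
    and "f \<in> extensional (carrier M)"
  using assms by (auto simp: rhom_def PiE_def)

lemma rhom_zero:
  assumes f: "f \<in> rhom R M N" and "right_module R M" "right_module R N"
  shows "f \<zero>\<^bsub>M\<^esub> = \<zero>\<^bsub>N\<^esub>"
proof -
  interpret M: rmod R M by (rule rmod.intro) fact
  interpret N: rmod R N by (rule rmod.intro) fact
  show ?thesis
    using rhomD(3)[OF f M.M.zero_closed M.R.zero_closed] rhomD(1)[OF f M.M.zero_closed]
    by (simp add: M.ract_zero N.ract_zero)
qed

lemma rhom_neg:
  assumes f: "f \<in> rhom R M N" and "right_module R M" "right_module R N" and x: "x \<in> carrier M"
  shows "f (\<ominus>\<^bsub>M\<^esub> x) = \<ominus>\<^bsub>N\<^esub> f x"
proof -
  interpret M: rmod R M by (rule rmod.intro) fact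
  interpret N: rmod R N by (rule rmod.intro) fact
  show ?thesis
    using rhomD(3)[OF f x, of "\<ominus>\<^bsub>R\<^esub> \<one>\<^bsub>R\<^esub>"] rhomD(1)[OF f x] x
    by (simp add: M.ract_neg N.ract_neg M.ract_one N.ract_one)
qed

lemma rhom_minus:
  assumes f: "f \<in> rhom R M N" and "right_module R M" "right_module R N"
    and x: "x \<in> carrier M" and y: "y \<in> carrier M"
  shows "f (x \<ominus>\<^bsub>M\<^esub> y) = f x \<ominus>\<^bsub>N\<^esub> f y"
proof -
  interpret M: rmod R M by (rule rmod.intro) fact
  interpret N: rmod R N by (rule rmod.intro) fact
  show ?thesis using x y
    by (simp add: M.M.minus_eq N.M.minus_eq rhomD(2)[OF f] rhom_neg[OF f assms(2,3)])
qed

lemma rhom_restrictI: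
  assumes "right_module R M"
    and "\<And>x. x \<in> carrier M \<Longrightarrow> e x \<in> carrier N"
    and "\<And>x y. x \<in> carrier M \<Longrightarrow> y \<in> carrier M \<Longrightarrow> e (x \<oplus>\<^bsub>M\<^esub> y) = e x \<oplus>\<^bsub>N\<^esub> e y"
    and "\<And>x a. x \<in> carrier M \<Longrightarrow> a \<in> carrier R \<Longrightarrow> e (x \<lhd>\<^bsub>M\<^esub> a) = e x \<lhd>\<^bsub>N\<^esub> a"
  shows "(\<lambda>x\<in>carrier M. e x) \<in> rhom R M N"
proof -
  interpret M: rmod R M by (rule rmod.intro) fact
  show ?thesis using assms(2-4) by (auto simp: rhom_def M.ract_closed)
qed

lemma rhom_compose:
  assumes "right_module R L" "f \<in> rhom R L M" "g \<in> rhom R M N"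
  shows "(\<lambda>x\<in>carrier L. g (f x)) \<in> rhom R L N"
  by (rule rhom_restrictI[OF assms(1)]) (simp_all add: rhomD[OF assms(2)] rhomD[OF assms(3)])

lemma rhom_add:
  assumes "right_module R M" "right_module R N" and f: "f \<in> rhom R M N" and g: "g \<in> rhom R M N"
  shows "(\<lambda>x\<in>carrier M. f x \<oplus>\<^bsub>N\<^esub> g x) \<in> rhom R M N"
proof -
  interpret N: rmod R N by (rule rmod.intro) fact
  show ?thesis
    by (rule rhom_restrictI[OF assms(1)])
      (simp_all add: rhomD[OF f] rhomD[OF g] N.ract_add N.M.a_ac)
qed

lemma rhom_diff:
  assumes "right_module R M" "right_module R N" and f: "f \<in> rhom R M N" and g: "g \<in> rhom R M N"
  shows "(\<lambda>x\<in>carrier M. f x \<ominus>\<^bsub>N\<^esub> g x) \<in> rhom R M N"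
proof -
  interpret N: rmod R N by (rule rmod.intro) fact
  show ?thesis
    by (rule rhom_restrictI[OF assms(1)])
      (simp_all add: rhomD[OF f] rhomD[OF g] N.ract_add N.neg_ract N.ract_closed
        N.M.minus_eq N.M.a_ac N.M.minus_add)
qed

lemma rhom_id: "right_module R M \<Longrightarrow> (\<lambda>x\<in>carrier M. x) \<in> rhom R M M"
  by (rule rhom_restrictI) auto

lemma zero_hom_rhom: "right_module R M \<Longrightarrow> right_module R N \<Longrightarrow> zero_hom M N \<in> rhom R M N"
proof -
  assume M: "right_module R M" and "right_module R N"
  then interpret N: rmod R N by (simp add: rmod_def)
  show ?thesis unfolding zero_hom_def by (rule rhom_restrictI[OF M]) (auto simp: N.zero_ract)
qed

lemma rhom_eqI:
  assumes "f \<in> rhom R M N" "g \<in> rhom R M N" "\<And>x. x \<in> carrier M \<Longrightarrow> f x = g x"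
  shows "f = g"
  using assms by (meson extensionalityI rhomD(4))

lemma a_kernel_iff: "x \<in> a_kernel M N g \<longleftrightarrow> x \<in> carrier M \<and> g x = \<zero>\<^bsub>N\<^esub>"
  by (simp add: a_kernel_def kernel_def)

lemma right_submodule_kernel:
  assumes M: "right_module R M" and N: "right_module R N" and g: "g \<in> rhom R M N"
  shows "right_submodule {x \<in> carrier M. g x = \<zero>\<^bsub>N\<^esub>} R M"
proof -
  interpret M: rmod R M by (rule rmod.intro) fact
  interpret N: rmod R N by (rule rmod.intro) fact
  show ?thesis
    by (rule M.right_submoduleI)
      (auto simp: rhomD[OF g] rhom_zero[OF g M N] M.ract_closed N.zero_ract)
qed

lemma right_submodule_vimage:
  assumes M: "right_module R M" and N: "right_module R N" and g: "g \<in> rhom R M N"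
    and U: "right_submodule U R N"
  shows "right_submodule {x \<in> carrier M. g x \<in> U} R M"
proof -
  interpret M: rmod R M by (rule rmod.intro) fact
  interpret N: rmod R N by (rule rmod.intro) fact
  show ?thesis
    by (rule M.right_submoduleI)
      (auto simp: rhomD[OF g] rhom_zero[OF g M N] M.ract_closed N.right_submoduleD[OF U])
qed

lemma right_submodule_image:
  assumes M: "right_module R M" and N: "right_module R N" and g: "g \<in> rhom R M N"
    and U: "right_submodule U R M"
  shows "right_submodule (g ` U) R N"
proof -
  interpret M: rmod R M by (rule rmod.intro) fact
  interpret N: rmod R N by (rule rmod.intro) fact
  note D = M.right_submoduleD[OF U]
  show ?thesis
  proof (rule N.right_submoduleI, goal_cases)
    case 1 then show ?case using D rhomD(1)[OF g] by auto
  next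
    case 2 then show ?case using D(2) rhom_zero[OF g M N] by force
  next
    case (3 x y) then show ?case using D by (auto simp: rhomD(2)[OF g, symmetric])
  next
    case (4 x a) then show ?case using D by (auto simp: rhomD(3)[OF g, symmetric])
  qed
qed

text \<open>The universal property of a quotient, for an arbitrary surjection so that it also
  applies to copies of quotients. The map is h after a set-theoretic section of g; the choice is
  immaterial because h vanishes on the kernel of g.\<close>

lemma rhom_factor:
  assumes M: "right_module R M" and N: "right_module R N" and L: "right_module R L"
    and g: "g \<in> rhom R M N" and surj: "g ` carrier M = carrier N" and h: "h \<in> rhom R M L"
    and ker: "\<And>x. x \<in> carrier M \<Longrightarrow> g x = \<zero>\<^bsub>N\<^esub> \<Longrightarrow> h x = \<zero>\<^bsub>L\<^esub>"
  shows "\<exists>k\<in>rhom R N L. \<forall>x\<in>carrier M. k (g x) = h x"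
proof -
  interpret M: rmod R M by (rule rmod.intro) fact
  interpret N: rmod R N by (rule rmod.intro) fact
  interpret L: rmod R L by (rule rmod.intro) fact
  have eq: "h x = h y" if "x \<in> carrier M" "y \<in> carrier M" "g x = g y" for x y
  proof -
    have "g (x \<ominus>\<^bsub>M\<^esub> y) = \<zero>\<^bsub>N\<^esub>"
      using that by (simp add: rhom_minus[OF g M N] N.minus_self rhomD[OF g])
    then have "h (x \<ominus>\<^bsub>M\<^esub> y) = \<zero>\<^bsub>L\<^esub>" using that by (simp add: ker)
    then show ?thesis using that
      by (simp add: rhom_minus[OF h M L] L.minus_eq_zero_iff rhomD[OF h])
  qed
  define s where "s y = (SOME x. x \<in> carrier M \<and> g x = y)" for y
  have s: "s y \<in> carrier M \<and> g (s y) = y" if "y \<in> carrier N" for y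
    unfolding s_def by (rule someI_ex) (use that surj[symmetric] in auto)
  have k: "h (s (g x)) = h x" if "x \<in> carrier M" for x
    using s[OF rhomD(1)[OF g that]] that by (intro eq) simp_all
  have "(\<lambda>y\<in>carrier N. h (s y)) \<in> rhom R N L"
  proof (rule rhom_restrictI[OF N], goal_cases)
    case (1 x) then show ?case using s rhomD[OF h] by auto
  next
    case (2 x y)
    have "h (s (x \<oplus>\<^bsub>N\<^esub> y)) = h (s x \<oplus>\<^bsub>M\<^esub> s y)"
      using 2 s by (intro eq) (auto simp: rhomD(2)[OF g])
    then show ?case using 2 s by (simp add: rhomD(2)[OF h])
  next
    case (3 x a)
    have "h (s (x \<lhd>\<^bsub>N\<^esub> a)) = h (s x \<lhd>\<^bsub>M\<^esub> a)"
      using 3 s by (intro eq) (auto simp: rhomD(3)[OF g] M.ract_closed N.ract_closed)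
    then show ?case using 3 s by (simp add: rhomD(3)[OF h])
  qed
  then show ?thesis using k rhomD(1)[OF g]
    by (intro bexI[of _ "\<lambda>y\<in>carrier N. h (s y)"]) auto
qed

text \<open>The universal property of a kernel, for an arbitrary injection f. The preimage under f
  is unique, so additivity and linearity can be tested after applying f.\<close>

lemma rhom_cofactor:
  assumes M: "right_module R M" and N: "right_module R N" and L: "right_module R L"
    and f: "f \<in> rhom R M N" and inj: "inj_on f (carrier M)" and h: "h \<in> rhom R L N"
    and im: "\<And>x. x \<in> carrier L \<Longrightarrow> h x \<in> f ` carrier M"
  shows "\<exists>k\<in>rhom R L M. \<forall>x\<in>carrier L. f (k x) = h x"
proof -
  interpret M: rmod R M by (rule rmod.intro) fact
  interpret L: rmod R L by (rule rmod.intro) fact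
  define k where "k x = inv_into (carrier M) f (h x)" for x
  have k: "k x \<in> carrier M" "f (k x) = h x" if "x \<in> carrier L" for x
    unfolding k_def using im[OF that] by (simp_all add: inv_into_into f_inv_into_f)
  have "(\<lambda>x\<in>carrier L. k x) \<in> rhom R L M"
  proof (rule rhom_restrictI[OF L], goal_cases)
    case (1 x) then show ?case by (rule k)
  next
    case (2 x y) then show ?case
      by (intro inj_onD[OF inj]) (simp_all add: k rhomD[OF f] rhomD[OF h])
  next
    case (3 x a) then show ?case
      by (intro inj_onD[OF inj]) (simp_all add: k rhomD[OF f] rhomD[OF h] M.ract_closed L.ract_closed)
  qed
  then show ?thesis using k by (intro bexI[of _ "\<lambda>x\<in>carrier L. k x"]) auto
qed

lemma rhom_inj_onI:
  assumes M: "right_module R M" and N: "right_module R N" and f: "f \<in> rhom R M N"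
    and ker: "\<And>x. x \<in> carrier M \<Longrightarrow> f x = \<zero>\<^bsub>N\<^esub> \<Longrightarrow> x = \<zero>\<^bsub>M\<^esub>"
  shows "inj_on f (carrier M)"
proof (rule inj_onI)
  interpret M: rmod R M by (rule rmod.intro) fact
  interpret N: rmod R N by (rule rmod.intro) fact
  fix x y assume xy: "x \<in> carrier M" "y \<in> carrier M" "f x = f y"
  then have "f (x \<ominus>\<^bsub>M\<^esub> y) = \<zero>\<^bsub>N\<^esub>"
    by (simp add: rhom_minus[OF f M N] N.minus_self rhomD[OF f])
  then show "x = y" using ker[of "x \<ominus>\<^bsub>M\<^esub> y"] xy by (simp add: M.minus_eq_zero_iff)
qed

lemma riso_inv:
  assumes M: "right_module R M" and N: "right_module R N" and f: "f \<in> riso R M N"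
  shows "\<exists>g\<in>riso R N M. (\<forall>x\<in>carrier M. g (f x) = x) \<and> (\<forall>y\<in>carrier N. f (g y) = y)"
proof -
  have fh: "f \<in> rhom R M N" and b: "bij_betw f (carrier M) (carrier N)"
    using f by (auto simp: riso_def)
  have inj: "inj_on f (carrier M)" and im: "f ` carrier M = carrier N"
    using b by (auto simp: bij_betw_def)
  obtain g where g: "g \<in> rhom R N M" "\<And>y. y \<in> carrier N \<Longrightarrow> f (g y) = y"
    using rhom_cofactor[OF M N N fh inj rhom_id[OF N]] im by auto
  have gf: "g (f x) = x" if "x \<in> carrier M" for x
    using inj_onD[OF inj _ rhomD(1)[OF g(1)] that] g(2) rhomD(1)[OF fh] that by auto
  have "bij_betw g (carrier N) (carrier M)"
    by (rule bij_betw_byWitness[of _ f]) (auto simp: gf g rhomD(1)[OF g(1)] rhomD(1)[OF fh])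
  then show ?thesis using g gf by (auto simp: riso_def)
qed

lemma isomorphic_refl: "right_module R M \<Longrightarrow> isomorphic R M M"
  using rhom_id[of R M] by (auto simp: isomorphic_def riso_def bij_betw_def inj_on_def)

lemma isomorphic_sym:
  "right_module R M \<Longrightarrow> right_module R N \<Longrightarrow> isomorphic R M N \<Longrightarrow> isomorphic R N M"
  unfolding isomorphic_def using riso_inv[of R M N] by blast

lemma riso_compose:
  assumes "right_module R L" "f \<in> riso R L M" "g \<in> riso R M N"
  shows "(\<lambda>x\<in>carrier L. g (f x)) \<in> riso R L N"
proof -
  have "bij_betw (g \<circ> f) (carrier L) (carrier N)"
    using assms by (auto simp: riso_def intro: bij_betw_trans)
  then have "bij_betw (\<lambda>x\<in>carrier L. g (f x)) (carrier L) (carrier N)"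
    by (rule bij_betw_cong[THEN iffD1, rotated]) auto
  then show ?thesis using assms by (auto simp: riso_def intro: rhom_compose)
qed

lemma isomorphic_trans:
  "right_module R L \<Longrightarrow> isomorphic R L M \<Longrightarrow> isomorphic R M N \<Longrightarrow> isomorphic R L N"
  unfolding isomorphic_def using riso_compose by (metis ex_in_conv)

section \<open>Quotients and copies\<close>

context rmod
begin

lemma coset_eq_iff:
  assumes U: "right_submodule U R M" and x: "x \<in> carrier M" and y: "y \<in> carrier M"
  shows "U +>\<^bsub>M\<^esub> x = U +>\<^bsub>M\<^esub> y \<longleftrightarrow> x \<ominus>\<^bsub>M\<^esub> y \<in> U"
proof -
  interpret U: additive_subgroup U M using U by (simp add: right_submodule_def)
  interpret U: abelian_subgroup U M
    by (rule abelian_subgroupI3[OF U.additive_subgroup_axioms M.abelian_group_axioms])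
  show ?thesis
  proof
    assume "U +>\<^bsub>M\<^esub> x = U +>\<^bsub>M\<^esub> y"
    then have "x \<in> U +>\<^bsub>M\<^esub> y" using U.a_rcos_self[OF x] by simp
    then show "x \<ominus>\<^bsub>M\<^esub> y \<in> U" using U.a_rcos_module[OF y x] by (simp add: M.minus_eq)
  next
    assume "x \<ominus>\<^bsub>M\<^esub> y \<in> U"
    then have "x \<in> U +>\<^bsub>M\<^esub> y" using U.a_rcos_module[OF y x] by (simp add: M.minus_eq)
    then show "U +>\<^bsub>M\<^esub> x = U +>\<^bsub>M\<^esub> y" by (metis M.a_repr_independence y U.a_subgroup)
  qed
qed

text \<open>From here on a quotient is known only through its projection: a surjective homomorphism
  with kernel U. Cosets are not computed with again.\<close>

lemma quot_module_proj:
  assumes U: "right_submodule U R M"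
  defines "\<pi> \<equiv> (\<lambda>x\<in>carrier M. U +>\<^bsub>M\<^esub> x)"
  shows "right_module R (quot_module M U)" "\<pi> \<in> rhom R M (quot_module M U)"
    "\<pi> ` carrier M = carrier (quot_module M U)"
    "\<And>x. x \<in> carrier M \<Longrightarrow> \<pi> x = \<zero>\<^bsub>quot_module M U\<^esub> \<longleftrightarrow> x \<in> U"
proof -
  interpret U: additive_subgroup U M using U by (simp add: right_submodule_def)
  interpret U: abelian_subgroup U M
    by (rule abelian_subgroupI3[OF U.additive_subgroup_axioms M.abelian_group_axioms])
  note D = right_submoduleD[OF U]
  have surj: "(\<lambda>x. U +>\<^bsub>M\<^esub> x) ` carrier M = carrier (quot_module M U)"
    by (auto simp: quot_module_def A_RCOSETS_def')
  have add: "U +>\<^bsub>M\<^esub> (x \<oplus>\<^bsub>M\<^esub> y) = (U +>\<^bsub>M\<^esub> x) \<oplus>\<^bsub>quot_module M U\<^esub> (U +>\<^bsub>M\<^esub> y)"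
    if "x \<in> carrier M" "y \<in> carrier M" for x y
    using that by (simp add: quot_module_def U.a_rcos_sum)
  have act: "U +>\<^bsub>M\<^esub> (x \<lhd>\<^bsub>M\<^esub> a) = (U +>\<^bsub>M\<^esub> x) \<lhd>\<^bsub>quot_module M U\<^esub> a"
    if x: "x \<in> carrier M" and a: "a \<in> carrier R" for x a
  proof -
    \<comment> \<open>The action on a coset is a union over its representatives. It collapses to a
      single coset because y = u + x acts as ua + xa, with ua in U.\<close>
    have eq: "U +>\<^bsub>M\<^esub> (y \<lhd>\<^bsub>M\<^esub> a) = U +>\<^bsub>M\<^esub> (x \<lhd>\<^bsub>M\<^esub> a)" if y: "y \<in> U +>\<^bsub>M\<^esub> x" for y
    proof -
      obtain u where u: "u \<in> U" "y = u \<oplus>\<^bsub>M\<^esub> x" using y by (auto simp: a_r_coset_def')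
      then have "y \<lhd>\<^bsub>M\<^esub> a \<ominus>\<^bsub>M\<^esub> x \<lhd>\<^bsub>M\<^esub> a = u \<lhd>\<^bsub>M\<^esub> a"
        using x a D by (simp add: ract_add ract_closed M.minus_eq M.a_assoc M.r_neg)
      then show ?thesis using u x a D by (subst coset_eq_iff[OF U]) (auto simp: ract_closed)
    qed
    have "(\<Union>y\<in>U +>\<^bsub>M\<^esub> x. U +>\<^bsub>M\<^esub> (y \<lhd>\<^bsub>M\<^esub> a)) = U +>\<^bsub>M\<^esub> (x \<lhd>\<^bsub>M\<^esub> a)"
      by (rule UN_constant_eq[OF U.a_rcos_self[OF x]]) (intro ballI eq)
    then show ?thesis by (simp add: quot_module_def)
  qed
  have zero: "U +>\<^bsub>M\<^esub> \<zero>\<^bsub>M\<^esub> = \<zero>\<^bsub>quot_module M U\<^esub>"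
    by (simp add: quot_module_def U.a_subset)
  show "right_module R (quot_module M U)" by (rule right_module_image[OF surj add act zero])
  have cl: "U +>\<^bsub>M\<^esub> x \<in> carrier (quot_module M U)" if "x \<in> carrier M" for x using surj that by auto
  show "\<pi> \<in> rhom R M (quot_module M U)" unfolding \<pi>_def
    by (rule rhom_restrictI[OF right_module_axioms cl add act])
  show "\<pi> ` carrier M = carrier (quot_module M U)" using surj by (simp add: \<pi>_def)
  show "\<pi> x = \<zero>\<^bsub>quot_module M U\<^esub> \<longleftrightarrow> x \<in> U" if "x \<in> carrier M" for x
    using coset_eq_iff[OF U that M.zero_closed] minus_add_cancel[OF that M.zero_closed] that
    by (simp add: \<pi>_def zero[symmetric])
qed



text \<open>Coefficients are indexed from the end of the list, so that prepending a generator does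
  not shift those of the tail and inductions need no reindexing.\<close>

primrec lincomb :: "'b list \<Rightarrow> (nat \<Rightarrow> 'a) \<Rightarrow> 'b" where
  "lincomb [] v = \<zero>\<^bsub>M\<^esub>"
| "lincomb (x # xs) v = x \<lhd>\<^bsub>M\<^esub> v (length xs) \<oplus>\<^bsub>M\<^esub> lincomb xs v"

lemma lincomb_cong: "(\<And>i. i < length xs \<Longrightarrow> v i = w i) \<Longrightarrow> lincomb xs v = lincomb xs w"
  by (induction xs) auto

lemma lincomb_closed:
  "set xs \<subseteq> carrier M \<Longrightarrow> v \<in> UNIV \<rightarrow> carrier R \<Longrightarrow> lincomb xs v \<in> carrier M"
  by (induction xs) (auto simp: ract_closed Pi_iff)

lemma lincomb_zero: "set xs \<subseteq> carrier M \<Longrightarrow> lincomb xs (\<lambda>i. \<zero>\<^bsub>R\<^esub>) = \<zero>\<^bsub>M\<^esub>"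
  by (induction xs) (auto simp: ract_zero)

lemma lincomb_add:
  assumes "set xs \<subseteq> carrier M" "v \<in> UNIV \<rightarrow> carrier R" "w \<in> UNIV \<rightarrow> carrier R"
  shows "lincomb xs (\<lambda>i. v i \<oplus>\<^bsub>R\<^esub> w i) = lincomb xs v \<oplus>\<^bsub>M\<^esub> lincomb xs w"
  using assms(1)
proof (induction xs)
  case (Cons x xs)
  then show ?case using assms(2,3)
    by (simp add: ract_ring_add ract_closed lincomb_closed Pi_iff M.a_ac)
qed simp

lemma lincomb_ract:
  assumes "set xs \<subseteq> carrier M" "v \<in> UNIV \<rightarrow> carrier R" "a \<in> carrier R"
  shows "lincomb xs (\<lambda>i. v i \<otimes>\<^bsub>R\<^esub> a) = lincomb xs v \<lhd>\<^bsub>M\<^esub> a"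
  using assms(1)
proof (induction xs)
  case Nil
  then show ?case using assms by (simp add: zero_ract)
next
  case (Cons x xs)
  then show ?case using assms(2,3)
    by (simp add: ract_add ract_closed ract_assoc lincomb_closed Pi_iff)
qed

lemma lincomb_generator:
  "set xs \<subseteq> carrier M \<Longrightarrow> x \<in> set xs \<Longrightarrow> \<exists>v\<in>UNIV \<rightarrow> carrier R. lincomb xs v = x"
proof (induction xs)
  case (Cons y xs)
  show ?case
  proof (cases "x = y")
    case True
    let ?v = "\<lambda>i. if i = length xs then \<one>\<^bsub>R\<^esub> else \<zero>\<^bsub>R\<^esub>"
    have "lincomb xs ?v = \<zero>\<^bsub>M\<^esub>"
      using lincomb_cong[of xs ?v "\<lambda>i. \<zero>\<^bsub>R\<^esub>"] lincomb_zero[of xs] Cons by simp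
    then show ?thesis using Cons True by (intro bexI[of _ ?v]) (auto simp: ract_one)
  next
    case False
    then obtain v where v: "v \<in> UNIV \<rightarrow> carrier R" "lincomb xs v = x" using Cons by auto
    \<comment> \<open>The new head receives the coefficient zero. The tail never reads position
      \<open>length xs\<close>, so its value is unchanged.\<close>
    define w where "w = v(length xs := \<zero>\<^bsub>R\<^esub>)"
    have w: "w \<in> UNIV \<rightarrow> carrier R" "w (length xs) = \<zero>\<^bsub>R\<^esub>" using v by (auto simp: w_def)
    have "lincomb xs w = x" using lincomb_cong[of xs w v] v by (simp add: w_def)
    then show ?thesis using Cons w False by (intro bexI[of _ w]) (auto simp: ract_zero)
  qed
qed simp

lemma lincomb_surj:
  assumes xs: "set xs \<subseteq> carrier M"
    and gen: "\<And>U. right_submodule U R M \<Longrightarrow> set xs \<subseteq> U \<Longrightarrow> U = carrier M"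
    and "x \<in> carrier M"
  shows "\<exists>v\<in>UNIV \<rightarrow> carrier R. lincomb xs v = x"
proof -
  let ?S = "{lincomb xs v | v. v \<in> UNIV \<rightarrow> carrier R}"
  have "right_submodule ?S R M"
  proof (rule right_submoduleI, goal_cases)
    case 1 then show ?case using lincomb_closed[OF xs] by auto
  next
    case 2 then show ?case using lincomb_zero[OF xs] by force
  next
    case (3 x y)
    then obtain v w where vw: "v \<in> UNIV \<rightarrow> carrier R" "w \<in> UNIV \<rightarrow> carrier R"
      "x = lincomb xs v" "y = lincomb xs w" by auto
    then show ?case using lincomb_add[OF xs vw(1,2)]
      by (intro CollectI exI[of _ "\<lambda>i. v i \<oplus>\<^bsub>R\<^esub> w i"]) auto
  next
    case (4 x a)
    then obtain v where v: "v \<in> UNIV \<rightarrow> carrier R" "x = lincomb xs v" by auto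
    then show ?case using lincomb_ract[OF xs v(1) 4(2)] 4
      by (intro CollectI exI[of _ "\<lambda>i. v i \<otimes>\<^bsub>R\<^esub> a"]) auto
  qed
  then have "?S = carrier M" using gen lincomb_generator[OF xs] by blast
  then have "x \<in> ?S" using assms(3) by simp
  then show ?thesis by blast
qed

text \<open>An element is encoded by the set of its coefficient families with respect to a generating list,
  which has the type of the elements of a member of \<^const>\<open>fgmod\<close>.\<close>

lemma fgmod_copy:
  assumes fg: "finitely_generated R M"
  shows "\<exists>N\<in>fgmod R. \<exists>\<theta>. \<theta> \<in> riso R M N"
proof -
  obtain G where G: "finite G" "G \<subseteq> carrier M"
    "\<And>U. right_submodule U R M \<Longrightarrow> G \<subseteq> U \<Longrightarrow> U = carrier M"
    using fg by (auto simp: finitely_generated_def)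
  then obtain xs where xs: "set xs = G" using finite_list by blast
  define \<theta> where "\<theta> x = {v \<in> UNIV \<rightarrow> carrier R. lincomb xs v = x}" for x
  \<comment> \<open>The sets \<open>\<theta> x\<close> are fibres of one map, hence disjoint for
    different x; they are nonempty because the list generates M, and therefore distinct.\<close>
  have inj: "inj_on \<theta> (carrier M)"
  proof (rule inj_onI)
    fix x y assume "x \<in> carrier M" "y \<in> carrier M" "\<theta> x = \<theta> y"
    moreover obtain v where "v \<in> \<theta> x"
      using lincomb_surj[of xs x] G xs \<open>x \<in> carrier M\<close> by (auto simp: \<theta>_def)
    ultimately show "x = y" by (auto simp: \<theta>_def)
  qed
  define N :: "'a fgm" where "N = \<lparr>carrier = \<theta> ` carrier M, mult = undefined, one = undefined, zero = \<theta> \<zero>\<^bsub>M\<^esub>,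
    add = (\<lambda>u v. \<theta> (the_inv_into (carrier M) \<theta> u \<oplus>\<^bsub>M\<^esub> the_inv_into (carrier M) \<theta> v)),
    ract = (\<lambda>u a. \<theta> (the_inv_into (carrier M) \<theta> u \<lhd>\<^bsub>M\<^esub> a))\<rparr>"
  have inv: "the_inv_into (carrier M) \<theta> (\<theta> x) = x" if "x \<in> carrier M" for x
    using the_inv_into_f_f[OF inj that] .
  have surj: "\<theta> ` carrier M = carrier N" by (simp add: N_def)
  have add: "\<theta> (x \<oplus>\<^bsub>M\<^esub> y) = \<theta> x \<oplus>\<^bsub>N\<^esub> \<theta> y" if "x \<in> carrier M" "y \<in> carrier M" for x y
    using that by (simp add: N_def inv)
  have act: "\<theta> (x \<lhd>\<^bsub>M\<^esub> a) = \<theta> x \<lhd>\<^bsub>N\<^esub> a" if "x \<in> carrier M" "a \<in> carrier R" for x a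
    using that by (simp add: N_def inv)
  have zero: "\<theta> \<zero>\<^bsub>M\<^esub> = \<zero>\<^bsub>N\<^esub>" by (simp add: N_def)
  have "N \<in> fgmod R"
    using right_module_image[OF surj add act zero] finitely_generated_image[OF surj add act zero fg]
    by (simp add: fgmod_def)
  moreover have "(\<lambda>x\<in>carrier M. \<theta> x) \<in> riso R M N"
    using surj inj unfolding riso_def
    by (auto intro!: rhom_restrictI[OF right_module_axioms] add act simp: bij_betw_def)
  ultimately show ?thesis by blast
qed

end

section \<open>Chain conditions\<close>

text \<open>Takes the place of additivity of length: \<open>\<alpha>\<close> records the trace of a
  submodule on a part of the module, and \<open>\<beta>\<close> what remains, such as its image
  under a homomorphism.\<close>

lemma wf_lex_combine:
  assumes "wf r1" "wf r2"
    and "\<And>x y. (x, y) \<in> r \<Longrightarrow> (\<alpha> x, \<alpha> y) \<in> r1 \<or> \<alpha> x = \<alpha> y \<and> (\<beta> x, \<beta> y) \<in> r2"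
  shows "wf r"
proof (rule wf_subset)
  show "wf (inv_image (r1 <*lex*> r2) (\<lambda>x. (\<alpha> x, \<beta> x)))"
    by (intro wf_inv_image wf_lex_prod assms(1,2))
  show "r \<subseteq> inv_image (r1 <*lex*> r2) (\<lambda>x. (\<alpha> x, \<beta> x))"
    using assms(3) by (auto simp: inv_image_def)
qed

lemma right_module_regular:
  assumes "ring R"
  shows "right_module R (restricted_module id R)"
proof -
  interpret ring R by fact
  have "abelian_group (restricted_module id R)"
  proof (rule abelian_groupI, goal_cases)
    case (6 x) then show ?case
      by (auto simp: restricted_module_def l_neg intro!: bexI[of _ "\<ominus>\<^bsub>R\<^esub> x"])
  qed (auto simp: restricted_module_def a_ac)
  then show ?thesis using assms
    by (auto simp: right_module_def right_module_axioms_def restricted_module_def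
      l_distr r_distr m_assoc)
qed

lemma wf_minimal: "wf r \<Longrightarrow> x \<in> Q \<Longrightarrow> \<exists>z\<in>Q. \<forall>y. (y, z) \<in> r \<longrightarrow> y \<notin> Q"
  unfolding wf_eq_minimal by blast

text \<open>Well-foundedness of this relation is the descending chain condition below A, and that of
  its converse the ascending one. The bound A is a parameter so that smaller submodules are compared
  within one fixed M.\<close>

definition submod_desc :: "'a ring \<Rightarrow> ('a, 'b) rmodule \<Rightarrow> 'b set \<Rightarrow> ('b set \<times> 'b set) set" where
  "submod_desc R M A =
     {(U, V). right_submodule U R M \<and> right_submodule V R M \<and> U \<subset> V \<and> V \<subseteq> A}"

definition submod_asc :: "'a ring \<Rightarrow> ('a, 'b) rmodule \<Rightarrow> 'b set \<Rightarrow> ('b set \<times> 'b set) set" where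
  "submod_asc R M A = (submod_desc R M A)\<inverse>"

lemma submod_asc_iff:
  "(V, U) \<in> submod_asc R M A \<longleftrightarrow>
     right_submodule U R M \<and> right_submodule V R M \<and> U \<subset> V \<and> V \<subseteq> A"
  by (simp add: submod_asc_def submod_desc_def)

lemma submod_desc_iff:
  "(U, V) \<in> submod_desc R M A \<longleftrightarrow>
     right_submodule U R M \<and> right_submodule V R M \<and> U \<subset> V \<and> V \<subseteq> A"
  by (simp add: submod_desc_def)

lemma wf_submod_asc_mono: "wf (submod_asc R M B) \<Longrightarrow> A \<subseteq> B \<Longrightarrow> wf (submod_asc R M A)"
  by (erule wf_subset) (force simp: submod_asc_def submod_desc_def)

context rmod
begin

text \<open>Noetherianity of an extension: nested submodules with the same kernel part and the same
  image coincide, so each proper inclusion enlarges one of the two.\<close>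

lemma wf_submod_asc_hom:
  assumes N: "right_module R N" and g: "g \<in> rhom R M N" and A: "right_submodule A R M"
    and ker: "wf (submod_asc R M {x \<in> A. g x = \<zero>\<^bsub>N\<^esub>})" and im: "wf (submod_asc R N (g ` A))"
  shows "wf (submod_asc R M A)"
proof (rule wf_lex_combine[OF ker im])
  interpret N: rmod R N by (rule rmod.intro) fact
  fix V U assume "(V, U) \<in> submod_asc R M A"
  then have U: "right_submodule U R M" and V: "right_submodule V R M"
    and UV: "U \<subset> V" "V \<subseteq> A" by (auto simp: submod_asc_iff)
  let ?k = "\<lambda>U. U \<inter> {x \<in> carrier M. g x = \<zero>\<^bsub>N\<^esub>}"
  have sub: "right_submodule (?k U) R M" "right_submodule (?k V) R M"
    using U V right_submodule_kernel[OF right_module_axioms N g] by (auto intro: right_submodule_Int)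
  have "g ` U \<noteq> g ` V" if eq: "?k V = ?k U"
  proof
    assume im: "g ` U = g ` V"
    have "v \<in> U" if v: "v \<in> V" for v
    proof -
      obtain u where u: "u \<in> U" "g v = g u" using im v by auto
      have c: "u \<in> carrier M" "v \<in> carrier M" "u \<in> V"
        using right_submoduleD(1)[OF U] right_submoduleD(1)[OF V] u v UV by auto
      then have "v \<ominus>\<^bsub>M\<^esub> u \<in> ?k V" using u v right_submoduleD(6)[OF V]
        by (auto simp: rhom_minus[OF g right_module_axioms N] N.minus_self rhomD[OF g])
      then have "v \<ominus>\<^bsub>M\<^esub> u \<in> U" using eq by auto
      then show "v \<in> U" using right_submoduleD(3)[OF U _ u(1)] minus_add_cancel[OF c(2,1)] by metis
    qed
    then show False using UV by auto
  qed
  moreover have "right_submodule (g ` U) R N" "right_submodule (g ` V) R N"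
    using U V by (auto intro: right_submodule_image[OF right_module_axioms N g])
  ultimately show "(?k V, ?k U) \<in> submod_asc R M {x \<in> A. g x = \<zero>\<^bsub>N\<^esub>} \<or>
      ?k V = ?k U \<and> (g ` V, g ` U) \<in> submod_asc R N (g ` A)"
    using sub UV unfolding submod_asc_iff psubset_eq by blast
qed

text \<open>Adjoining one generator x. Among nested submodules, one is determined by its trace on A
  together with the right ideal of those c for which xc occurs in it modulo A. This ideal stands in
  for the image in a cyclic quotient, so that no quotient has to be formed.\<close>

lemma wf_submod_desc_adjoin:
  assumes A: "right_submodule A R M" and x: "x \<in> carrier M"
    and dcc: "wf (submod_desc R M A)" and reg: "wf (submod_desc R (restricted_module id R) (carrier R))"
  shows "wf (submod_desc R M {a \<oplus>\<^bsub>M\<^esub> x \<lhd>\<^bsub>M\<^esub> c | a c. a \<in> A \<and> c \<in> carrier R})"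
    (is "wf (submod_desc R M ?B)")
proof (rule wf_lex_combine[OF dcc reg])
  interpret Reg: rmod R "restricted_module id R"
    by (rule rmod.intro, rule right_module_regular[OF R.ring_axioms])
  fix U V assume "(U, V) \<in> submod_desc R M ?B"
  then have U: "right_submodule U R M" and V: "right_submodule V R M"
    and UV: "U \<subset> V" "V \<subseteq> ?B" by (auto simp: submod_desc_iff)
  note AD = right_submoduleD[OF A] and UD = right_submoduleD[OF U] and VD = right_submoduleD[OF V]
  let ?c = "\<lambda>U. {c \<in> carrier R. \<exists>a\<in>A. a \<oplus>\<^bsub>M\<^esub> x \<lhd>\<^bsub>M\<^esub> c \<in> U}"
  have sub: "right_submodule (?c W) R (restricted_module id R)" if W: "right_submodule W R M" for W
  proof (rule Reg.right_submoduleI, goal_cases)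
    case 1 then show ?case by (auto simp: restricted_module_def)
  next
    case 2 then show ?case using AD(2) right_submoduleD(2)[OF W] x
      by (auto simp: restricted_module_def ract_zero intro!: bexI[of _ "\<zero>\<^bsub>M\<^esub>"])
  next
    case (3 c d)
    then obtain a b where *: "c \<in> carrier R" "d \<in> carrier R" "a \<in> A" "b \<in> A"
      "a \<oplus>\<^bsub>M\<^esub> x \<lhd>\<^bsub>M\<^esub> c \<in> W" "b \<oplus>\<^bsub>M\<^esub> x \<lhd>\<^bsub>M\<^esub> d \<in> W" by auto
    then have "(a \<oplus>\<^bsub>M\<^esub> b) \<oplus>\<^bsub>M\<^esub> x \<lhd>\<^bsub>M\<^esub> (c \<oplus>\<^bsub>R\<^esub> d) = (a \<oplus>\<^bsub>M\<^esub> x \<lhd>\<^bsub>M\<^esub> c) \<oplus>\<^bsub>M\<^esub> (b \<oplus>\<^bsub>M\<^esub> x \<lhd>\<^bsub>M\<^esub> d)"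
      using x AD(1) by (simp add: ract_ring_add ract_closed M.a_ac)
    then show ?case using * AD(3) right_submoduleD(3)[OF W]
      by (auto simp: restricted_module_def intro!: bexI[of _ "a \<oplus>\<^bsub>M\<^esub> b"])
  next
    case (4 c d)
    then obtain a where *: "c \<in> carrier R" "a \<in> A" "a \<oplus>\<^bsub>M\<^esub> x \<lhd>\<^bsub>M\<^esub> c \<in> W" by auto
    then have "a \<lhd>\<^bsub>M\<^esub> d \<oplus>\<^bsub>M\<^esub> x \<lhd>\<^bsub>M\<^esub> (c \<otimes>\<^bsub>R\<^esub> d) = (a \<oplus>\<^bsub>M\<^esub> x \<lhd>\<^bsub>M\<^esub> c) \<lhd>\<^bsub>M\<^esub> d"
      using x AD(1) 4 by (simp add: ract_assoc ract_closed ract_add)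
    then show ?case using * 4 AD(4) right_submoduleD(4)[OF W]
      by (auto simp: restricted_module_def intro!: bexI[of _ "a \<lhd>\<^bsub>M\<^esub> d"])
  qed
  have "?c U \<noteq> ?c V" if eq: "U \<inter> A = V \<inter> A"
  proof
    assume im: "?c U = ?c V"
    have "v \<in> U" if v: "v \<in> V" for v
    proof -
      obtain a c where ac: "a \<in> A" "c \<in> carrier R" "v = a \<oplus>\<^bsub>M\<^esub> x \<lhd>\<^bsub>M\<^esub> c" using UV v by blast
      then have "c \<in> ?c U" using im v by auto
      then obtain b where b: "b \<in> A" "b \<oplus>\<^bsub>M\<^esub> x \<lhd>\<^bsub>M\<^esub> c \<in> U" by auto
      let ?u = "b \<oplus>\<^bsub>M\<^esub> x \<lhd>\<^bsub>M\<^esub> c"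
      have cc: "a \<in> carrier M" "b \<in> carrier M" "x \<lhd>\<^bsub>M\<^esub> c \<in> carrier M"
        using AD ac b x by (auto simp: ract_closed)
      have "v \<ominus>\<^bsub>M\<^esub> ?u = a \<ominus>\<^bsub>M\<^esub> b" using cc ac
        by (simp add: M.minus_eq M.minus_add M.a_ac M.r_neg1 M.r_neg2 M.r_neg M.l_neg)
      moreover have "v \<ominus>\<^bsub>M\<^esub> ?u \<in> V" using VD(6)[OF v] b UV by blast
      ultimately have "v \<ominus>\<^bsub>M\<^esub> ?u \<in> U" using eq AD(6)[OF ac(1) b(1)] by auto
      then show "v \<in> U" using UD(3)[OF _ b(2)] minus_add_cancel[OF VD(1)[OF v] UD(1)[OF b(2)]] by metis
    qed
    then show False using UV by auto
  qed
  moreover have "?c U \<subseteq> ?c V" "U \<inter> A \<subseteq> V \<inter> A" using UV by auto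
  moreover have "right_submodule (U \<inter> A) R M" "right_submodule (V \<inter> A) R M"
    using U V A by (auto intro: right_submodule_Int)
  ultimately show "(U \<inter> A, V \<inter> A) \<in> submod_desc R M A \<or>
      U \<inter> A = V \<inter> A \<and> (?c U, ?c V) \<in> submod_desc R (restricted_module id R) (carrier R)"
    using sub[OF U] sub[OF V] unfolding submod_desc_iff psubset_eq by blast
qed

lemma wf_submod_desc_fg:
  assumes fg: "finitely_generated R M"
    and reg: "wf (submod_desc R (restricted_module id R) (carrier R))"
  shows "wf (submod_desc R M (carrier M))"
proof -
  obtain G where G: "finite G" "G \<subseteq> carrier M"
    "\<And>U. right_submodule U R M \<Longrightarrow> G \<subseteq> U \<Longrightarrow> U = carrier M"
    using fg by (auto simp: finitely_generated_def)
  \<comment> \<open>The induction tracks some artinian submodule that contains the generators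
    treated so far, not their exact span. For all generators it can only be the whole
    module.\<close>
  have "\<exists>A. right_submodule A R M \<and> G \<subseteq> A \<and> wf (submod_desc R M A)"
    using G(1,2)
  proof (induction G rule: finite_induct)
    case empty
    have "submod_desc R M {\<zero>\<^bsub>M\<^esub>} = {}"
      using right_submoduleD(2) by (auto simp: submod_desc_def)
    then show ?case using right_submodule_zero by (intro exI[of _ "{\<zero>\<^bsub>M\<^esub>}"]) simp
  next
    case (insert x G)
    then obtain A where A: "right_submodule A R M" "G \<subseteq> A" "wf (submod_desc R M A)" by auto
    have x: "x \<in> carrier M" using insert by simp
    let ?B = "{a \<oplus>\<^bsub>M\<^esub> b | a b. a \<in> A \<and> b \<in> (\<lambda>c. x \<lhd>\<^bsub>M\<^esub> c) ` carrier R}"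
    have B: "right_submodule ?B R M"
      by (rule right_submodule_sum[OF A(1) right_submodule_cyclic[OF x]])
    have "?B = {a \<oplus>\<^bsub>M\<^esub> x \<lhd>\<^bsub>M\<^esub> c | a c. a \<in> A \<and> c \<in> carrier R}" by auto
    then have "wf (submod_desc R M ?B)" using wf_submod_desc_adjoin[OF A(1) x A(3) reg] by simp
    moreover have "x \<in> ?B"
      using x right_submoduleD(2)[OF A(1)] ract_one[OF x]
      by (intro CollectI exI[of _ "\<zero>\<^bsub>M\<^esub>"] exI[of _ x]) (auto intro!: image_eqI[of _ _ "\<one>\<^bsub>R\<^esub>"])
    moreover have "G \<subseteq> ?B"
    proof
      fix y assume "y \<in> G"
      then have y: "y \<in> A" "y \<in> carrier M" using A(2) right_submoduleD(1)[OF A(1)] by auto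
      then show "y \<in> ?B"
        using ract_zero[OF x]
        by (intro CollectI exI[of _ y] exI[of _ "\<zero>\<^bsub>M\<^esub>"]) (auto intro!: image_eqI[of _ _ "\<zero>\<^bsub>R\<^esub>"])
    qed
    ultimately show ?case using B by (intro exI[of _ ?B]) simp
  qed
  then show ?thesis using G(3) by metis
qed

lemma commuting_ract_rhom:
  assumes "x \<in> carrier R" "\<And>a. a \<in> carrier R \<Longrightarrow> a \<otimes>\<^bsub>R\<^esub> x = x \<otimes>\<^bsub>R\<^esub> a"
  shows "(\<lambda>v\<in>carrier M. v \<lhd>\<^bsub>M\<^esub> x) \<in> rhom R M M"
  by (rule rhom_restrictI[OF right_module_axioms])
    (simp_all add: assms ract_closed ract_add ract_assoc[symmetric])

text \<open>Over a commutative artinian ring, a module minimal among those with the descending but without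
  the ascending chain condition would be a vector space over a residue field: every scalar acts on
  it as zero or invertibly. A hyperplane in it satisfies the ascending chain condition by minimality.\<close>

lemma wf_submod_asc_if_desc:
  assumes comm: "cring R" and reg: "wf (submod_desc R (restricted_module id R) (carrier R))"
    and dcc: "wf (submod_desc R M (carrier M))"
  shows "wf (submod_asc R M (carrier M))"
proof (rule ccontr)
  interpret C: cring R by fact
  interpret Reg: rmod R "restricted_module id R"
    by (rule rmod.intro, rule right_module_regular[OF R.ring_axioms])
  assume "\<not> ?thesis"
  then have "carrier M \<in> {I. right_submodule I R M \<and> \<not> wf (submod_asc R M I)}"
    using right_submodule_carrier by simp
  from wfE_min[OF dcc this] obtain I where I: "right_submodule I R M" "\<not> wf (submod_asc R M I)"
    and min: "\<And>J. (J, I) \<in> submod_desc R M (carrier M) \<Longrightarrow>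
      J \<notin> {I. right_submodule I R M \<and> \<not> wf (submod_asc R M I)}" by blast
  note ID = right_submoduleD[OF I(1)]
  have proper: "wf (submod_asc R M J)" if "right_submodule J R M" "J \<subset> I" for J
    using min[of J] that I(1) ID(1) by (auto simp: submod_desc_iff)
  have act: "(\<forall>v\<in>I. v \<lhd>\<^bsub>M\<^esub> x = \<zero>\<^bsub>M\<^esub>) \<or> (\<exists>y\<in>carrier R. \<forall>v\<in>I. (v \<lhd>\<^bsub>M\<^esub> x) \<lhd>\<^bsub>M\<^esub> y = v)"
    if x: "x \<in> carrier R" for x
  proof (cases "\<forall>v\<in>I. v \<lhd>\<^bsub>M\<^esub> x = \<zero>\<^bsub>M\<^esub>")
    case False
    let ?g = "\<lambda>v\<in>carrier M. v \<lhd>\<^bsub>M\<^esub> x"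
    have g: "?g \<in> rhom R M M" by (rule commuting_ract_rhom) (auto simp: x C.m_comm)
    let ?J = "{v \<in> I. ?g v = \<zero>\<^bsub>M\<^esub>}"
    have J: "?J = I \<inter> {v \<in> carrier M. ?g v = \<zero>\<^bsub>M\<^esub>}" using ID(1) by auto
    have "right_submodule ?J R M" unfolding J
      by (intro right_submodule_Int I right_submodule_kernel[OF right_module_axioms right_module_axioms g])
    moreover have "?J \<subset> I" using False ID(1) by auto
    ultimately have wJ: "wf (submod_asc R M ?J)" by (rule proper)
    have im: "right_submodule (?g ` I) R M"
      by (rule right_submodule_image[OF right_module_axioms right_module_axioms g I(1)])
    have sub: "?g ` I \<subseteq> I" using ID(1,4) x by auto
    \<comment> \<open>The kernel is a proper submodule and so has the ascending chain condition. If
      the image had it as well, so would I. By minimality of I the image is then all of I.\<close>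
    have "\<not> wf (submod_asc R M (?g ` I))"
      using wf_submod_asc_hom[OF right_module_axioms g I(1) wJ] I(2) by blast
    then have "?g ` I = I" using proper[OF im] sub by blast
    then have s: "\<exists>w\<in>I. v = w \<lhd>\<^bsub>M\<^esub> x" if "v \<in> I" for v using that ID(1) by force
    have pow: "\<exists>w\<in>I. v = w \<lhd>\<^bsub>M\<^esub> (x [^]\<^bsub>R\<^esub> n)" if "v \<in> I" for v and n :: nat
      using that
    proof (induction n arbitrary: v)
      case 0 then show ?case using ID(1) by (auto simp: ract_one)
    next
      case (Suc n)
      then obtain u where u: "u \<in> I" "v = u \<lhd>\<^bsub>M\<^esub> x" using s by blast
      then obtain w where w: "w \<in> I" "u = w \<lhd>\<^bsub>M\<^esub> (x [^]\<^bsub>R\<^esub> n)" using Suc.IH by blast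
      then show ?case using u x ID(1)[OF w(1)]
        by (intro bexI[of _ w]) (simp_all add: ract_assoc)
    qed
    \<comment> \<open>The principal ideals generated by powers of x have a minimal member, whence
      x^n = x^(n+1) y. Every v in I has the form w x^n because x acts surjectively, so y undoes x on
      I.\<close>
    let ?P = "\<lambda>n::nat. (\<lambda>a. (x [^]\<^bsub>R\<^esub> n) \<lhd>\<^bsub>restricted_module id R\<^esub> a) ` carrier R"
    have P: "right_submodule (?P n) R (restricted_module id R)" for n :: nat
      by (rule Reg.right_submodule_cyclic) (simp add: restricted_module_def x)
    define Q where "Q = range ?P"
    have "?P 0 \<in> Q" unfolding Q_def by (rule rangeI)
    from wf_minimal[OF reg this] obtain Z where Z: "Z \<in> Q"
      "\<forall>Y. (Y, Z) \<in> submod_desc R (restricted_module id R) (carrier R) \<longrightarrow> Y \<notin> Q"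
      by blast
    then obtain n where n: "Z = ?P n" by (auto simp: Q_def)
    have "?P (Suc n) \<in> Q" unfolding Q_def by (rule rangeI)
    with Z(2) n have not_desc: "(?P (Suc n), ?P n) \<notin> submod_desc R (restricted_module id R) (carrier R)"
      by blast
    have "?P (Suc n) \<subseteq> ?P n"
    proof
      fix z assume "z \<in> ?P (Suc n)"
      then obtain a where "a \<in> carrier R" "z = (x [^]\<^bsub>R\<^esub> n \<otimes>\<^bsub>R\<^esub> x) \<otimes>\<^bsub>R\<^esub> a"
        by (auto simp: restricted_module_def)
      then show "z \<in> ?P n" using x
        by (intro image_eqI[of _ _ "x \<otimes>\<^bsub>R\<^esub> a"]) (simp_all add: restricted_module_def R.m_assoc)
    qed
    moreover have "?P n \<subseteq> carrier R" using x by (auto simp: restricted_module_def)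
    ultimately have "?P (Suc n) = ?P n"
      using not_desc P[of n] P[of "Suc n"] unfolding submod_desc_iff by blast
    moreover have "x [^]\<^bsub>R\<^esub> n \<in> ?P n"
      using x by (intro image_eqI[of _ _ "\<one>\<^bsub>R\<^esub>"]) (simp_all add: restricted_module_def)
    ultimately have "x [^]\<^bsub>R\<^esub> n \<in> ?P (Suc n)" by simp
    then obtain y where y: "y \<in> carrier R" "x [^]\<^bsub>R\<^esub> n = (x [^]\<^bsub>R\<^esub> n \<otimes>\<^bsub>R\<^esub> x) \<otimes>\<^bsub>R\<^esub> y"
      by (auto simp: restricted_module_def)
    have "(v \<lhd>\<^bsub>M\<^esub> x) \<lhd>\<^bsub>M\<^esub> y = v" if v: "v \<in> I" for v
    proof -
      obtain w where w: "w \<in> I" "v = w \<lhd>\<^bsub>M\<^esub> (x [^]\<^bsub>R\<^esub> n)" using pow v by blast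
      have "(v \<lhd>\<^bsub>M\<^esub> x) \<lhd>\<^bsub>M\<^esub> y = w \<lhd>\<^bsub>M\<^esub> ((x [^]\<^bsub>R\<^esub> n \<otimes>\<^bsub>R\<^esub> x) \<otimes>\<^bsub>R\<^esub> y)"
        using w ID(1)[OF w(1)] x y(1) by (simp add: ract_assoc ract_closed)
      then show ?thesis using y(2) w(2) by metis
    qed
    then show ?thesis using y(1) by blast
  qed simp
  have "\<exists>v\<in>I. v \<noteq> \<zero>\<^bsub>M\<^esub>"
  proof (rule ccontr)
    assume "\<not> ?thesis"
    then have "submod_asc R M I = {}" using right_submoduleD(2) by (fastforce simp: submod_asc_iff)
    then show False using I(2) by simp
  qed
  then obtain v where v: "v \<in> I" "v \<noteq> \<zero>\<^bsub>M\<^esub>" by blast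
  \<comment> \<open>A maximal submodule W of I avoiding v is the hyperplane. It comes from Zorn's
    lemma, since I lacks the ascending chain condition.\<close>
  let ?W = "{W. right_submodule W R M \<and> W \<subseteq> I \<and> v \<notin> W}"
  have "\<exists>W\<in>?W. \<forall>X\<in>?W. W \<subseteq> X \<longrightarrow> X = W"
  proof (rule subset_Zorn_nonempty)
    show "?W \<noteq> {}" using right_submodule_zero ID(2) v by blast
    fix \<C> assume "\<C> \<noteq> {}" and ch: "subset.chain ?W \<C>"
    then obtain W0 where W0: "W0 \<in> \<C>" by auto
    have C: "right_submodule W R M" "W \<subseteq> I" "v \<notin> W" if "W \<in> \<C>" for W
      using ch that by (auto simp: subset.chain_def)
    have "right_submodule (\<Union>\<C>) R M"
    proof (rule right_submoduleI, goal_cases)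
      case 1 show ?case using C(2) ID(1) by blast
    next
      case 2 show ?case using W0 right_submoduleD(2)[OF C(1)[OF W0]] by blast
    next
      case (3 x y)
      then obtain A B where AB: "x \<in> A" "A \<in> \<C>" "y \<in> B" "B \<in> \<C>" by blast
      have "A \<subseteq> B \<or> B \<subseteq> A" using ch AB by (auto simp: subset.chain_def)
      then show ?case using AB right_submoduleD(3)[OF C(1)[OF AB(2)]]
        right_submoduleD(3)[OF C(1)[OF AB(4)]] by blast
    next
      case (4 x a)
      then show ?case using right_submoduleD(4)[OF C(1)] by blast
    qed
    then show "\<Union>\<C> \<in> ?W" using C by blast
  qed
  then obtain W where W: "right_submodule W R M" "W \<subseteq> I" "v \<notin> W"
    and Wmax: "\<And>X. right_submodule X R M \<Longrightarrow> X \<subseteq> I \<Longrightarrow> v \<notin> X \<Longrightarrow> W \<subseteq> X \<Longrightarrow> X = W" by auto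
  note WD = right_submoduleD[OF W(1)]
  have wW: "wf (submod_asc R M W)" using proper W v by blast
  \<comment> \<open>By maximality v = w + uc lies in W + uR. As v is not in W, uc is nonzero, so c
    acts invertibly and u is a multiple of v modulo W: the quotient I/W is a line.\<close>
  have span: "\<exists>w\<in>W. \<exists>c\<in>carrier R. \<exists>y\<in>carrier R. v = w \<oplus>\<^bsub>M\<^esub> u \<lhd>\<^bsub>M\<^esub> c \<and> u = (v \<ominus>\<^bsub>M\<^esub> w) \<lhd>\<^bsub>M\<^esub> y"
    if u: "u \<in> I" "u \<notin> W" for u
  proof -
    have uc: "u \<in> carrier M" using ID(1) u by auto
    let ?X = "{a \<oplus>\<^bsub>M\<^esub> b | a b. a \<in> W \<and> b \<in> (\<lambda>c. u \<lhd>\<^bsub>M\<^esub> c) ` carrier R}"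
    have X: "right_submodule ?X R M"
      by (rule right_submodule_sum[OF W(1) right_submodule_cyclic[OF uc]])
    have "u \<in> ?X" using uc WD(2) ract_one[OF uc]
      by (intro CollectI exI[of _ "\<zero>\<^bsub>M\<^esub>"] exI[of _ u]) (auto intro!: image_eqI[of _ _ "\<one>\<^bsub>R\<^esub>"])
    moreover have "W \<subseteq> ?X"
    proof
      fix y assume "y \<in> W"
      then show "y \<in> ?X" using ract_zero[OF uc] WD(1)
        by (intro CollectI exI[of _ y] exI[of _ "\<zero>\<^bsub>M\<^esub>"]) (auto intro!: image_eqI[of _ _ "\<zero>\<^bsub>R\<^esub>"])
    qed
    moreover have "?X \<subseteq> I" using ID(3,4) u(1) W(2) by blast
    ultimately have "v \<in> ?X" using Wmax[OF X] u(2) by blast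
    then obtain w c where wc: "w \<in> W" "c \<in> carrier R" "v = w \<oplus>\<^bsub>M\<^esub> u \<lhd>\<^bsub>M\<^esub> c" by blast
    have "u \<lhd>\<^bsub>M\<^esub> c \<noteq> \<zero>\<^bsub>M\<^esub>" using wc WD(1) W(3) by auto
    then obtain y where y: "y \<in> carrier R" "(u \<lhd>\<^bsub>M\<^esub> c) \<lhd>\<^bsub>M\<^esub> y = u" using act[OF wc(2)] u(1) by blast
    have "v \<ominus>\<^bsub>M\<^esub> w = u \<lhd>\<^bsub>M\<^esub> c" using wc WD(1)[OF wc(1)] ract_closed[OF uc wc(2)]
      by (simp add: M.minus_eq M.a_ac M.r_neg1 M.r_neg2 M.r_neg)
    then have "u = (v \<ominus>\<^bsub>M\<^esub> w) \<lhd>\<^bsub>M\<^esub> y" using y by simp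
    then show ?thesis using wc y(1) by blast
  qed
  \<comment> \<open>Since I/W is a line, what remains besides the trace on W is one bit, namely
    whether the submodule lies in W. Along an ascending chain with constant trace this bit switches
    at most once.\<close>
  have "wf (submod_asc R M I)"
  proof (rule wf_lex_combine[OF wW])
    show "wf {(False, True)}" by (rule wf_subset[of "measure (\<lambda>b. if b then 1 else 0)"]) auto
    fix V U assume "(V, U) \<in> submod_asc R M I"
    then have U: "right_submodule U R M" and V: "right_submodule V R M"
      and UV: "U \<subset> V" "V \<subseteq> I" by (auto simp: submod_asc_iff)
    note UD = right_submoduleD[OF U] and VD = right_submoduleD[OF V]
    \<comment> \<open>Otherwise some u in U lies outside W. Then any b in V outside U is also
      outside W and differs from a multiple of u by an element of V \<inter> W, which is U \<inter>
      W, so b would be in U.\<close>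
    have "U \<subseteq> W" if eq: "V \<inter> W = U \<inter> W"
    proof (rule ccontr)
      assume "\<not> U \<subseteq> W"
      then obtain u where u: "u \<in> U" "u \<notin> W" by auto
      obtain b where b: "b \<in> V" "b \<notin> U" using UV by auto
      then have "b \<notin> W" using eq by auto
      obtain w c where wc: "w \<in> W" "c \<in> carrier R" "v = w \<oplus>\<^bsub>M\<^esub> u \<lhd>\<^bsub>M\<^esub> c"
        using span[of u] u UV by blast
      obtain w' y where wy: "w' \<in> W" "y \<in> carrier R" "b = (v \<ominus>\<^bsub>M\<^esub> w') \<lhd>\<^bsub>M\<^esub> y"
        using span[of b] b UV \<open>b \<notin> W\<close> by blast
      have cc: "w \<in> carrier M" "w' \<in> carrier M" "u \<in> carrier M" "u \<lhd>\<^bsub>M\<^esub> c \<in> carrier M" "b \<in> carrier M"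
        using WD(1) wc wy UD(1) u b VD(1) by (auto simp: ract_closed)
      let ?e = "(u \<lhd>\<^bsub>M\<^esub> c) \<lhd>\<^bsub>M\<^esub> y"
      have "v \<ominus>\<^bsub>M\<^esub> w' = (w \<ominus>\<^bsub>M\<^esub> w') \<oplus>\<^bsub>M\<^esub> u \<lhd>\<^bsub>M\<^esub> c" using cc wc(3)
        by (simp add: M.minus_eq M.a_ac)
      then have "b = (w \<ominus>\<^bsub>M\<^esub> w') \<lhd>\<^bsub>M\<^esub> y \<oplus>\<^bsub>M\<^esub> ?e" using wy cc by (simp add: ract_add)
      then have "b \<ominus>\<^bsub>M\<^esub> ?e = (w \<ominus>\<^bsub>M\<^esub> w') \<lhd>\<^bsub>M\<^esub> y" using cc wy(2)
        by (simp add: M.minus_eq M.a_assoc M.r_neg ract_closed)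
      moreover have "(w \<ominus>\<^bsub>M\<^esub> w') \<lhd>\<^bsub>M\<^esub> y \<in> W" using wc wy WD by auto
      moreover have e: "?e \<in> U" using UD(4) u wc wy by auto
      moreover have "?e \<in> V" using e UV by blast
      then have "b \<ominus>\<^bsub>M\<^esub> ?e \<in> V" by (rule VD(6)[OF b(1)])
      ultimately have "b \<ominus>\<^bsub>M\<^esub> ?e \<in> V \<inter> W" by simp
      then have "b \<ominus>\<^bsub>M\<^esub> ?e \<in> U" using eq by blast
      then have "(b \<ominus>\<^bsub>M\<^esub> ?e) \<oplus>\<^bsub>M\<^esub> ?e \<in> U" by (rule UD(3)[OF _ e])
      then have "b \<in> U" using minus_add_cancel[OF cc(5) UD(1)[OF e]] by simp
      then show False using b by simp
    qed
    moreover have "\<not> V \<subseteq> W" if "V \<inter> W = U \<inter> W" using UV that by blast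
    moreover have "right_submodule (V \<inter> W) R M" "right_submodule (U \<inter> W) R M"
      using U V W by (auto intro: right_submodule_Int)
    ultimately show "(V \<inter> W, U \<inter> W) \<in> submod_asc R M W \<or>
      V \<inter> W = U \<inter> W \<and> (V \<subseteq> W, U \<subseteq> W) \<in> {(False, True)}"
      using UV unfolding submod_asc_iff psubset_eq by blast
  qed
  then show False using I(2) by simp
qed

text \<open>The chain condition yields a maximal finitely generated submodule of U. It is U itself,
  for otherwise one further generator would enlarge it.\<close>

lemma finitely_generated_sub:
  assumes acc: "wf (submod_asc R M (carrier M))" and U: "right_submodule U R M"
  shows "finitely_generated R (M\<lparr>carrier := U\<rparr>)"
proof -
  let ?Q = "{V. right_submodule V R M \<and> V \<subseteq> U \<and>
    (\<exists>G. finite G \<and> G \<subseteq> V \<and> (\<forall>X. right_submodule X R M \<and> G \<subseteq> X \<longrightarrow> V \<subseteq> X))}"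
  have ne: "{\<zero>\<^bsub>M\<^esub>} \<in> ?Q"
    using right_submodule_zero right_submoduleD(2) U by (auto intro!: exI[of _ "{}"])
  from wf_minimal[OF acc ne] obtain V where V: "V \<in> ?Q"
    and max: "\<forall>X. (X, V) \<in> submod_asc R M (carrier M) \<longrightarrow> X \<notin> ?Q"
    by (rule bexE) (rule that)
  from V have sV: "right_submodule V R M" "V \<subseteq> U" by auto
  from V obtain G where G: "finite G" "G \<subseteq> V" "\<And>X. right_submodule X R M \<Longrightarrow> G \<subseteq> X \<Longrightarrow> V \<subseteq> X"
    by auto
  have "V = U"
  proof (rule ccontr)
    assume "V \<noteq> U"
    then obtain x where x: "x \<in> U" "x \<notin> V" using sV by blast
    have xc: "x \<in> carrier M" using right_submoduleD(1)[OF U] x by simp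
    let ?X = "{a \<oplus>\<^bsub>M\<^esub> b | a b. a \<in> V \<and> b \<in> (\<lambda>c. x \<lhd>\<^bsub>M\<^esub> c) ` carrier R}"
    have X: "right_submodule ?X R M"
      by (rule right_submodule_sum[OF sV(1) right_submodule_cyclic[OF xc]])
    have xX: "x \<in> ?X" using xc right_submoduleD(2)[OF sV(1)] ract_one[OF xc]
      by (intro CollectI exI[of _ "\<zero>\<^bsub>M\<^esub>"] exI[of _ x]) (auto intro!: image_eqI[of _ _ "\<one>\<^bsub>R\<^esub>"])
    have VX: "V \<subseteq> ?X"
    proof
      fix y assume "y \<in> V"
      then show "y \<in> ?X" using ract_zero[OF xc] right_submoduleD(1)[OF sV(1)]
        by (intro CollectI exI[of _ y] exI[of _ "\<zero>\<^bsub>M\<^esub>"]) (auto intro!: image_eqI[of _ _ "\<zero>\<^bsub>R\<^esub>"])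
    qed
    have "?X \<subseteq> U" using right_submoduleD(3,4)[OF U] x(1) sV by blast
    moreover have "?X \<subseteq> Z" if Z: "right_submodule Z R M" "insert x G \<subseteq> Z" for Z
      using right_submoduleD(3,4)[OF Z(1)] Z(2) G(3)[OF Z(1)] by blast
    ultimately have "?X \<in> ?Q" using X G(1,2) xX VX
      by (intro CollectI conjI exI[of _ "insert x G"]) auto
    moreover have "(?X, V) \<in> submod_asc R M (carrier M)"
      using X sV xX VX x(2) right_submoduleD(1)[OF X] unfolding submod_asc_iff by blast
    ultimately show False using max[rule_format, of ?X] by (metis (no_types, lifting))
  qed
  then show ?thesis unfolding finitely_generated_def
    using G by (intro exI[of _ G]) (auto simp: right_submodule_sub_iff[OF U])
qed

end

section \<open>Modules over artin algebras\<close>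

definition restrict_scalars :: "('k \<Rightarrow> 'a) \<Rightarrow> ('a, 'b) rmodule \<Rightarrow> ('k, 'b) rmodule" where
  "restrict_scalars \<phi> M =
     \<lparr>carrier = carrier M, mult = mult M, one = one M, zero = zero M, add = add M,
      ract = (\<lambda>x c. x \<lhd>\<^bsub>M\<^esub> \<phi> c)\<rparr>"

lemma restrict_scalars_simps [simp]:
  "carrier (restrict_scalars \<phi> M) = carrier M"
  "zero (restrict_scalars \<phi> M) = zero M"
  "add (restrict_scalars \<phi> M) = add M"
  "ract (restrict_scalars \<phi> M) x c = x \<lhd>\<^bsub>M\<^esub> \<phi> c"
  by (simp_all add: restrict_scalars_def)

lemma right_module_restrict_scalars:
  fixes R :: "'a ring" and K :: "'k ring"
  assumes "right_module R M" "ring K" and \<phi>: "\<phi> \<in> ring_hom K R"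
  shows "right_module K (restrict_scalars \<phi> M)"
proof -
  interpret M: rmod R M by (rule rmod.intro) fact
  interpret K: ring K by fact
  have "abelian_group (restrict_scalars \<phi> M)"
  proof (rule abelian_groupI, goal_cases)
    case (6 x) then show ?case
      by (auto simp: M.M.l_neg intro!: bexI[of _ "\<ominus>\<^bsub>M\<^esub> x"])
  qed (auto simp: M.M.a_ac)
  then show ?thesis using K.ring_axioms
    by (auto simp: right_module_def right_module_axioms_def M.ract_closed M.ract_add
      M.ract_ring_add M.ract_assoc M.ract_one ring_hom_closed[OF \<phi>] ring_hom_add[OF \<phi>]
      ring_hom_mult[OF \<phi>] ring_hom_one[OF \<phi>])
qed

lemma right_submodule_restrict_scalars:
  assumes "right_module R M" "ring K" and \<phi>: "\<phi> \<in> ring_hom K R" and U: "right_submodule U R M"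
  shows "right_submodule U K (restrict_scalars \<phi> M)"
proof -
  interpret M: rmod R M by (rule rmod.intro) fact
  interpret S: rmod K "restrict_scalars \<phi> M"
    by (rule rmod.intro, rule right_module_restrict_scalars) fact+
  show ?thesis
    by (rule S.right_submoduleI)
      (auto simp: M.right_submoduleD[OF U] ring_hom_closed[OF \<phi>])
qed

text \<open>Generators over K are the products of generators of M over R with generators of R over
  K.\<close>

lemma finitely_generated_restrict_scalars:
  assumes M: "right_module R M" and K: "ring K" and \<phi>: "\<phi> \<in> ring_hom K R"
    and R: "finitely_generated K (restricted_module \<phi> R)" and fg: "finitely_generated R M"
    and central: "\<And>c x. c \<in> carrier K \<Longrightarrow> x \<in> carrier R \<Longrightarrow> \<phi> c \<otimes>\<^bsub>R\<^esub> x = x \<otimes>\<^bsub>R\<^esub> \<phi> c"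
  shows "finitely_generated K (restrict_scalars \<phi> M)"
proof -
  interpret M: rmod R M by (rule rmod.intro) fact
  interpret Reg: rmod R "restricted_module id R"
    by (rule rmod.intro, rule right_module_regular[OF M.R.ring_axioms])
  have eq: "restricted_module \<phi> R = restrict_scalars \<phi> (restricted_module id R)"
    by (simp add: restricted_module_def restrict_scalars_def)
  interpret RK: rmod K "restricted_module \<phi> R"
    unfolding eq
    by (rule rmod.intro, rule right_module_restrict_scalars[OF Reg.right_module_axioms K \<phi>])
  interpret MK: rmod K "restrict_scalars \<phi> M"
    by (rule rmod.intro, rule right_module_restrict_scalars[OF M K \<phi>])
  obtain G where G: "finite G" "G \<subseteq> carrier M"
    "\<And>U. right_submodule U R M \<Longrightarrow> G \<subseteq> U \<Longrightarrow> U = carrier M"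
    using fg by (auto simp: finitely_generated_def)
  obtain H where H: "finite H" "H \<subseteq> carrier R"
    "\<And>U. right_submodule U K (restricted_module \<phi> R) \<Longrightarrow> H \<subseteq> U \<Longrightarrow> U = carrier R"
    using R by (auto simp: finitely_generated_def restricted_module_def)
  let ?GH = "(\<lambda>(x, r). x \<lhd>\<^bsub>M\<^esub> r) ` (G \<times> H)"
  show ?thesis unfolding finitely_generated_def
  proof (intro exI[of _ ?GH] conjI allI impI)
    show "finite ?GH" using G H by simp
    show "?GH \<subseteq> carrier (restrict_scalars \<phi> M)"
      using G(2) H(2) by (auto intro!: M.ract_closed)
    fix U assume "right_submodule U K (restrict_scalars \<phi> M) \<and> ?GH \<subseteq> U"
    then have U: "right_submodule U K (restrict_scalars \<phi> M)" and sub: "?GH \<subseteq> U" by auto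
    note UD = MK.right_submoduleD[OF U, simplified]
    have xr: "x \<lhd>\<^bsub>M\<^esub> r \<in> U" if x: "x \<in> G" and r: "r \<in> carrier R" for x r
    proof -
      have xc: "x \<in> carrier M" using x G by auto
      let ?A = "{r \<in> carrier R. x \<lhd>\<^bsub>M\<^esub> r \<in> U}"
      have "right_submodule ?A K (restricted_module \<phi> R)"
        by (rule RK.right_submoduleI)
          (use xc UD in \<open>auto simp: restricted_module_def M.ract_zero M.ract_ring_add M.ract_assoc
            ring_hom_closed[OF \<phi>]\<close>)
      moreover have "H \<subseteq> ?A" using H(2) sub x by auto
      ultimately have "?A = carrier R" by (rule H(3))
      then show ?thesis using r by auto
    qed
    \<comment> \<open>U is only known to be a K-submodule; \<open>?V\<close> is the largest
      R-submodule contained in it, to which generation over R applies.\<close>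
    let ?V = "{m \<in> carrier M. \<forall>r\<in>carrier R. m \<lhd>\<^bsub>M\<^esub> r \<in> U}"
    have "right_submodule ?V R M"
      by (rule M.right_submoduleI)
        (use UD in \<open>auto simp: M.zero_ract M.ract_add M.ract_assoc[symmetric] M.ract_closed\<close>)
    moreover have "G \<subseteq> ?V" using xr G(2) by auto
    ultimately have "?V = carrier M" by (rule G(3))
    then have "m \<in> U" if "m \<in> carrier M" for m
      using that M.ract_one[OF that] M.R.one_closed by (metis (no_types, lifting) mem_Collect_eq)
    then show "U = carrier (restrict_scalars \<phi> M)" using UD(1) by auto
  qed
qed

lemma wf_submod_desc_artinian:
  assumes "artinian_cring K"
  shows "wf (submod_desc K (restricted_module id K) (carrier K))"
  unfolding wf_iff_no_infinite_down_chain
proof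
  interpret cring K using assms by (simp add: artinian_cring_def)
  interpret Reg: rmod K "restricted_module id K"
    by (rule rmod.intro, rule right_module_regular[OF ring_axioms])
  assume "\<exists>f. \<forall>i. (f (Suc i), f i) \<in> submod_desc K (restricted_module id K) (carrier K)"
  then obtain f where f: "\<And>i. (f (Suc i), f i) \<in> submod_desc K (restricted_module id K) (carrier K)"
    by blast
  have "ideal (f n) K" for n
  proof (rule idealI[OF ring_axioms])
    have sub: "right_submodule (f n) K (restricted_module id K)"
      using f[of n] by (simp add: submod_desc_iff)
    note D = Reg.right_submoduleD[OF sub]
    show "subgroup (f n) (add_monoid K)"
    proof (rule add.subgroupI)
      show "f n \<subseteq> carrier K" using D(1) by (auto simp: restricted_module_def)
      show "f n \<noteq> {}" using D(2) by auto
      fix a b assume a: "a \<in> f n"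
      show "b \<in> f n \<Longrightarrow> a \<oplus>\<^bsub>K\<^esub> b \<in> f n" using D(3)[OF a] by (simp add: restricted_module_def)
      have ac: "a \<in> carrier K" using D(1)[OF a] by (simp add: restricted_module_def)
      have "a \<otimes>\<^bsub>K\<^esub> (\<ominus>\<^bsub>K\<^esub> \<one>\<^bsub>K\<^esub>) \<in> f n" using D(4)[OF a, of "\<ominus>\<^bsub>K\<^esub> \<one>\<^bsub>K\<^esub>"]
        by (simp add: restricted_module_def)
      then show "\<ominus>\<^bsub>K\<^esub> a \<in> f n" using ac by (simp add: r_minus)
    qed
    fix a x assume a: "a \<in> f n" and x: "x \<in> carrier K"
    then show "a \<otimes>\<^bsub>K\<^esub> x \<in> f n" using D(4)[OF a x] by (simp add: restricted_module_def)
    then show "x \<otimes>\<^bsub>K\<^esub> a \<in> f n" using D(1)[OF a] x by (simp add: restricted_module_def m_comm)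
  qed
  moreover have "f (Suc n) \<subseteq> f n" for n using f[of n] by (auto simp: submod_desc_iff)
  ultimately have "\<exists>N. \<forall>n\<ge>N. f n = f N" using assms unfolding artinian_cring_def by blast
  then obtain N where "f (Suc N) = f N" by (meson le_SucI order_refl)
  then show False using f[of N] by (simp add: submod_desc_iff)
qed

locale artin_alg =
  fixes K :: "'k ring" and \<phi> :: "'k \<Rightarrow> 'a" and R :: "'a ring"
  assumes artin_algebra: "artin_algebra K \<phi> R"
begin

lemma artin_algebraD:
  shows "artinian_cring K" "cring K" "ring K" "ring R" "\<phi> \<in> ring_hom K R"
    and "\<And>c x. c \<in> carrier K \<Longrightarrow> x \<in> carrier R \<Longrightarrow> \<phi> c \<otimes>\<^bsub>R\<^esub> x = x \<otimes>\<^bsub>R\<^esub> \<phi> c"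
    and "finitely_generated K (restricted_module \<phi> R)"
  using artin_algebra by (auto simp: artin_algebra_def artinian_cring_def cring_def)

lemma wf_submod_desc_scalars:
  assumes M: "right_module R M" and fg: "finitely_generated R M"
  shows "wf (submod_desc K (restrict_scalars \<phi> M) (carrier M))"
proof -
  interpret MK: rmod K "restrict_scalars \<phi> M"
    by (rule rmod.intro, rule right_module_restrict_scalars[OF M artin_algebraD(3,5)])
  show ?thesis
    using MK.wf_submod_desc_fg[OF finitely_generated_restrict_scalars[OF M artin_algebraD(3,5,7) fg artin_algebraD(6)]
      wf_submod_desc_artinian[OF artin_algebraD(1)]] by simp
qed

lemma wf_submod_asc_scalars:
  assumes M: "right_module R M" and fg: "finitely_generated R M"
  shows "wf (submod_asc K (restrict_scalars \<phi> M) (carrier M))"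
proof -
  interpret MK: rmod K "restrict_scalars \<phi> M"
    by (rule rmod.intro, rule right_module_restrict_scalars[OF M artin_algebraD(3,5)])
  show ?thesis
    using MK.wf_submod_asc_if_desc[OF artin_algebraD(2) wf_submod_desc_artinian[OF artin_algebraD(1)]]
      wf_submod_desc_scalars[OF assms] by simp
qed

text \<open>Every R-submodule is a K-submodule, so this relation is contained in the well-founded
  one over K.\<close>

lemma wf_submod_desc:
  assumes M: "right_module R M" and fg: "finitely_generated R M"
  shows "wf (submod_desc R M (carrier M))"
  by (rule wf_subset[OF wf_submod_desc_scalars[OF assms]])
    (auto simp: submod_desc_def intro: right_submodule_restrict_scalars[OF M artin_algebraD(3,5)])

lemma wf_submod_asc:
  assumes M: "right_module R M" and fg: "finitely_generated R M"
  shows "wf (submod_asc R M (carrier M))"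
  by (rule wf_subset[OF wf_submod_asc_scalars[OF assms]])
    (auto simp: submod_asc_def submod_desc_def
      intro: right_submodule_restrict_scalars[OF M artin_algebraD(3,5)])

lemma fgmod_sub: "M \<in> fgmod R \<Longrightarrow> right_submodule U R M \<Longrightarrow> M\<lparr>carrier := U\<rparr> \<in> fgmod R"
  unfolding fgmod_def
  using rmod.finitely_generated_sub rmod.right_module_sub rmod.intro wf_submod_asc by blast

end

section \<open>Composition series and simple modules\<close>

context rmod
begin

lemma simple_quot_module:
  assumes U: "right_submodule U R M" and V: "right_submodule V R M" and UV: "U \<subset> V"
    and min: "\<And>W. right_submodule W R M \<Longrightarrow> U \<subset> W \<Longrightarrow> W \<subset> V \<Longrightarrow> False"
  shows "simple_module R (quot_module (M\<lparr>carrier := V\<rparr>) U)"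
proof -
  let ?S = "M\<lparr>carrier := V\<rparr>" and ?Q = "quot_module (M\<lparr>carrier := V\<rparr>) U"
  interpret S: rmod R ?S by (rule rmod.intro, rule right_module_sub[OF V])
  have US: "right_submodule U R ?S" using U UV by (simp add: right_submodule_sub_iff[OF V])
  define p where "p = (\<lambda>x\<in>V. U +>\<^bsub>?S\<^esub> x)"
  have p: "right_module R ?Q" "p \<in> rhom R ?S ?Q" "p ` V = carrier ?Q"
    "\<And>x. x \<in> V \<Longrightarrow> p x = \<zero>\<^bsub>?Q\<^esub> \<longleftrightarrow> x \<in> U"
    using S.quot_module_proj[OF US] by (simp_all add: p_def)
  interpret Q: rmod R ?Q by (rule rmod.intro) fact
  obtain x where x: "x \<in> V" "x \<notin> U" using UV by blast
  have "carrier ?Q \<noteq> {\<zero>\<^bsub>?Q\<^esub>}" using p(3) p(4)[OF x(1)] x by blast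
  moreover have "W = {\<zero>\<^bsub>?Q\<^esub>} \<or> W = carrier ?Q" if W: "right_submodule W R ?Q" for W
  proof -
    let ?W = "{x \<in> V. p x \<in> W}"
    have "right_submodule ?W R ?S"
      using right_submodule_vimage[OF S.right_module_axioms p(1,2) W] by simp
    then have W': "right_submodule ?W R M" by (simp add: right_submodule_sub_iff[OF V])
    have "U \<subseteq> ?W"
    proof
      fix u assume u: "u \<in> U"
      then have "u \<in> V" using UV by auto
      with u show "u \<in> ?W" using p(4)[of u] Q.right_submoduleD(2)[OF W] by simp
    qed
    then have "?W = U \<or> ?W = V" using min[OF W'] by blast
    then show ?thesis
    proof
      assume eq: "?W = U"
      have "w = \<zero>\<^bsub>?Q\<^esub>" if w: "w \<in> W" for w
      proof -
        obtain v where v: "v \<in> V" "w = p v" using Q.right_submoduleD(1)[OF W w] p(3) by auto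
        then have "v \<in> U" using w eq by blast
        then show ?thesis using p(4) v by simp
      qed
      then show ?thesis using Q.right_submoduleD(2)[OF W] by blast
    next
      assume "?W = V"
      then have "p ` V \<subseteq> W" by auto
      then show ?thesis using p(3) Q.right_submoduleD(1)[OF W] by auto
    qed
  qed
  ultimately show ?thesis using p(1) by (simp add: simple_module_def)
qed

text \<open>The series is built upwards from U by induction along the ascending relation: the
  descending condition provides a minimal V properly above U, with simple factor, and the induction
  hypothesis continues from V.\<close>

lemma composition_series:
  assumes desc: "wf (submod_desc R M (carrier M))" and asc: "wf (submod_asc R M (carrier M))"
  shows "filtered R (simple_module R) M"
proof -
  have "\<exists>t (Y :: nat \<Rightarrow> 'b set). Y 0 = U \<and> Y t = carrier M \<and> (\<forall>i\<le>t. right_submodule (Y i) R M) \<and>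
      (\<forall>i<t. Y i \<subseteq> Y (Suc i) \<and> simple_module R (quot_module (M\<lparr>carrier := Y (Suc i)\<rparr>) (Y i)))"
    if "right_submodule U R M" for U
    using asc that
  proof (induction U rule: wf_induct_rule)
    case (less U)
    note U = less.prems
    show ?case
    proof (cases "U = carrier M")
      case True
      then show ?thesis using U by (intro exI[of _ "0::nat"] exI[of _ "\<lambda>i. U"]) simp
    next
      case False
      have sub: "V \<subseteq> carrier M" if "right_submodule V R M" for V
        using right_submoduleD(1)[OF that] by auto
      have "carrier M \<in> {V. right_submodule V R M \<and> U \<subset> V}"
        using False sub[OF U] right_submodule_carrier by blast
      from wf_minimal[OF desc this] obtain V where V: "right_submodule V R M" "U \<subset> V"
        and min: "\<forall>W. (W, V) \<in> submod_desc R M (carrier M) \<longrightarrow> \<not> (right_submodule W R M \<and> U \<subset> W)"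
        by auto
      have simple: "simple_module R (quot_module (M\<lparr>carrier := V\<rparr>) U)"
        using min V sub[OF V(1)] by (intro simple_quot_module U V) (auto simp: submod_desc_iff)
      have "(V, U) \<in> submod_asc R M (carrier M)" using U V sub[OF V(1)] by (simp add: submod_asc_iff)
      from less.IH[OF this V(1)] obtain t and Y :: "nat \<Rightarrow> 'b set" where
        Y: "Y 0 = V" "Y t = carrier M" "\<And>i. i \<le> t \<Longrightarrow> right_submodule (Y i) R M"
        "\<And>i. i < t \<Longrightarrow> Y i \<subseteq> Y (Suc i) \<and> simple_module R (quot_module (M\<lparr>carrier := Y (Suc i)\<rparr>) (Y i))"
        by blast
      show ?thesis
      proof (intro exI[of _ "Suc t"] exI[of _ "case_nat U Y"] conjI allI impI)
        fix i
        show "i \<le> Suc t \<Longrightarrow> right_submodule (case i of 0 \<Rightarrow> U | Suc x \<Rightarrow> Y x) R M"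
          using U Y(3) by (cases i) auto
        assume "i < Suc t"
        then show "(case i of 0 \<Rightarrow> U | Suc x \<Rightarrow> Y x) \<subseteq> (case Suc i of 0 \<Rightarrow> U | Suc x \<Rightarrow> Y x)"
          "simple_module R (quot_module (M\<lparr>carrier := case Suc i of 0 \<Rightarrow> U | Suc x \<Rightarrow> Y x\<rparr>)
             (case i of 0 \<Rightarrow> U | Suc x \<Rightarrow> Y x))"
          using Y(1,4) V(2) simple by (cases i; auto)+
      qed (simp_all add: Y)
    qed
  qed
  from this[OF right_submodule_zero] show ?thesis unfolding filtered_def by simp
qed

text \<open>At the first member of the filtration that h does not kill, h induces a nonzero map from
  a simple factor to S, which is an isomorphism by Schur's lemma. This is the part of the
  Jordan-Hoelder theorem that counting simple modules requires.\<close>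

lemma simple_quotient_factor:
  assumes Y: "Y 0 = {\<zero>\<^bsub>M\<^esub>}" "Y t = carrier M" "\<And>i. i \<le> t \<Longrightarrow> right_submodule (Y i) R M"
    and fac: "\<And>i. i < t \<Longrightarrow> Y i \<subseteq> Y (Suc i) \<and> simple_module R (quot_module (M\<lparr>carrier := Y (Suc i)\<rparr>) (Y i))"
    and S: "simple_module R S" and h: "h \<in> rhom R M S" and x: "x \<in> carrier M" "h x \<noteq> \<zero>\<^bsub>S\<^esub>"
  shows "\<exists>i<t. isomorphic R (quot_module (M\<lparr>carrier := Y (Suc i)\<rparr>) (Y i)) S"
proof -
  have Sm: "right_module R S" and Ss: "\<And>U. right_submodule U R S \<Longrightarrow> U = {\<zero>\<^bsub>S\<^esub>} \<or> U = carrier S"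
    using S by (auto simp: simple_module_def)
  interpret S: rmod R S by (rule rmod.intro) fact
  let ?P = "\<lambda>i. \<exists>x\<in>Y i. h x \<noteq> \<zero>\<^bsub>S\<^esub>"
  define j where "j = (LEAST i. ?P i)"
  have Pt: "?P t" using x Y(2) by auto
  then have Pj: "?P j" unfolding j_def by (rule LeastI)
  have "j \<noteq> 0" using Pj Y(1) rhom_zero[OF h right_module_axioms Sm] by (cases "j = 0") auto
  then obtain i where i: "j = Suc i" by (cases j) auto
  have "j \<le> t" unfolding j_def using Pt by (rule Least_le)
  then have it: "i < t" using i by simp
  have zi: "h x = \<zero>\<^bsub>S\<^esub>" if "x \<in> Y i" for x
    using not_less_Least[of i ?P] i that unfolding j_def by (metis lessI)
  let ?V = "Y (Suc i)" and ?Q = "quot_module (M\<lparr>carrier := Y (Suc i)\<rparr>) (Y i)"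
  let ?N = "M\<lparr>carrier := ?V\<rparr>"
  have V: "right_submodule ?V R M" "right_submodule (Y i) R M" using Y(3) it by auto
  interpret N: rmod R ?N by (rule rmod.intro, rule right_module_sub[OF V(1)])
  have YN: "right_submodule (Y i) R ?N" using V fac[OF it] by (simp add: right_submodule_sub_iff)
  define p where "p = (\<lambda>x\<in>?V. Y i +>\<^bsub>?N\<^esub> x)"
  have p: "right_module R ?Q" "p \<in> rhom R ?N ?Q" "p ` carrier ?N = carrier ?Q"
    "\<And>x. x \<in> ?V \<Longrightarrow> p x = \<zero>\<^bsub>?Q\<^esub> \<longleftrightarrow> x \<in> Y i"
    using N.quot_module_proj[OF YN] by (simp_all add: p_def)
  have h': "(\<lambda>x\<in>carrier ?N. h x) \<in> rhom R ?N S"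
    by (rule rhom_restrictI[OF N.right_module_axioms])
      (auto simp: rhomD[OF h] right_submoduleD[OF V(1)])
  obtain k where k: "k \<in> rhom R ?Q S" "\<And>x. x \<in> ?V \<Longrightarrow> k (p x) = h x"
    using rhom_factor[OF N.right_module_axioms p(1) Sm p(2,3) h'] p(4) zi by auto
  obtain v where v: "v \<in> ?V" "h v \<noteq> \<zero>\<^bsub>S\<^esub>" using Pj i by auto
  interpret Q: rmod R ?Q by (rule rmod.intro) fact
  have pv: "p v \<in> carrier ?Q" using rhomD(1)[OF p(2)] v by simp
  have "right_submodule (k ` carrier ?Q) R S"
    by (rule right_submodule_image[OF p(1) Sm k(1) Q.right_submodule_carrier])
  moreover have "k (p v) \<in> k ` carrier ?Q" using pv by (rule imageI)
  moreover have "k (p v) \<noteq> \<zero>\<^bsub>S\<^esub>" using k(2) v by auto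
  ultimately have im: "k ` carrier ?Q = carrier S" using Ss by blast
  let ?ker = "{x \<in> carrier ?Q. k x = \<zero>\<^bsub>S\<^esub>}"
  have "right_submodule ?ker R ?Q" by (rule right_submodule_kernel[OF p(1) Sm k(1)])
  moreover have "p v \<notin> ?ker" using k(2) v by auto
  ultimately have ker: "?ker = {\<zero>\<^bsub>?Q\<^esub>}" using fac[OF it] pv by (auto simp: simple_module_def)
  have "inj_on k (carrier ?Q)" using ker by (intro rhom_inj_onI[OF p(1) Sm k(1)]) auto
  then have "k \<in> riso R ?Q S" using im k(1) by (auto simp: riso_def bij_betw_def)
  then show ?thesis using it by (auto simp: isomorphic_def)
qed

end

context artin_alg
begin

lemma length_category: "length_category R"
  unfolding length_category_def fgmod_def
  using rmod.composition_series[OF rmod.intro wf_submod_desc wf_submod_asc] by blast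

lemma regular_fg: "finitely_generated R (restricted_module id R)"
proof -
  interpret ring R by (rule artin_algebraD(4))
  interpret Reg: rmod R "restricted_module id R"
    by (rule rmod.intro, rule right_module_regular[OF ring_axioms])
  show ?thesis unfolding finitely_generated_def
  proof (intro exI[of _ "{\<one>\<^bsub>R\<^esub>}"] conjI allI impI)
    fix U assume U: "right_submodule U R (restricted_module id R) \<and> {\<one>\<^bsub>R\<^esub>} \<subseteq> U"
    have "x \<in> U" if "x \<in> carrier R" for x
      using Reg.right_submoduleD(4)[of U "\<one>\<^bsub>R\<^esub>" x] U that by (simp add: restricted_module_def)
    then show "U = carrier (restricted_module id R)"
      using Reg.right_submoduleD(1) U by (auto simp: restricted_module_def)
  qed (auto simp: restricted_module_def)
qed

text \<open>A nonzero s in a simple module S gives a nonzero homomorphism from R to S, sending r to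
  sr. Hence S is isomorphic to a factor of one fixed composition series of R.\<close>

lemma finitely_many_simples: "finitely_many_simples R"
proof -
  interpret ring R by (rule artin_algebraD(4))
  interpret Reg: rmod R "restricted_module id R"
    by (rule rmod.intro, rule right_module_regular[OF ring_axioms])
  let ?M = "restricted_module id R"
  have "filtered R (simple_module R) ?M"
    by (rule Reg.composition_series[OF wf_submod_desc[OF Reg.right_module_axioms regular_fg]
      wf_submod_asc[OF Reg.right_module_axioms regular_fg]])
  then obtain t Y where Y: "Y 0 = {\<zero>\<^bsub>?M\<^esub>}" "Y t = carrier ?M"
    "\<And>i. i \<le> t \<Longrightarrow> right_submodule (Y i) R ?M"
    "\<And>i. i < t \<Longrightarrow> Y i \<subseteq> Y (Suc i) \<and> simple_module R (quot_module (?M\<lparr>carrier := Y (Suc i)\<rparr>) (Y i))"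
    unfolding filtered_def by blast
  let ?Q = "\<lambda>i. quot_module (?M\<lparr>carrier := Y (Suc i)\<rparr>) (Y i)"
  let ?r = "{(S, T). S \<in> fgmod R \<and> T \<in> fgmod R \<and> isomorphic R S T}"
  \<comment> \<open>The factors are carried by another type than the members of
    \<open>fgmod R\<close>, so an isomorphism class is described by the factor it is isomorphic to,
    without choosing a copy.\<close>
  let ?c = "\<lambda>i. {T \<in> fgmod R. isomorphic R (?Q i) T}"
  have "?r `` {S} \<in> ?c ` {..<t}" if S: "S \<in> fgmod R" "simple_module R S" for S
  proof -
    have Sm: "right_module R S" using S by (simp add: fgmod_def)
    interpret S: rmod R S by (rule rmod.intro) fact
    obtain s where s: "s \<in> carrier S" "s \<noteq> \<zero>\<^bsub>S\<^esub>"
      using S(2) S.M.zero_closed unfolding simple_module_def by blast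
    have h: "(\<lambda>r\<in>carrier ?M. s \<lhd>\<^bsub>S\<^esub> r) \<in> rhom R ?M S"
      by (rule rhom_restrictI[OF Reg.right_module_axioms])
        (auto simp: restricted_module_def s S.ract_closed S.ract_ring_add S.ract_assoc)
    have "\<exists>i<t. isomorphic R (?Q i) S"
      by (rule Reg.simple_quotient_factor[OF Y S(2) h, of "\<one>\<^bsub>R\<^esub>"])
        (use s in \<open>auto simp: restricted_module_def S.ract_one\<close>)
    then obtain i where i: "i < t" "isomorphic R (?Q i) S" by blast
    have Qm: "right_module R (?Q i)" using Y(4)[OF i(1)] by (simp add: simple_module_def)
    have "isomorphic R S T \<longleftrightarrow> isomorphic R (?Q i) T" for T :: "'a fgm"
      using i(2) isomorphic_trans[OF Qm i(2)]
        isomorphic_trans[OF Sm isomorphic_sym[OF Qm Sm i(2)]] by blast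
    then have "?r `` {S} = ?c i" using S(1) by auto
    then show ?thesis using i(1) by blast
  qed
  then have "{S \<in> fgmod R. simple_module R S} // ?r \<subseteq> ?c ` {..<t}"
    by (auto simp: quotient_def)
  then show ?thesis unfolding finitely_many_simples_def using finite_surj finite_lessThan by blast
qed

end

section \<open>Exact sequences and direct sums\<close>

lemma fgmodD: "M \<in> fgmod R \<Longrightarrow> right_module R M" "M \<in> fgmod R \<Longrightarrow> finitely_generated R M"
  by (simp_all add: fgmod_def)

lemma short_exactD:
  assumes "short_exact R L f M g N"
  shows "f \<in> rhom R L M" "g \<in> rhom R M N" "inj_on f (carrier L)" "g ` carrier M = carrier N"
    and "\<And>x. x \<in> carrier L \<Longrightarrow> g (f x) = \<zero>\<^bsub>N\<^esub>"
    and "\<And>y. y \<in> carrier M \<Longrightarrow> g y = \<zero>\<^bsub>N\<^esub> \<Longrightarrow> \<exists>x\<in>carrier L. y = f x"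
    and "\<And>z. z \<in> carrier N \<Longrightarrow> \<exists>y\<in>carrier M. g y = z"
proof -
  have *: "f \<in> rhom R L M" "g \<in> rhom R M N" "inj_on f (carrier L)" "g ` carrier M = carrier N"
    "f ` carrier L = a_kernel M N g"
    using assms by (auto simp: short_exact_def)
  then show "f \<in> rhom R L M" "g \<in> rhom R M N" "inj_on f (carrier L)" "g ` carrier M = carrier N"
    by blast+
  show "g (f x) = \<zero>\<^bsub>N\<^esub>" if "x \<in> carrier L" for x
    using that *(5) a_kernel_iff by (metis imageI)
  show "\<exists>x\<in>carrier L. y = f x" if "y \<in> carrier M" "g y = \<zero>\<^bsub>N\<^esub>" for y
  proof -
    have "y \<in> a_kernel M N g" using that by (simp add: a_kernel_iff)
    then have "y \<in> f ` carrier L" by (simp add: *(5))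
    then show ?thesis by auto
  qed
  show "\<exists>y\<in>carrier M. g y = z" if "z \<in> carrier N" for z
  proof -
    have "z \<in> g ` carrier M" using that by (simp add: *(4))
    then show ?thesis by auto
  qed
qed

lemma short_exactI:
  assumes L: "right_module R L" and M: "right_module R M"
    and f: "f \<in> rhom R L M" and g: "g \<in> rhom R M N"
    and ker: "\<And>x. x \<in> carrier L \<Longrightarrow> f x = \<zero>\<^bsub>M\<^esub> \<Longrightarrow> x = \<zero>\<^bsub>L\<^esub>"
    and zero: "\<And>x. x \<in> carrier L \<Longrightarrow> g (f x) = \<zero>\<^bsub>N\<^esub>"
    and exact: "\<And>y. y \<in> carrier M \<Longrightarrow> g y = \<zero>\<^bsub>N\<^esub> \<Longrightarrow> \<exists>x\<in>carrier L. f x = y"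
    and surj: "\<And>z. z \<in> carrier N \<Longrightarrow> \<exists>y\<in>carrier M. g y = z"
  shows "short_exact R L f M g N"
  unfolding short_exact_def
proof (intro conjI f g)
  show "inj_on f (carrier L)" by (rule rhom_inj_onI[OF L M f ker])
  show "f ` carrier L = a_kernel M N g"
  proof (intro equalityI subsetI)
    fix y assume "y \<in> f ` carrier L"
    then show "y \<in> a_kernel M N g" using zero rhomD(1)[OF f] by (auto simp: a_kernel_iff)
  next
    fix y assume "y \<in> a_kernel M N g"
    then show "y \<in> f ` carrier L" using exact[of y] by (auto simp: a_kernel_iff)
  qed
  show "g ` carrier M = carrier N"
  proof (intro equalityI subsetI)
    fix y assume "y \<in> carrier N"
    then show "y \<in> g ` carrier M" using surj[of y] by auto
  qed (use rhomD(1)[OF g] in auto)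
qed

lemma short_exact_ker:
  assumes "short_exact R L f M g N" "right_module R L" "right_module R M" "x \<in> carrier L" "f x = \<zero>\<^bsub>M\<^esub>"
  shows "x = \<zero>\<^bsub>L\<^esub>"
proof -
  interpret L: rmod R L by (rule rmod.intro) fact
  have "f x = f \<zero>\<^bsub>L\<^esub>"
    using assms rhom_zero[OF short_exactD(1)[OF assms(1)]] by simp
  then show ?thesis using short_exactD(3)[OF assms(1)] assms(4) L.M.zero_closed
    by (auto dest: inj_onD)
qed

lemma rhom_inclusion:
  assumes "right_module R M" "right_submodule U R M"
  shows "(\<lambda>x\<in>U. x) \<in> rhom R (M\<lparr>carrier := U\<rparr>) M"
proof -
  interpret M: rmod R M by (rule rmod.intro) fact
  show ?thesis
    using rhom_restrictI[OF M.right_module_sub[OF assms(2)], of "\<lambda>x. x" M]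
      M.right_submoduleD(1)[OF assms(2)] by simp
qed

lemma rhom_into_sub:
  assumes "h \<in> rhom R L M" "\<And>x. x \<in> carrier L \<Longrightarrow> h x \<in> U"
  shows "h \<in> rhom R L (M\<lparr>carrier := U\<rparr>)"
  using assms by (auto simp: rhom_def PiE_def)

lemma short_exact_kernel:
  assumes M: "right_module R M" and N: "right_module R N" and g: "g \<in> rhom R M N"
    and surj: "g ` carrier M = carrier N"
  defines "U \<equiv> {x \<in> carrier M. g x = \<zero>\<^bsub>N\<^esub>}"
  shows "short_exact R (M\<lparr>carrier := U\<rparr>) (\<lambda>x\<in>U. x) M g N"
proof -
  interpret M: rmod R M by (rule rmod.intro) fact
  have U: "right_submodule U R M" unfolding U_def by (rule right_submodule_kernel[OF M N g])
  show ?thesis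
  proof (rule short_exactI[OF M.right_module_sub[OF U] M rhom_inclusion[OF M U] g])
    fix z assume "z \<in> carrier N"
    then show "\<exists>y\<in>carrier M. g y = z" using surj by (metis imageE)
  qed (auto simp: U_def)
qed

text \<open>The preimage in B of the submodule C' of C is an extension of C' by A, and the quotient
  of B by it is D. Inductions use this to peel off the top factor of a filtration of C when C is the
  quotient of some B, and to compose two successive extensions.\<close>

lemma short_exact_preimage:
  assumes m: "right_module R A" "right_module R B" "right_module R C'" "right_module R C" "right_module R D"
    and exB: "short_exact R A f B g C" and exC: "short_exact R C' f' C g' D"
  defines "U \<equiv> {x \<in> carrier B. g' (g x) = \<zero>\<^bsub>D\<^esub>}"
  shows "right_submodule U R B" "\<exists>l. short_exact R A f (B\<lparr>carrier := U\<rparr>) l C'"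
    "short_exact R (B\<lparr>carrier := U\<rparr>) (\<lambda>x\<in>U. x) B (\<lambda>x\<in>carrier B. g' (g x)) D"
proof -
  interpret B: rmod R B by (rule rmod.intro) (rule m)
  note E = short_exactD[OF exB] and E' = short_exactD[OF exC]
  define k where "k = (\<lambda>x\<in>carrier B. g' (g x))"
  have k: "k \<in> rhom R B D" unfolding k_def by (rule rhom_compose[OF m(2) E(2) E'(2)])
  have ksurj: "k ` carrier B = carrier D"
  proof (intro equalityI subsetI)
    fix z assume "z \<in> carrier D"
    then obtain c b where "b \<in> carrier B" "g b = c" "g' c = z" using E(7) E'(7) by metis
    then show "z \<in> k ` carrier B" by (auto simp: k_def)
  qed (use rhomD(1)[OF k] in auto)
  let ?B = "B\<lparr>carrier := U\<rparr>"
  have Uk: "U = {x \<in> carrier B. k x = \<zero>\<^bsub>D\<^esub>}" by (auto simp: U_def k_def)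
  show U: "right_submodule U R B" unfolding Uk by (rule right_submodule_kernel[OF m(2,5) k])
  note B' = B.right_module_sub[OF U]
  show "short_exact R ?B (\<lambda>x\<in>U. x) B (\<lambda>x\<in>carrier B. g' (g x)) D"
    using short_exact_kernel[OF m(2,5) k ksurj] unfolding Uk[symmetric] by (simp add: k_def)
  have gU: "(\<lambda>x\<in>carrier ?B. g x) \<in> rhom R ?B C"
    by (rule rhom_restrictI[OF B']) (auto simp: U_def rhomD[OF E(2)])
  have im: "(\<lambda>x\<in>carrier ?B. g x) x \<in> f' ` carrier C'" if "x \<in> carrier ?B" for x
    using that E'(6)[OF rhomD(1)[OF E(2)], of x] by (auto simp: U_def)
  obtain l where l: "l \<in> rhom R ?B C'" "\<And>x. x \<in> U \<Longrightarrow> f' (l x) = g x"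
    using rhom_cofactor[OF m(3,4) B' E'(1,3) gU im] by auto
  have f'0: "f' \<zero>\<^bsub>C'\<^esub> = \<zero>\<^bsub>C\<^esub>" by (rule rhom_zero[OF E'(1) m(3,4)])
  have fU: "f x \<in> U" if "x \<in> carrier A" for x
    using that E(5) rhomD(1)[OF E(1)] rhom_zero[OF E'(2) m(4,5)] by (simp add: U_def)
  have "short_exact R A f ?B l C'"
  proof (rule short_exactI[OF m(1) B' rhom_into_sub[OF E(1) fU] l(1)])
    fix x assume x: "x \<in> carrier A"
    show "f x = \<zero>\<^bsub>?B\<^esub> \<Longrightarrow> x = \<zero>\<^bsub>A\<^esub>"
      using short_exact_ker[OF exB m(1,2) x] by simp
    show "l (f x) = \<zero>\<^bsub>C'\<^esub>"
      using l(2)[OF fU[OF x]] E(5)[OF x] rhomD(1)[OF l(1), of "f x"] fU[OF x]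
        short_exact_ker[OF exC m(3,4)] by simp
  next
    fix y assume y: "y \<in> carrier ?B" "l y = \<zero>\<^bsub>C'\<^esub>"
    then have "g y = \<zero>\<^bsub>C\<^esub>" using l(2)[of y] f'0 by simp
    then show "\<exists>x\<in>carrier A. f x = y" using E(6)[of y] y by (auto simp: U_def)
  next
    fix z assume z: "z \<in> carrier C'"
    obtain b where b: "b \<in> carrier B" "g b = f' z" using E(7)[OF rhomD(1)[OF E'(1) z]] by blast
    then have bU: "b \<in> U" using E'(5)[OF z] by (simp add: U_def)
    then have "f' (l b) = f' z" using l(2) b by simp
    then have "l b = z" using inj_onD[OF E'(3) _ _ z] rhomD(1)[OF l(1), of b] bU by simp
    then show "\<exists>y\<in>carrier ?B. l y = z" using bU by auto
  qed
  then show "\<exists>l. short_exact R A f ?B l C'" by blast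
qed

text \<open>A quotient that stays inside \<open>fgmod R\<close>: the module of cosets is replaced by
  a copy, and only the surjection and its kernel are remembered.\<close>

lemma fgmod_quotient:
  assumes M: "M \<in> fgmod R" and U: "right_submodule U R M"
  obtains Q g where "Q \<in> fgmod R" "g \<in> rhom R M Q" "g ` carrier M = carrier Q"
    "\<forall>x\<in>carrier M. g x = \<zero>\<^bsub>Q\<^esub> \<longleftrightarrow> x \<in> U"
proof -
  interpret M: rmod R M by (rule rmod.intro) (rule fgmodD[OF M])
  let ?Q = "quot_module M U"
  define p where "p = (\<lambda>x\<in>carrier M. U +>\<^bsub>M\<^esub> x)"
  have p: "right_module R ?Q" "p \<in> rhom R M ?Q" "p ` carrier M = carrier ?Q"
    "\<And>x. x \<in> carrier M \<Longrightarrow> p x = \<zero>\<^bsub>?Q\<^esub> \<longleftrightarrow> x \<in> U"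
    using M.quot_module_proj[OF U] by (simp_all add: p_def)
  interpret Q: rmod R ?Q by (rule rmod.intro) fact
  have "finitely_generated R ?Q"
    by (rule M.finitely_generated_image[OF p(3) rhomD(2,3)[OF p(2)]
          rhom_zero[OF p(2) M.right_module_axioms p(1)] fgmodD(2)[OF M]])
  then obtain N \<theta> where N: "N \<in> fgmod R" "\<theta> \<in> riso R ?Q N"
    using Q.fgmod_copy by blast
  have \<theta>: "\<theta> \<in> rhom R ?Q N" "bij_betw \<theta> (carrier ?Q) (carrier N)"
    using N by (auto simp: riso_def)
  have inj: "inj_on \<theta> (carrier ?Q)" using \<theta>(2) by (simp add: bij_betw_def)
  have t0: "\<theta> y = \<zero>\<^bsub>N\<^esub> \<longleftrightarrow> y = \<zero>\<^bsub>?Q\<^esub>" if "y \<in> carrier ?Q" for y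
    using inj_onD[OF inj, of y "\<zero>\<^bsub>?Q\<^esub>"] rhom_zero[OF \<theta>(1) p(1) fgmodD(1)[OF N(1)]] that by auto
  let ?g = "\<lambda>x\<in>carrier M. \<theta> (p x)"
  have g: "?g \<in> rhom R M N" by (rule rhom_compose[OF M.right_module_axioms p(2) \<theta>(1)])
  have im: "?g ` carrier M = carrier N"
  proof -
    have "?g ` carrier M = \<theta> ` (p ` carrier M)" by (auto simp: image_iff)
    then show ?thesis using p(3) \<theta>(2) by (simp add: bij_betw_def)
  qed
  have "?g x = \<zero>\<^bsub>N\<^esub> \<longleftrightarrow> x \<in> U" if "x \<in> carrier M" for x
    using that t0[OF rhomD(1)[OF p(2) that]] p(4) by simp
  then show ?thesis by (intro that[OF N(1) g im] ballI)
qed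

text \<open>A direct sum presented by its two projections, so that it may be carried by any type, in
  particular by that of \<open>fgmod R\<close>. The injections are recovered by pairing an identity
  with a zero map.\<close>

definition bisum :: "'a ring \<Rightarrow> ('a, 'b) rmodule \<Rightarrow> ('a, 'c) rmodule \<Rightarrow> ('a, 'd) rmodule \<Rightarrow>
    ('b \<Rightarrow> 'c) \<Rightarrow> ('b \<Rightarrow> 'd) \<Rightarrow> bool" where
  "bisum R Q A B p q \<longleftrightarrow> p \<in> rhom R Q A \<and> q \<in> rhom R Q B \<and>
     bij_betw (\<lambda>x. (p x, q x)) (carrier Q) (carrier A \<times> carrier B)"

lemma bisumD:
  assumes "bisum R Q A B p q"
  shows "p \<in> rhom R Q A" "q \<in> rhom R Q B"
    and "\<And>x y. x \<in> carrier Q \<Longrightarrow> y \<in> carrier Q \<Longrightarrow> p x = p y \<Longrightarrow> q x = q y \<Longrightarrow> x = y"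
    and "\<And>a b. a \<in> carrier A \<Longrightarrow> b \<in> carrier B \<Longrightarrow> \<exists>x\<in>carrier Q. p x = a \<and> q x = b"
proof -
  have *: "p \<in> rhom R Q A" "q \<in> rhom R Q B" "inj_on (\<lambda>x. (p x, q x)) (carrier Q)"
    "(\<lambda>x. (p x, q x)) ` carrier Q = carrier A \<times> carrier B"
    using assms by (auto simp: bisum_def bij_betw_def)
  show "p \<in> rhom R Q A" "q \<in> rhom R Q B" by fact+
  show "x = y" if "x \<in> carrier Q" "y \<in> carrier Q" "p x = p y" "q x = q y" for x y
    using *(3) that by (auto dest: inj_onD)
  show "\<exists>x\<in>carrier Q. p x = a \<and> q x = b" if "a \<in> carrier A" "b \<in> carrier B" for a b
  proof -
    have "(a, b) \<in> (\<lambda>x. (p x, q x)) ` carrier Q" unfolding *(4) using that by simp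
    then show ?thesis by auto
  qed
qed

lemma bisumI:
  assumes p: "p \<in> rhom R Q A" and q: "q \<in> rhom R Q B"
    and "\<And>x y. x \<in> carrier Q \<Longrightarrow> y \<in> carrier Q \<Longrightarrow> p x = p y \<Longrightarrow> q x = q y \<Longrightarrow> x = y"
    and sur: "\<And>a b. a \<in> carrier A \<Longrightarrow> b \<in> carrier B \<Longrightarrow> \<exists>x\<in>carrier Q. p x = a \<and> q x = b"
  shows "bisum R Q A B p q"
  unfolding bisum_def bij_betw_def
proof (intro conjI p q equalityI subsetI)
  show "inj_on (\<lambda>x. (p x, q x)) (carrier Q)" using assms(3) by (auto intro!: inj_onI)
  fix z assume "z \<in> (\<lambda>x. (p x, q x)) ` carrier Q"
  then show "z \<in> carrier A \<times> carrier B" using rhomD(1)[OF p] rhomD(1)[OF q] by auto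
next
  fix z assume "z \<in> carrier A \<times> carrier B"
  then show "z \<in> (\<lambda>x. (p x, q x)) ` carrier Q" using sur by (force simp: image_iff)
qed

lemma bisum_pairing:
  assumes b: "bisum R Q A B p q" and mods: "right_module R Q" "right_module R L"
    and f: "f \<in> rhom R L A" and g: "g \<in> rhom R L B"
  shows "\<exists>h\<in>rhom R L Q. \<forall>x\<in>carrier L. p (h x) = f x \<and> q (h x) = g x"
proof -
  interpret Q: rmod R Q by (rule rmod.intro) fact
  interpret L: rmod R L by (rule rmod.intro) fact
  note D = bisumD[OF b]
  have "\<forall>x\<in>carrier L. \<exists>y\<in>carrier Q. p y = f x \<and> q y = g x"
    using D(4) rhomD(1)[OF f] rhomD(1)[OF g] by blast
  then obtain h where h: "\<And>x. x \<in> carrier L \<Longrightarrow> h x \<in> carrier Q"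
    "\<And>x. x \<in> carrier L \<Longrightarrow> p (h x) = f x" "\<And>x. x \<in> carrier L \<Longrightarrow> q (h x) = g x" by metis
  have "(\<lambda>x\<in>carrier L. h x) \<in> rhom R L Q"
    by (rule rhom_restrictI[OF mods(2)]; (intro D(3))?)
      (simp_all add: h L.ract_closed Q.ract_closed rhomD[OF D(1)] rhomD[OF D(2)] rhomD[OF f] rhomD[OF g])
  then show ?thesis using h by (intro bexI[of _ "\<lambda>x\<in>carrier L. h x"]) auto
qed

lemma bisum_injections:
  assumes b: "bisum R Q A B p q" and mods: "right_module R Q" "right_module R A" "right_module R B"
  obtains i j where "i \<in> rhom R A Q" "\<forall>a\<in>carrier A. p (i a) = a \<and> q (i a) = \<zero>\<^bsub>B\<^esub>"
    "j \<in> rhom R B Q" "\<forall>b\<in>carrier B. p (j b) = \<zero>\<^bsub>A\<^esub> \<and> q (j b) = b"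
    "\<forall>x\<in>carrier Q. x = i (p x) \<oplus>\<^bsub>Q\<^esub> j (q x)"
proof -
  interpret Q: rmod R Q by (rule rmod.intro) fact
  interpret A: rmod R A by (rule rmod.intro) fact
  interpret B: rmod R B by (rule rmod.intro) fact
  note D = bisumD[OF b]
  obtain i where i: "i \<in> rhom R A Q" "\<And>a. a \<in> carrier A \<Longrightarrow> p (i a) = a \<and> q (i a) = \<zero>\<^bsub>B\<^esub>"
    using bisum_pairing[OF b mods(1,2) rhom_id[OF mods(2)] zero_hom_rhom[OF mods(2,3)]]
    by (auto simp: zero_hom_def)
  obtain j where j: "j \<in> rhom R B Q" "\<And>b. b \<in> carrier B \<Longrightarrow> p (j b) = \<zero>\<^bsub>A\<^esub> \<and> q (j b) = b"
    using bisum_pairing[OF b mods(1,3) zero_hom_rhom[OF mods(3,2)] rhom_id[OF mods(3)]]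
    by (auto simp: zero_hom_def)
  have "x = i (p x) \<oplus>\<^bsub>Q\<^esub> j (q x)" if x: "x \<in> carrier Q" for x
  proof (rule D(3)[OF x])
    have c: "p x \<in> carrier A" "q x \<in> carrier B" using x rhomD(1)[OF D(1)] rhomD(1)[OF D(2)] by auto
    then have c': "i (p x) \<in> carrier Q" "j (q x) \<in> carrier Q"
      using rhomD(1)[OF i(1)] rhomD(1)[OF j(1)] by auto
    show "i (p x) \<oplus>\<^bsub>Q\<^esub> j (q x) \<in> carrier Q" using c' by simp
    show "p x = p (i (p x) \<oplus>\<^bsub>Q\<^esub> j (q x))" "q x = q (i (p x) \<oplus>\<^bsub>Q\<^esub> j (q x))"
      using c c' i(2) j(2) by (simp_all add: rhomD(2)[OF D(1)] rhomD(2)[OF D(2)])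
  qed
  with i j show ?thesis by (intro that[OF i(1) _ j(1)] ballI)
qed

lemma bisum_short_exact:
  assumes b: "bisum R Q A B p q" and mods: "right_module R Q" "right_module R A" "right_module R B"
  shows "\<exists>i. short_exact R A i Q q B" "\<exists>j. short_exact R B j Q p A"
proof -
  interpret Q: rmod R Q by (rule rmod.intro) fact
  interpret A: rmod R A by (rule rmod.intro) fact
  interpret B: rmod R B by (rule rmod.intro) fact
  note D = bisumD[OF b]
  obtain i j where ij: "i \<in> rhom R A Q" "\<forall>a\<in>carrier A. p (i a) = a \<and> q (i a) = \<zero>\<^bsub>B\<^esub>"
    "j \<in> rhom R B Q" "\<forall>b\<in>carrier B. p (j b) = \<zero>\<^bsub>A\<^esub> \<and> q (j b) = b"
    "\<forall>x\<in>carrier Q. x = i (p x) \<oplus>\<^bsub>Q\<^esub> j (q x)"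
    by (rule bisum_injections[OF assms]) (rule that)
  note i = ij(1) ij(2)[rule_format] and j = ij(3) ij(4)[rule_format] and ij = ij(5)[rule_format]
  note z = rhom_zero[OF i(1) mods(2,1)] rhom_zero[OF j(1) mods(3,1)]
    rhom_zero[OF D(1) mods(1,2)] rhom_zero[OF D(2) mods(1,3)]
  note c = rhomD(1)[OF i(1)] rhomD(1)[OF j(1)] rhomD(1)[OF D(1)] rhomD(1)[OF D(2)]
  have "short_exact R A i Q q B"
  proof (rule short_exactI[OF mods(2,1) i(1) D(2)])
    show "x = \<zero>\<^bsub>A\<^esub>" if "x \<in> carrier A" "i x = \<zero>\<^bsub>Q\<^esub>" for x using i(2)[OF that(1)] that z by simp
    show "q (i x) = \<zero>\<^bsub>B\<^esub>" if "x \<in> carrier A" for x using i(2) that by simp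
    show "\<exists>x\<in>carrier A. i x = y" if "y \<in> carrier Q" "q y = \<zero>\<^bsub>B\<^esub>" for y
      using ij[OF that(1)] that z c by (intro bexI[of _ "p y"]) simp_all
    show "\<exists>y\<in>carrier Q. q y = x" if "x \<in> carrier B" for x using j(2)[OF that] c that by blast
  qed
  then show "\<exists>i. short_exact R A i Q q B" by blast
  have "short_exact R B j Q p A"
  proof (rule short_exactI[OF mods(3,1) j(1) D(1)])
    show "x = \<zero>\<^bsub>B\<^esub>" if "x \<in> carrier B" "j x = \<zero>\<^bsub>Q\<^esub>" for x using j(2)[OF that(1)] that z by simp
    show "p (j x) = \<zero>\<^bsub>A\<^esub>" if "x \<in> carrier B" for x using j(2) that by simp
    show "\<exists>x\<in>carrier B. j x = y" if "y \<in> carrier Q" "p y = \<zero>\<^bsub>A\<^esub>" for y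
      using ij[OF that(1)] that z c by (intro bexI[of _ "q y"]) simp_all
    show "\<exists>y\<in>carrier Q. p y = x" if "x \<in> carrier A" for x using i(2)[OF that] c that by blast
  qed
  then show "\<exists>j. short_exact R B j Q p A" by blast
qed

text \<open>A concrete model on pairs. Its purpose is to be copied into \<open>fgmod R\<close>,
  which shows that direct sums exist there.\<close>

definition prod_module :: "('a, 'b) rmodule \<Rightarrow> ('a, 'c) rmodule \<Rightarrow> ('a, 'b \<times> 'c) rmodule" where
  "prod_module M N = \<lparr>carrier = carrier M \<times> carrier N, mult = undefined, one = undefined,
     zero = (\<zero>\<^bsub>M\<^esub>, \<zero>\<^bsub>N\<^esub>), add = (\<lambda>x y. (fst x \<oplus>\<^bsub>M\<^esub> fst y, snd x \<oplus>\<^bsub>N\<^esub> snd y)),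
     ract = (\<lambda>x a. (fst x \<lhd>\<^bsub>M\<^esub> a, snd x \<lhd>\<^bsub>N\<^esub> a))\<rparr>"

lemma right_module_prod:
  fixes R :: "'a ring"
  assumes "right_module R M" "right_module R N"
  shows "right_module R (prod_module M N)"
proof -
  interpret M: rmod R M by (rule rmod.intro) fact
  interpret N: rmod R N by (rule rmod.intro) fact
  have "abelian_group (prod_module M N)"
  proof (rule abelian_groupI, goal_cases)
    case (6 x) then show ?case
      by (auto simp: prod_module_def M.M.l_neg N.M.l_neg
        intro!: bexI[of _ "(\<ominus>\<^bsub>M\<^esub> fst x, \<ominus>\<^bsub>N\<^esub> snd x)"])
  qed (auto simp: prod_module_def M.M.a_ac N.M.a_ac)
  then show ?thesis using M.R.ring_axioms
    by (auto simp: right_module_def right_module_axioms_def prod_module_def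
      M.ract_closed M.ract_add M.ract_ring_add M.ract_assoc M.ract_one
      N.ract_closed N.ract_add N.ract_ring_add N.ract_assoc N.ract_one)
qed

lemma finitely_generated_prod:
  assumes M: "right_module R M" "finitely_generated R M" and N: "right_module R N" "finitely_generated R N"
  shows "finitely_generated R (prod_module M N)"
proof -
  interpret M: rmod R M by (rule rmod.intro) fact
  interpret N: rmod R N by (rule rmod.intro) fact
  interpret P: rmod R "prod_module M N"
    by (rule rmod.intro, rule right_module_prod) fact+
  obtain G where G: "finite G" "G \<subseteq> carrier M"
    "\<And>U. right_submodule U R M \<Longrightarrow> G \<subseteq> U \<Longrightarrow> U = carrier M"
    using M by (auto simp: finitely_generated_def)
  obtain H where H: "finite H" "H \<subseteq> carrier N"
    "\<And>U. right_submodule U R N \<Longrightarrow> H \<subseteq> U \<Longrightarrow> U = carrier N"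
    using N by (auto simp: finitely_generated_def)
  let ?G = "(\<lambda>x. (x, \<zero>\<^bsub>N\<^esub>)) ` G \<union> (\<lambda>y. (\<zero>\<^bsub>M\<^esub>, y)) ` H"
  show ?thesis unfolding finitely_generated_def
  proof (intro exI[of _ ?G] conjI allI impI)
    show "finite ?G" using G H by simp
    show "?G \<subseteq> carrier (prod_module M N)" using G H by (auto simp: prod_module_def)
    fix U assume "right_submodule U R (prod_module M N) \<and> ?G \<subseteq> U"
    then have U: "right_submodule U R (prod_module M N)" and sub: "?G \<subseteq> U" by auto
    note D = P.right_submoduleD[OF U]
    have D2: "(\<zero>\<^bsub>M\<^esub>, \<zero>\<^bsub>N\<^esub>) \<in> U" using D(2) by (simp add: prod_module_def)
    have D3: "(x \<oplus>\<^bsub>M\<^esub> x', y \<oplus>\<^bsub>N\<^esub> y') \<in> U" if "(x, y) \<in> U" "(x', y') \<in> U" for x y x' y'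
      using D(3)[OF that] by (simp add: prod_module_def)
    have D4: "(x \<lhd>\<^bsub>M\<^esub> a, y \<lhd>\<^bsub>N\<^esub> a) \<in> U" if "(x, y) \<in> U" "a \<in> carrier R" for x y a
      using D(4)[OF that] by (simp add: prod_module_def)
    let ?A = "{x \<in> carrier M. (x, \<zero>\<^bsub>N\<^esub>) \<in> U}" and ?B = "{y \<in> carrier N. (\<zero>\<^bsub>M\<^esub>, y) \<in> U}"
    have "right_submodule ?A R M"
      using D2 D3[of _ "\<zero>\<^bsub>N\<^esub>" _ "\<zero>\<^bsub>N\<^esub>"] D4[of _ "\<zero>\<^bsub>N\<^esub>"]
      by (intro M.right_submoduleI) (auto simp: M.ract_closed N.zero_ract)
    then have A: "?A = carrier M" using sub G(2) by (intro G(3)) auto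
    have "right_submodule ?B R N"
      using D2 D3[of "\<zero>\<^bsub>M\<^esub>" _ "\<zero>\<^bsub>M\<^esub>"] D4[of "\<zero>\<^bsub>M\<^esub>"]
      by (intro N.right_submoduleI) (auto simp: N.ract_closed M.zero_ract)
    then have B: "?B = carrier N" using sub H(2) by (intro H(3)) auto
    have "(x, y) \<in> U" if "x \<in> carrier M" "y \<in> carrier N" for x y
    proof -
      have "(x, \<zero>\<^bsub>N\<^esub>) \<in> U" "(\<zero>\<^bsub>M\<^esub>, y) \<in> U" using that A B by blast+
      from D3[OF this] show ?thesis using that by simp
    qed
    then show "U = carrier (prod_module M N)" using D(1) by (auto simp: prod_module_def)
  qed
qed

lemma bisum_exists:
  assumes A: "A \<in> fgmod R" and B: "B \<in> fgmod R"
  shows "\<exists>Q\<in>fgmod R. \<exists>p q. bisum R Q A B p q"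
proof -
  note m = fgmodD(1)[OF A] fgmodD(1)[OF B]
  interpret P: rmod R "prod_module A B" by (rule rmod.intro, rule right_module_prod[OF m])
  obtain Q \<theta> where Q: "Q \<in> fgmod R" "\<theta> \<in> riso R (prod_module A B) Q"
    using P.fgmod_copy[OF finitely_generated_prod[OF m(1) fgmodD(2)[OF A] m(2) fgmodD(2)[OF B]]] by blast
  obtain \<eta> where \<eta>: "\<eta> \<in> riso R Q (prod_module A B)"
    using riso_inv[OF P.right_module_axioms fgmodD(1)[OF Q(1)] Q(2)] by blast
  then have h: "\<eta> \<in> rhom R Q (prod_module A B)" and
    bij: "bij_betw \<eta> (carrier Q) (carrier A \<times> carrier B)"
    by (auto simp: riso_def prod_module_def)
  have hp: "(\<lambda>x\<in>carrier Q. fst (\<eta> x)) \<in> rhom R Q A" "(\<lambda>x\<in>carrier Q. snd (\<eta> x)) \<in> rhom R Q B"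
    using rhomD(1)[OF h] by (intro rhom_restrictI fgmodD(1)[OF Q(1)];
      force simp: rhomD(2,3)[OF h] prod_module_def)+
  have "bisum R Q A B (\<lambda>x\<in>carrier Q. fst (\<eta> x)) (\<lambda>x\<in>carrier Q. snd (\<eta> x))"
    unfolding bisum_def using hp bij by (auto cong: bij_betw_cong)
  then show ?thesis using Q(1) by blast
qed

text \<open>Right noetherianity in the form that homological arguments use: kernels and fibre
  products of finitely generated modules stay in \<open>fgmod R\<close>. The base ring K does not
  appear, so this part concerns R alone.\<close>

locale right_noetherian_ring = ring R for R :: "'a ring" +
  assumes fgmod_sub: "\<And>M U. M \<in> fgmod R \<Longrightarrow> right_submodule U R M \<Longrightarrow> M\<lparr>carrier := U\<rparr> \<in> fgmod R"

sublocale artin_alg \<subseteq> right_noetherian_ring R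
  using artin_algebraD(4) fgmod_sub
  by (simp add: right_noetherian_ring_def right_noetherian_ring_axioms_def)

lemma isomorphicI:
  "\<lbrakk>f \<in> rhom R M N; inj_on f (carrier M); f ` carrier M = carrier N\<rbrakk> \<Longrightarrow> isomorphic R M N"
  by (auto simp: isomorphic_def riso_def bij_betw_def)

text \<open>The empty product consists of a single element, the function that is undefined
  everywhere, so the empty sum is a zero module.\<close>

lemma isomorphic_direct_sum_empty:
  fixes Q :: "('a, 'b) rmodule" and M :: "'i \<Rightarrow> ('a, 'c) rmodule"
  assumes "right_module R Q"
  shows "isomorphic R Q (direct_sum {} M) \<longleftrightarrow> carrier Q = {\<zero>\<^bsub>Q\<^esub>}"
proof -
  interpret Q: rmod R Q by (rule rmod.intro) fact
  have c: "carrier (direct_sum {} M) = {\<lambda>x. undefined}" by (simp add: direct_sum_def)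
  show ?thesis
  proof
    assume "isomorphic R Q (direct_sum {} M)"
    then obtain f where "bij_betw f (carrier Q) {\<lambda>x::'i. undefined :: 'c}"
      using c by (auto simp: isomorphic_def riso_def)
    then have "inj_on f (carrier Q)" "\<And>x. x \<in> carrier Q \<Longrightarrow> f x = (\<lambda>x. undefined)"
      by (auto simp: bij_betw_def)
    then have "x = \<zero>\<^bsub>Q\<^esub>" if "x \<in> carrier Q" for x
      using that inj_onD[of f "carrier Q" x "\<zero>\<^bsub>Q\<^esub>"] by simp
    then show "carrier Q = {\<zero>\<^bsub>Q\<^esub>}" using Q.M.zero_closed by blast
  next
    assume z: "carrier Q = {\<zero>\<^bsub>Q\<^esub>}"
    have "(\<lambda>x\<in>carrier Q. (\<lambda>i::'i. undefined :: 'c)) \<in> rhom R Q (direct_sum {} M)"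
      by (rule rhom_restrictI[OF assms]) (simp_all add: direct_sum_def restrict_def)
    moreover have "bij_betw (\<lambda>x\<in>carrier Q. (\<lambda>i::'i. undefined :: 'c)) (carrier Q) (carrier (direct_sum {} M))"
      unfolding c by (subst z, subst z) (auto simp: bij_betw_def)
    ultimately show "isomorphic R Q (direct_sum {} M)" by (auto simp: isomorphic_def riso_def)
  qed
qed

lemma isomorphic_direct_sum_insert:
  assumes Q: "right_module R Q" and b: "bisum R Q Q0 (M k) p q"
    and iso: "isomorphic R Q0 (direct_sum I M)" and k: "k \<notin> I"
  shows "isomorphic R Q (direct_sum (insert k I) M)"
proof -
  interpret Q: rmod R Q by (rule rmod.intro) fact
  note D = bisumD[OF b]
  obtain \<theta> where \<theta>: "\<theta> \<in> rhom R Q0 (direct_sum I M)" and bij: "bij_betw \<theta> (carrier Q0) (carrier (direct_sum I M))"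
    using iso by (auto simp: isomorphic_def riso_def)
  note cl = rhomD(1)[OF D(1)] rhomD(1)[OF D(2)]
  have \<theta>c: "\<theta> y \<in> (\<Pi>\<^sub>E i\<in>I. carrier (M i))" if "y \<in> carrier Q0" for y
    using rhomD(1)[OF \<theta> that] by (simp add: direct_sum_def)
  define h where "h x = (\<lambda>i\<in>insert k I. if i = k then q x else \<theta> (p x) i)" for x
  have hom: "(\<lambda>x\<in>carrier Q. h x) \<in> rhom R Q (direct_sum (insert k I) M)"
  proof (rule rhom_restrictI[OF Q], goal_cases)
    case (1 x)
    have "h x i \<in> carrier (M i)" if "i \<in> insert k I" for i
      using that cl[OF 1] \<theta>c[OF cl(1)[OF 1]] by (auto simp: h_def)
    moreover have "h x \<in> extensional (insert k I)" by (simp add: h_def)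
    ultimately show ?case by (simp add: direct_sum_def PiE_iff)
  next
    case (2 x y)
    have "\<theta> (p x \<oplus>\<^bsub>Q0\<^esub> p y) i = \<theta> (p x) i \<oplus>\<^bsub>M i\<^esub> \<theta> (p y) i" if "i \<in> I" for i
      using 2 cl that by (simp add: rhomD(2)[OF \<theta>] direct_sum_def)
    then show ?case using 2 k
      by (auto simp: h_def direct_sum_def rhomD[OF D(1)] rhomD[OF D(2)] fun_eq_iff)
  next
    case (3 x a)
    have "\<theta> (p x \<lhd>\<^bsub>Q0\<^esub> a) i = \<theta> (p x) i \<lhd>\<^bsub>M i\<^esub> a" if "i \<in> I" for i
      using 3 cl that by (simp add: rhomD(3)[OF \<theta>] direct_sum_def)
    then show ?case using 3 k
      by (auto simp: h_def direct_sum_def rhomD[OF D(1)] rhomD[OF D(2)] fun_eq_iff)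
  qed
  have "inj_on h (carrier Q)"
  proof (rule inj_onI)
    fix x y assume xy: "x \<in> carrier Q" "y \<in> carrier Q" "h x = h y"
    have "\<theta> (p x) i = \<theta> (p y) i" for i
    proof (cases "i \<in> I")
      case True
      then have "i \<noteq> k" using k by auto
      then show ?thesis using fun_cong[OF xy(3), of i] True by (simp add: h_def)
    next
      case False then show ?thesis using \<theta>c cl xy by (metis PiE_arb)
    qed
    then have "\<theta> (p x) = \<theta> (p y)" by (rule ext)
    then have "p x = p y" using bij xy cl by (auto simp: bij_betw_def dest: inj_onD)
    moreover have "q x = q y" using fun_cong[OF xy(3), of k] by (simp add: h_def)
    ultimately show "x = y" by (rule D(3)[OF xy(1,2)])
  qed
  then have "inj_on (\<lambda>x\<in>carrier Q. h x) (carrier Q)" by (simp cong: inj_on_cong)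
  moreover have "(\<lambda>x\<in>carrier Q. h x) ` carrier Q = carrier (direct_sum (insert k I) M)"
  proof (intro equalityI subsetI)
    fix v assume v: "v \<in> carrier (direct_sum (insert k I) M)"
    then have vk: "v k \<in> carrier (M k)" by (auto simp: direct_sum_def)
    have "restrict v I \<in> carrier (direct_sum I M)" using v by (auto simp: direct_sum_def)
    then have "restrict v I \<in> \<theta> ` carrier Q0" using bij by (simp add: bij_betw_def)
    then obtain y where y: "y \<in> carrier Q0" "\<theta> y = restrict v I" by (metis imageE)
    obtain x where x: "x \<in> carrier Q" "p x = y" "q x = v k" using D(4)[OF y(1) vk] by blast
    have "h x i = v i" for i
      using v x y k by (auto simp: h_def direct_sum_def PiE_def extensional_def)
    then have "h x = v" by (rule ext)
    then show "v \<in> (\<lambda>x\<in>carrier Q. h x) ` carrier Q" using x by auto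
  qed (use rhomD(1)[OF hom] in auto)
  ultimately show ?thesis by (rule isomorphicI[OF hom])
qed

context right_noetherian_ring
begin

text \<open>The complement of the summand \<open>M k\<close> is realised inside Q, as the kernel of
  the projection to \<open>M k\<close>; in this way it is a member of \<open>fgmod R\<close> on the
  same type.\<close>

lemma direct_sum_insertD:
  assumes Q: "Q \<in> fgmod R" and Mk: "M k \<in> fgmod R"
    and iso: "isomorphic R Q (direct_sum (insert k I) M)" and k: "k \<notin> I"
    and Mi: "\<And>i. i \<in> I \<Longrightarrow> M i \<in> fgmod R"
  shows "\<exists>Q0\<in>fgmod R. \<exists>p q. isomorphic R Q0 (direct_sum I M) \<and> bisum R Q Q0 (M k) p q"
proof -
  have ne: "i \<noteq> k" if "i \<in> I" for i using k that by auto
  note Qm = fgmodD(1)[OF Q] and Mm = fgmodD(1)[OF Mk]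
  interpret Q: rmod R Q by (rule rmod.intro, rule Qm)
  interpret Mk: rmod R "M k" by (rule rmod.intro, rule Mm)
  obtain \<theta> where \<theta>: "\<theta> \<in> rhom R Q (direct_sum (insert k I) M)"
    and bij: "bij_betw \<theta> (carrier Q) (carrier (direct_sum (insert k I) M))"
    using iso by (auto simp: isomorphic_def riso_def)
  have \<theta>c: "\<theta> x \<in> (\<Pi>\<^sub>E i\<in>insert k I. carrier (M i))" if "x \<in> carrier Q" for x
    using rhomD(1)[OF \<theta> that] by (simp add: direct_sum_def)
  have \<theta>i: "\<theta> x i \<in> carrier (M i)" if "x \<in> carrier Q" "i \<in> insert k I" for x i
    using \<theta>c[OF that(1)] that(2) by (rule PiE_mem)
  have \<theta>add: "\<theta> (x \<oplus>\<^bsub>Q\<^esub> y) i = \<theta> x i \<oplus>\<^bsub>M i\<^esub> \<theta> y i"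
    if "x \<in> carrier Q" "y \<in> carrier Q" "i \<in> insert k I" for x y i
    using that by (simp add: rhomD(2)[OF \<theta>] direct_sum_def)
  have \<theta>act: "\<theta> (x \<lhd>\<^bsub>Q\<^esub> a) i = \<theta> x i \<lhd>\<^bsub>M i\<^esub> a"
    if "x \<in> carrier Q" "a \<in> carrier R" "i \<in> insert k I" for x a i
    using that by (simp add: rhomD(3)[OF \<theta>] direct_sum_def)
  have inj: "x = y" if "x \<in> carrier Q" "y \<in> carrier Q" "\<And>i. i \<in> insert k I \<Longrightarrow> \<theta> x i = \<theta> y i" for x y
  proof -
    have "\<theta> x = \<theta> y" by (rule PiE_ext[OF \<theta>c[OF that(1)] \<theta>c[OF that(2)] that(3)])
    then show ?thesis using bij that by (auto simp: bij_betw_def dest: inj_onD)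
  qed
  have "\<exists>x\<in>carrier Q. \<forall>i\<in>insert k I. \<theta> x i = v i" if "\<And>i. i \<in> insert k I \<Longrightarrow> v i \<in> carrier (M i)" for v
  proof -
    have "restrict v (insert k I) \<in> \<theta> ` carrier Q"
      using bij that by (auto simp: bij_betw_def direct_sum_def)
    then obtain x where "x \<in> carrier Q" "restrict v (insert k I) = \<theta> x" by (rule imageE)
    then show ?thesis by (metis restrict_apply')
  qed
  then have surj: "\<And>v. \<exists>x. (\<forall>i\<in>insert k I. v i \<in> carrier (M i)) \<longrightarrow> x \<in> carrier Q \<and> (\<forall>i\<in>insert k I. \<theta> x i = v i)"
    by blast
  \<comment> \<open>\<open>s\<close> inverts \<open>\<theta>\<close> on families with components in
    the right carriers; its values on other families are immaterial.\<close>
  then obtain s where s: "\<And>v. (\<forall>i\<in>insert k I. v i \<in> carrier (M i)) \<longrightarrow> s v \<in> carrier Q \<and> (\<forall>i\<in>insert k I. \<theta> (s v) i = v i)"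
    by metis
  define q where "q = (\<lambda>x\<in>carrier Q. \<theta> x k)"
  have q: "q \<in> rhom R Q (M k)" unfolding q_def
    by (rule rhom_restrictI[OF Qm]) (simp_all add: \<theta>i \<theta>add \<theta>act)
  define U where "U = {x \<in> carrier Q. q x = \<zero>\<^bsub>M k\<^esub>}"
  have U: "right_submodule U R Q" unfolding U_def by (rule right_submodule_kernel[OF Qm Mm q])
  have Uk: "x \<in> U \<longleftrightarrow> x \<in> carrier Q \<and> \<theta> x k = \<zero>\<^bsub>M k\<^esub>" for x by (auto simp: U_def q_def)
  let ?Q0 = "Q\<lparr>carrier := U\<rparr>"
  have Q0: "?Q0 \<in> fgmod R" by (rule fgmod_sub[OF Q U])
  define p where "p x = s ((\<theta> x)(k := \<zero>\<^bsub>M k\<^esub>))" for x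
  have p1: "p x \<in> carrier Q" "\<theta> (p x) k = \<zero>\<^bsub>M k\<^esub>" if "x \<in> carrier Q" for x
    using s[of "(\<theta> x)(k := \<zero>\<^bsub>M k\<^esub>)"] \<theta>i[OF that] by (auto simp: p_def)
  have p2: "\<theta> (p x) i = \<theta> x i" if "x \<in> carrier Q" "i \<in> I" for x i
    using s[of "(\<theta> x)(k := \<zero>\<^bsub>M k\<^esub>)"] \<theta>i[OF that(1)] that(2) k by (auto simp: p_def)
  have p: "(\<lambda>x\<in>carrier Q. p x) \<in> rhom R Q ?Q0"
  proof (rule rhom_restrictI[OF Qm], goal_cases)
    case (1 x) then show ?case using p1 by (simp add: Uk)
  next
    case (2 x y)
    have "p (x \<oplus>\<^bsub>Q\<^esub> y) = p x \<oplus>\<^bsub>Q\<^esub> p y"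
      by (rule inj) (use 2 p1 p2 in \<open>auto simp: \<theta>add\<close>)
    then show ?case by simp
  next
    case (3 x a)
    have "p (x \<lhd>\<^bsub>Q\<^esub> a) = p x \<lhd>\<^bsub>Q\<^esub> a"
      by (rule inj) (use 3 p1 p2 in \<open>auto simp: \<theta>act Q.ract_closed Mk.zero_ract\<close>)
    then show ?case by simp
  qed
  have "bisum R Q ?Q0 (M k) (\<lambda>x\<in>carrier Q. p x) q"
  proof (rule bisumI[OF p q])
    fix x y assume xy: "x \<in> carrier Q" "y \<in> carrier Q"
      and pq: "(\<lambda>x\<in>carrier Q. p x) x = (\<lambda>x\<in>carrier Q. p x) y" "q x = q y"
    show "x = y"
    proof (rule inj[OF xy])
      fix i assume "i \<in> insert k I"
      then show "\<theta> x i = \<theta> y i" using pq xy p2[of x i] p2[of y i] by (auto simp: q_def)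
    qed
  next
    fix a b assume a: "a \<in> carrier ?Q0" and b: "b \<in> carrier (M k)"
    have ac: "a \<in> carrier Q" "\<theta> a k = \<zero>\<^bsub>M k\<^esub>" using a by (auto simp: Uk)
    let ?x = "s ((\<theta> a)(k := b))"
    have x: "?x \<in> carrier Q" "\<theta> ?x k = b" "\<And>i. i \<in> I \<Longrightarrow> \<theta> ?x i = \<theta> a i"
      using s[of "(\<theta> a)(k := b)"] \<theta>i[OF ac(1)] b k by auto
    have "p ?x = a" by (rule inj) (use x p1 p2 ac in auto)
    then show "\<exists>x\<in>carrier Q. (\<lambda>x\<in>carrier Q. p x) x = a \<and> q x = b"
      using x by (intro bexI[of _ ?x]) (auto simp: q_def)
  qed
  moreover have "isomorphic R ?Q0 (direct_sum I M)"
  proof -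
    let ?h = "\<lambda>x\<in>carrier ?Q0. restrict (\<theta> x) I"
    have "?h \<in> rhom R ?Q0 (direct_sum I M)"
      by (rule rhom_restrictI[OF fgmodD(1)[OF Q0]])
        (auto simp: Uk \<theta>i \<theta>add \<theta>act direct_sum_def fun_eq_iff restrict_def)
    moreover have "inj_on ?h U"
    proof (rule inj_onI)
      fix x y assume xy: "x \<in> U" "y \<in> U" "?h x = ?h y"
      show "x = y"
      proof (rule inj)
        fix i assume i: "i \<in> insert k I"
        show "\<theta> x i = \<theta> y i"
        proof (cases "i = k")
          case False
          then have "i \<in> I" using i by simp
          then show ?thesis using fun_cong[OF xy(3), of i] xy(1,2) by simp
        qed (use xy in \<open>simp add: Uk\<close>)
      qed (use xy in \<open>simp_all add: Uk\<close>)
    qed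
    moreover have "?h ` U = carrier (direct_sum I M)"
    proof (intro equalityI subsetI)
      fix v assume "v \<in> ?h ` U"
      then show "v \<in> carrier (direct_sum I M)" by (auto simp: direct_sum_def Uk \<theta>i)
    next
      fix v assume v: "v \<in> carrier (direct_sum I M)"
      let ?x = "s (v(k := \<zero>\<^bsub>M k\<^esub>))"
      have x: "?x \<in> carrier Q" "\<theta> ?x k = \<zero>\<^bsub>M k\<^esub>" "\<And>i. i \<in> I \<Longrightarrow> \<theta> ?x i = v i"
        using s[of "v(k := \<zero>\<^bsub>M k\<^esub>)"] v ne by (auto simp: direct_sum_def PiE_iff)
      have "restrict (\<theta> ?x) I = v"
        using x(3) v by (auto simp: direct_sum_def PiE_def extensional_def fun_eq_iff)
      moreover have "?x \<in> U" using x by (simp add: Uk)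
      ultimately show "v \<in> ?h ` U" by (intro image_eqI[of _ _ ?x]) simp_all
    qed
    ultimately show ?thesis by (intro isomorphicI[of ?h]) simp_all
  qed
  ultimately show ?thesis using Q0 by blast
qed

text \<open>Reduces finite direct sums to binary ones, so that the functions which make up a
  \<open>direct_sum\<close> need not be looked at again.\<close>

lemma direct_sum_induct:
  assumes "finite I" and "\<And>i. i \<in> I \<Longrightarrow> M i \<in> fgmod R"
    and "Q \<in> fgmod R" and "isomorphic R Q (direct_sum I M)"
    and zero: "\<And>Z. Z \<in> fgmod R \<Longrightarrow> carrier Z = {\<zero>\<^bsub>Z\<^esub>} \<Longrightarrow> P Z"
    and step: "\<And>Q0 Q k p q. k \<in> I \<Longrightarrow> Q0 \<in> fgmod R \<Longrightarrow> Q \<in> fgmod R \<Longrightarrow> P Q0 \<Longrightarrow>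
      bisum R Q Q0 (M k) p q \<Longrightarrow> P Q"
  shows "P Q"
  using assms(1-4) step
proof (induction I arbitrary: Q rule: finite_induct)
  case empty
  then show ?case using zero isomorphic_direct_sum_empty fgmodD(1) by blast
next
  case (insert k I)
  obtain Q0 p q where Q0: "Q0 \<in> fgmod R" "isomorphic R Q0 (direct_sum I M)" "bisum R Q Q0 (M k) p q"
    using direct_sum_insertD[OF insert.prems(2) _ insert.prems(3) insert.hyps(2)] insert.prems(1) by blast
  have "P Q0"
  proof (rule insert.IH[OF _ Q0(1,2)])
    show "M i \<in> fgmod R" if "i \<in> I" for i using insert.prems(1) that by simp
    show "P Q'" if "l \<in> I" "Q0' \<in> fgmod R" "Q' \<in> fgmod R" "P Q0'" "bisum R Q' Q0' (M l) p' q'"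
      for l Q0' Q' p' q'
      using insert.prems(4)[OF _ that(2-5)] that(1) by simp
  qed
  then show ?case using insert.prems(4)[of k Q0 Q] Q0 insert.prems(2) by blast
qed

lemma fgmod_zero_sub: "M \<in> fgmod R \<Longrightarrow> M\<lparr>carrier := {\<zero>\<^bsub>M\<^esub>}\<rparr> \<in> fgmod R"
  using fgmod_sub rmod.right_submodule_zero[OF rmod.intro] fgmodD(1) by blast

text \<open>\<open>Z\<close> supplies, through its zero submodule, the module that represents the
  empty sum.\<close>

lemma direct_sum_exists:
  assumes "finite I" and "\<And>i. i \<in> I \<Longrightarrow> M i \<in> fgmod R" and Z: "Z \<in> fgmod R"
  shows "\<exists>Q\<in>fgmod R. isomorphic R Q (direct_sum I M)"
  using assms(1,2)
proof (induction I rule: finite_induct)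
  case empty
  show ?case
    using isomorphic_direct_sum_empty[OF fgmodD(1)[OF fgmod_zero_sub[OF Z]]] fgmod_zero_sub[OF Z]
    by (intro bexI[of _ "Z\<lparr>carrier := {\<zero>\<^bsub>Z\<^esub>}\<rparr>"]) simp_all
next
  case (insert k I)
  then obtain Q0 where Q0: "Q0 \<in> fgmod R" "isomorphic R Q0 (direct_sum I M)" by auto
  obtain Q p q where Q: "Q \<in> fgmod R" "bisum R Q Q0 (M k) p q"
    using bisum_exists[OF Q0(1), of "M k"] insert.prems by auto
  then show ?case
    using isomorphic_direct_sum_insert[OF fgmodD(1)[OF Q(1)] Q(2) Q0(2) insert.hyps(2)] by blast
qed

end

section \<open>Filtrations\<close>

text \<open>Translates a factor of a filtration, which lives on a type of cosets, into a surjection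
  with prescribed kernel, that is, into a short exact sequence.\<close>

lemma isomorphic_quot_module_iff:
  fixes R :: "'a ring"
  assumes M: "right_module R M" and N: "right_module R N" and U: "right_submodule U R M"
  shows "isomorphic R (quot_module M U) N \<longleftrightarrow>
    (\<exists>g\<in>rhom R M N. g ` carrier M = carrier N \<and> {x \<in> carrier M. g x = \<zero>\<^bsub>N\<^esub>} = U)"
proof -
  interpret M: rmod R M by (rule rmod.intro) fact
  let ?Q = "quot_module M U"
  define p where "p = (\<lambda>x\<in>carrier M. U +>\<^bsub>M\<^esub> x)"
  have p: "right_module R ?Q" "p \<in> rhom R M ?Q" "p ` carrier M = carrier ?Q"
    "\<And>x. x \<in> carrier M \<Longrightarrow> p x = \<zero>\<^bsub>?Q\<^esub> \<longleftrightarrow> x \<in> U"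
    using M.quot_module_proj[OF U] by (simp_all add: p_def)
  interpret Q: rmod R ?Q by (rule rmod.intro) fact
  have Uc: "x \<in> U \<Longrightarrow> x \<in> carrier M" for x by (rule M.right_submoduleD(1)[OF U])
  show ?thesis
  proof
    assume "isomorphic R ?Q N"
    then obtain \<theta> where \<theta>: "\<theta> \<in> rhom R ?Q N" "inj_on \<theta> (carrier ?Q)" "\<theta> ` carrier ?Q = carrier N"
      by (auto simp: isomorphic_def riso_def bij_betw_def)
    have t0: "\<theta> y = \<zero>\<^bsub>N\<^esub> \<longleftrightarrow> y = \<zero>\<^bsub>?Q\<^esub>" if "y \<in> carrier ?Q" for y
      using inj_onD[OF \<theta>(2), of y "\<zero>\<^bsub>?Q\<^esub>"] rhom_zero[OF \<theta>(1) p(1) N] that by auto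
    let ?g = "\<lambda>x\<in>carrier M. \<theta> (p x)"
    have "?g ` carrier M = \<theta> ` (p ` carrier M)" by (auto simp: image_iff)
    then have "?g ` carrier M = carrier N" using p(3) \<theta>(3) by simp
    moreover have "{x \<in> carrier M. ?g x = \<zero>\<^bsub>N\<^esub>} = U"
      using t0[OF rhomD(1)[OF p(2)]] p(4) Uc by auto
    ultimately show "\<exists>g\<in>rhom R M N. g ` carrier M = carrier N \<and> {x \<in> carrier M. g x = \<zero>\<^bsub>N\<^esub>} = U"
      using rhom_compose[OF M p(2) \<theta>(1)] by blast
  next
    assume "\<exists>g\<in>rhom R M N. g ` carrier M = carrier N \<and> {x \<in> carrier M. g x = \<zero>\<^bsub>N\<^esub>} = U"
    then obtain g where g: "g \<in> rhom R M N" "g ` carrier M = carrier N"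
      "{x \<in> carrier M. g x = \<zero>\<^bsub>N\<^esub>} = U" by blast
    have "g x = \<zero>\<^bsub>N\<^esub>" if "x \<in> carrier M" "p x = \<zero>\<^bsub>?Q\<^esub>" for x using g(3) p(4) that by blast
    then obtain k where k: "k \<in> rhom R ?Q N" "\<And>x. x \<in> carrier M \<Longrightarrow> k (p x) = g x"
      using rhom_factor[OF M p(1) N p(2,3) g(1)] by blast
    have "inj_on k (carrier ?Q)"
    proof (rule rhom_inj_onI[OF p(1) N k(1)])
      fix y assume y: "y \<in> carrier ?Q" "k y = \<zero>\<^bsub>N\<^esub>"
      then obtain x where "x \<in> carrier M" "y = p x" using p(3) by (metis imageE)
      then show "y = \<zero>\<^bsub>?Q\<^esub>" using y k(2) g(3) p(4) by auto
    qed
    moreover have "k ` carrier ?Q = carrier N"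
    proof -
      have "k ` (p ` carrier M) = g ` carrier M" using k(2) by (force simp: image_iff)
      then show ?thesis using p(3) g(2) by simp
    qed
    ultimately show "isomorphic R ?Q N" using k(1) by (auto simp: isomorphic_def riso_def bij_betw_def)
  qed
qed

context right_noetherian_ring
begin

lemma zero_module_Filt:
  assumes Z: "Z \<in> fgmod R" and "carrier Z = {\<zero>\<^bsub>Z\<^esub>}"
  shows "Z \<in> Filt R \<Delta> J"
proof -
  interpret Z: rmod R Z by (rule rmod.intro) (rule fgmodD[OF Z])
  have "filtered R F Z" for F
    unfolding filtered_def using assms(2) Z.right_submodule_zero
    by (intro exI[of _ "0::nat"] exI[of _ "\<lambda>i. {\<zero>\<^bsub>Z\<^esub>}"]) simp
  then show ?thesis using Z by (simp add: Filt_def)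
qed

lemma Filt_fgmod: "X \<in> Filt R \<Delta> J \<Longrightarrow> X \<in> fgmod R"
  by (simp add: Filt_def)

lemma Filt_mono: "J \<subseteq> J' \<Longrightarrow> Filt R \<Delta> J \<subseteq> Filt R \<Delta> J'"
  unfolding Filt_def filtered_def by (intro Collect_mono conj_mono ex_mono all_mono imp_mono impI) auto

text \<open>Peels off the top factor: every filtered module arises from a zero module by successive
  extensions with some \<open>\<Delta> j\<close> as quotient. The members of the filtration are
  themselves filtered, a fact made available in the step.\<close>

lemma Filt_induct:
  assumes X: "X \<in> Filt R \<Delta> J" and \<Delta>: "\<forall>j\<in>J. \<Delta> j \<in> fgmod R"
    and zero: "\<And>Z. Z \<in> fgmod R \<Longrightarrow> carrier Z = {\<zero>\<^bsub>Z\<^esub>} \<Longrightarrow> P Z"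
    and step: "\<And>A B j f g. j \<in> J \<Longrightarrow> A \<in> Filt R \<Delta> J \<Longrightarrow> B \<in> Filt R \<Delta> J \<Longrightarrow> P A \<Longrightarrow>
      short_exact R A f B g (\<Delta> j) \<Longrightarrow> P B"
  shows "P X"
proof -
  have Xf: "X \<in> fgmod R" using X by (rule Filt_fgmod)
  interpret X: rmod R X by (rule rmod.intro) (rule fgmodD[OF Xf])
  obtain t Y where Y: "Y 0 = {\<zero>\<^bsub>X\<^esub>}" "Y t = carrier X" "\<And>i. i \<le> t \<Longrightarrow> right_submodule (Y i) R X"
    "\<And>i. i < t \<Longrightarrow> Y i \<subseteq> Y (Suc i)"
    "\<And>i. i < t \<Longrightarrow> \<exists>j\<in>J. isomorphic R (quot_module (X\<lparr>carrier := Y (Suc i)\<rparr>) (Y i)) (\<Delta> j)"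
    using X by (auto simp: Filt_def filtered_def)
  have mono: "Y i \<subseteq> Y k" if "i \<le> k" "k \<le> t" for i k
    using that
  proof (induction k rule: dec_induct)
    case (step n)
    then show ?case using Y(4)[of n] by auto
  qed simp
  have "X\<lparr>carrier := Y i\<rparr> \<in> Filt R \<Delta> J \<and> P (X\<lparr>carrier := Y i\<rparr>)" if "i \<le> t" for i
    using that
  proof (induction i)
    case 0
    then show ?case
      using zero[OF fgmod_zero_sub[OF Xf]] zero_module_Filt[OF fgmod_zero_sub[OF Xf]] Y(1) by simp
  next
    case (Suc i)
    let ?A = "X\<lparr>carrier := Y i\<rparr>" and ?B = "X\<lparr>carrier := Y (Suc i)\<rparr>"
    have sub: "right_submodule (Y i) R X" "right_submodule (Y (Suc i)) R X" using Suc Y(3) by auto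
    have Bf: "?B \<in> fgmod R" by (rule fgmod_sub[OF Xf sub(2)])
    interpret B: rmod R ?B by (rule rmod.intro) (rule fgmodD[OF Bf])
    have subB: "right_submodule (Y k) R ?B" if "k \<le> Suc i" for k
      using mono[OF that] Suc.prems Y(3) that by (simp add: X.right_submodule_sub_iff[OF sub(2)])
    have "filtered R (\<lambda>Q. \<exists>j\<in>J. isomorphic R Q (\<Delta> j)) ?B"
      unfolding filtered_def using Y(1,4,5) Suc.prems subB
      by (intro exI[of _ "Suc i"] exI[of _ Y]) auto
    then have BF: "?B \<in> Filt R \<Delta> J" using Bf by (simp add: Filt_def)
    obtain j where j: "j \<in> J" "isomorphic R (quot_module ?B (Y i)) (\<Delta> j)" using Y(5)[of i] Suc by auto
    obtain g where g: "g \<in> rhom R ?B (\<Delta> j)" "g ` carrier ?B = carrier (\<Delta> j)"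
      "{x \<in> carrier ?B. g x = \<zero>\<^bsub>\<Delta> j\<^esub>} = Y i"
      using j isomorphic_quot_module_iff[OF fgmodD(1)[OF Bf] fgmodD(1)[OF bspec[OF \<Delta> j(1)]] subB[of i]] by auto
    have ex: "short_exact R ?A (\<lambda>x\<in>Y i. x) ?B g (\<Delta> j)"
      using short_exact_kernel[OF fgmodD(1)[OF Bf] fgmodD(1)[OF bspec[OF \<Delta> j(1)]] g(1,2)] g(3) by simp
    show ?case using Suc by (intro conjI BF step[OF j(1) _ BF _ ex]) auto
  qed
  then have "P (X\<lparr>carrier := Y t\<rparr>)" by simp
  then show ?thesis using Y(2) by simp
qed

text \<open>The construction that \<open>Filt_induct\<close> inverts. The filtration of A is carried
  into B by f, and B is put on top; the lower factors are unchanged because f restricts to an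
  isomorphism from each member onto its image.\<close>

lemma Filt_extend:
  assumes A: "A \<in> Filt R \<Delta> J" and B: "B \<in> fgmod R" and j: "j \<in> J" and \<Delta>: "\<forall>j\<in>J. \<Delta> j \<in> fgmod R"
    and ex: "short_exact R A f B g (\<Delta> j)"
  shows "B \<in> Filt R \<Delta> J"
proof -
  note Am = fgmodD(1)[OF Filt_fgmod[OF A]] and Bm = fgmodD(1)[OF B] and \<Delta>m = fgmodD(1)[OF bspec[OF \<Delta> j]]
  interpret A: rmod R A by (rule rmod.intro) fact
  interpret B: rmod R B by (rule rmod.intro) fact
  interpret D: rmod R "\<Delta> j" by (rule rmod.intro) fact
  note E = short_exactD[OF ex]
  obtain t Y where Y: "Y 0 = {\<zero>\<^bsub>A\<^esub>}" "Y t = carrier A" "\<And>i. i \<le> t \<Longrightarrow> right_submodule (Y i) R A"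
    "\<And>i. i < t \<Longrightarrow> Y i \<subseteq> Y (Suc i)"
    "\<And>i. i < t \<Longrightarrow> \<exists>j\<in>J. isomorphic R (quot_module (A\<lparr>carrier := Y (Suc i)\<rparr>) (Y i)) (\<Delta> j)"
    using A by (auto simp: Filt_def filtered_def)
  \<comment> \<open>One step longer than the filtration of A: position t is the image of A, and
    position t + 1 is all of B.\<close>
  let ?Y = "\<lambda>i. if i \<le> t then f ` Y i else carrier B"
  have sub: "right_submodule (?Y i) R B" for i
    using right_submodule_image[OF Am Bm E(1) Y(3)] B.right_submodule_carrier by simp
  have ft: "f ` carrier A = {x \<in> carrier B. g x = \<zero>\<^bsub>\<Delta> j\<^esub>}"
    using E(5,6) rhomD(1)[OF E(1)] by blast
  have "\<exists>j\<in>J. isomorphic R (quot_module (B\<lparr>carrier := ?Y (Suc i)\<rparr>) (?Y i)) (\<Delta> j)" if "i \<le> t" for i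
  proof (cases "i = t")
    case True
    have "isomorphic R (quot_module B (f ` carrier A)) (\<Delta> j)"
      using sub[of t] E(2,4) ft Y(2) by (subst isomorphic_quot_module_iff[OF Bm \<Delta>m]) auto
    then show ?thesis using True Y(2) j by auto
  next
    case False
    then have i: "i < t" "Suc i \<le> t" "i \<le> t" using that by auto
    let ?A = "A\<lparr>carrier := Y (Suc i)\<rparr>" and ?B = "B\<lparr>carrier := f ` Y (Suc i)\<rparr>"
    obtain l where l: "l \<in> J" "isomorphic R (quot_module ?A (Y i)) (\<Delta> l)" using Y(5)[OF i(1)] by blast
    have subA: "right_submodule (Y (Suc i)) R A" "right_submodule (Y i) R A" using Y(3) i by auto
    have Yc: "x \<in> Y (Suc i) \<Longrightarrow> x \<in> carrier A" for x by (rule A.right_submoduleD(1)[OF subA(1)])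
    have Am': "right_module R ?A" by (rule A.right_module_sub[OF subA(1)])
    have subB: "right_submodule (f ` Y (Suc i)) R B" "right_submodule (f ` Y i) R B"
      using sub[of "Suc i"] sub[of i] i by simp_all
    have Bm': "right_module R ?B" by (rule B.right_module_sub[OF subB(1)])
    have fA: "f \<in> rhom R A B" by (rule E(1))
    have r: "(\<lambda>x\<in>carrier ?A. f x) \<in> rhom R ?A ?B"
      by (rule rhom_restrictI[OF Am']) (simp_all add: Yc rhomD[OF fA])
    have inj: "inj_on f (Y (Suc i))" by (rule inj_on_subset[OF E(3)]) (use Yc in blast)
    have fr: "(\<lambda>x\<in>carrier ?A. f x) \<in> riso R ?A ?B"
      using r inj by (auto simp: riso_def bij_betw_def cong: inj_on_cong)
    obtain e where e: "e \<in> riso R ?B ?A" "\<And>x. x \<in> Y (Suc i) \<Longrightarrow> e (f x) = x"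
      using riso_inv[OF Am' Bm' fr] by auto
    note \<Delta>l = fgmodD(1)[OF bspec[OF \<Delta> l(1)]]
    have Ysub: "right_submodule (Y i) R ?A"
      using Y(4)[OF i(1)] subA by (simp add: A.right_submodule_sub_iff[OF subA(1)])
    obtain k where k: "k \<in> rhom R ?A (\<Delta> l)" "k ` Y (Suc i) = carrier (\<Delta> l)"
      "{x \<in> Y (Suc i). k x = \<zero>\<^bsub>\<Delta> l\<^esub>} = Y i"
      using l(2) isomorphic_quot_module_iff[OF Am' \<Delta>l Ysub] by auto
    let ?k = "\<lambda>y\<in>carrier ?B. k (e y)"
    have kB: "?k \<in> rhom R ?B (\<Delta> l)" using e(1) by (intro rhom_compose[OF Bm' _ k(1)]) (simp add: riso_def)
    have kf: "?k (f x) = k x" if "x \<in> Y (Suc i)" for x using that e(2) by simp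
    have "?k ` f ` Y (Suc i) = k ` Y (Suc i)"
      unfolding image_image by (rule image_cong[OF refl kf])
    then have im: "?k ` carrier ?B = carrier (\<Delta> l)" using k(2) by simp
    have "{y \<in> carrier ?B. ?k y = \<zero>\<^bsub>\<Delta> l\<^esub>} = f ` {x \<in> Y (Suc i). k x = \<zero>\<^bsub>\<Delta> l\<^esub>}"
      using kf by auto
    then have ker: "{y \<in> carrier ?B. ?k y = \<zero>\<^bsub>\<Delta> l\<^esub>} = f ` Y i" unfolding k(3) .
    have YB: "right_submodule (f ` Y i) R ?B"
      using subB Y(4)[OF i(1)] by (auto simp: B.right_submodule_sub_iff[OF subB(1)])
    have "isomorphic R (quot_module ?B (f ` Y i)) (\<Delta> l)"
      unfolding isomorphic_quot_module_iff[OF Bm' \<Delta>l YB] using kB im ker by blast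
    then show ?thesis using i l(1) by auto
  qed
  moreover have "?Y i \<subseteq> ?Y (Suc i)" if "i \<le> t" for i
  proof (cases "Suc i \<le> t")
    case True
    then show ?thesis using image_mono[OF Y(4)[of i]] by simp
  qed (use that rhomD(1)[OF E(1)] A.right_submoduleD(1)[OF Y(3)[OF that]] in auto)
  moreover have "?Y 0 = {\<zero>\<^bsub>B\<^esub>}" using Y(1) rhom_zero[OF E(1) Am Bm] by simp
  ultimately have "filtered R (\<lambda>Q. \<exists>j\<in>J. isomorphic R Q (\<Delta> j)) B"
    unfolding filtered_def using sub by (intro exI[of _ "Suc t"] exI[of _ ?Y]) (simp add: less_Suc_eq_le)
  then show ?thesis using B by (simp add: Filt_def)
qed

text \<open>Only the topmost extension has to be moved along the isomorphism; the submodule A below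
  it keeps its own filtration.\<close>

lemma Filt_isomorphic:
  assumes A: "A \<in> Filt R \<Delta> J" and \<Delta>: "\<forall>j\<in>J. \<Delta> j \<in> fgmod R"
    and B: "B \<in> fgmod R" and iso: "isomorphic R A B"
  shows "B \<in> Filt R \<Delta> J"
proof -
  have "\<forall>B\<in>fgmod R. isomorphic R A B \<longrightarrow> B \<in> Filt R \<Delta> J"
  proof (rule Filt_induct[where P = "\<lambda>A. \<forall>B\<in>fgmod R. isomorphic R A B \<longrightarrow> B \<in> Filt R \<Delta> J",
      OF A \<Delta>]; intro ballI impI)
    fix Z :: "'a fgm" and B :: "'a fgm"
    assume zero: "Z \<in> fgmod R" "carrier Z = {\<zero>\<^bsub>Z\<^esub>}" "B \<in> fgmod R" "isomorphic R Z B"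
    then obtain f where f: "f \<in> rhom R Z B" "f ` carrier Z = carrier B"
      by (auto simp: isomorphic_def riso_def bij_betw_def)
    then have "carrier B = {\<zero>\<^bsub>B\<^esub>}"
      using rhom_zero[OF f(1)] fgmodD(1) zero by (metis image_insert image_empty)
    then show "B \<in> Filt R \<Delta> J" using zero_module_Filt zero by blast
  next
    fix A A1 j f g and B :: "'a fgm"
    assume hyps: "j \<in> J" "A \<in> Filt R \<Delta> J" "A1 \<in> Filt R \<Delta> J" "short_exact R A f A1 g (\<Delta> j)"
      and prems: "B \<in> fgmod R" "isomorphic R A1 B"
    note m = fgmodD(1)[OF Filt_fgmod[OF hyps(2)]] fgmodD(1)[OF Filt_fgmod[OF hyps(3)]]
      fgmodD(1)[OF prems(1)]
    obtain \<theta> where \<theta>: "\<theta> \<in> riso R A1 B" using prems(2) by (auto simp: isomorphic_def)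
    obtain \<eta> where \<eta>: "\<eta> \<in> riso R B A1" "\<And>x. x \<in> carrier A1 \<Longrightarrow> \<eta> (\<theta> x) = x"
      "\<And>y. y \<in> carrier B \<Longrightarrow> \<theta> (\<eta> y) = y"
      using riso_inv[OF m(2,3) \<theta>] by auto
    have h: "\<theta> \<in> rhom R A1 B" "\<eta> \<in> rhom R B A1" using \<theta> \<eta> by (auto simp: riso_def)
    note E = short_exactD[OF hyps(4)]
    have "short_exact R A (\<lambda>x\<in>carrier A. \<theta> (f x)) B (\<lambda>x\<in>carrier B. g (\<eta> x)) (\<Delta> j)"
    proof (rule short_exactI[OF m(1,3) rhom_compose[OF m(1) E(1) h(1)] rhom_compose[OF m(3) h(2) E(2)]])
      fix x assume x: "x \<in> carrier A"
      note fx = rhomD(1)[OF E(1) x]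
      show "(\<lambda>x\<in>carrier B. g (\<eta> x)) ((\<lambda>x\<in>carrier A. \<theta> (f x)) x) = \<zero>\<^bsub>\<Delta> j\<^esub>"
        using x fx rhomD(1)[OF h(1) fx] \<eta>(2)[OF fx] E(5) by simp
      assume "(\<lambda>x\<in>carrier A. \<theta> (f x)) x = \<zero>\<^bsub>B\<^esub>"
      then have "\<eta> (\<theta> (f x)) = \<zero>\<^bsub>A1\<^esub>" using x rhom_zero[OF h(2) m(3,2)] by simp
      then have "f x = \<zero>\<^bsub>A1\<^esub>" using \<eta>(2)[OF fx] by simp
      then show "x = \<zero>\<^bsub>A\<^esub>" by (rule short_exact_ker[OF hyps(4) m(1,2) x])
    next
      fix y assume y: "y \<in> carrier B" "(\<lambda>x\<in>carrier B. g (\<eta> x)) y = \<zero>\<^bsub>\<Delta> j\<^esub>"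
      then obtain x where "x \<in> carrier A" "\<eta> y = f x"
        using E(6)[OF rhomD(1)[OF h(2) y(1)]] by auto
      then show "\<exists>x\<in>carrier A. (\<lambda>x\<in>carrier A. \<theta> (f x)) x = y"
        using \<eta>(3)[OF y(1)] by (intro bexI[of _ x]) auto
    next
      fix z assume "z \<in> carrier (\<Delta> j)"
      then obtain y where y: "y \<in> carrier A1" "g y = z" using E(7) by blast
      then show "\<exists>y\<in>carrier B. (\<lambda>x\<in>carrier B. g (\<eta> x)) y = z"
        using rhomD(1)[OF h(1) y(1)] \<eta>(2) by (intro bexI[of _ "\<theta> y"]) auto
    qed
    then show "B \<in> Filt R \<Delta> J" by (rule Filt_extend[OF hyps(2) prems(1) hyps(1) \<Delta>])
  qed
  then show ?thesis using B iso by blast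
qed

text \<open>Induction on C, with B and the maps kept general: the preimage in B of the smaller
  module C' is an extension of C' by A, hence filtered by the induction hypothesis, and
  \<open>\<Delta> j\<close> remains as the top factor.\<close>

lemma Filt_extension:
  assumes C: "C \<in> Filt R \<Delta> J" and \<Delta>: "\<forall>j\<in>J. \<Delta> j \<in> fgmod R"
    and A: "A \<in> Filt R \<Delta> J" and B: "B \<in> fgmod R" and ex: "short_exact R A f B g C"
  shows "B \<in> Filt R \<Delta> J"
proof -
  have "\<forall>B\<in>fgmod R. \<forall>f g. short_exact R A f B g C \<longrightarrow> B \<in> Filt R \<Delta> J"
  proof (rule Filt_induct[where P = "\<lambda>C. \<forall>B\<in>fgmod R. \<forall>f g. short_exact R A f B g C \<longrightarrow> B \<in> Filt R \<Delta> J",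
      OF C \<Delta>]; intro ballI allI impI)
    fix Z B :: "'a fgm" and f g
    assume zero: "Z \<in> fgmod R" "carrier Z = {\<zero>\<^bsub>Z\<^esub>}" and prems: "B \<in> fgmod R" "short_exact R A f B g Z"
    note m = fgmodD(1)[OF Filt_fgmod[OF A]] fgmodD(1)[OF prems(1)]
    note E = short_exactD[OF prems(2)]
    have "f ` carrier A = carrier B"
      using E(6) rhomD(1)[OF E(1)] rhomD(1)[OF E(2)] zero(2) by blast
    then have "f \<in> riso R A B" using E(1,3) by (simp add: riso_def bij_betw_def)
    then have "isomorphic R A B" by (auto simp: isomorphic_def)
    then show "B \<in> Filt R \<Delta> J" using Filt_isomorphic[OF A \<Delta> prems(1)] by blast
  next
    fix C' C j f' g' and B :: "'a fgm" and f g
    assume hyps: "j \<in> J" "C' \<in> Filt R \<Delta> J" "C \<in> Filt R \<Delta> J" "short_exact R C' f' C g' (\<Delta> j)"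
      and IH: "\<forall>B\<in>fgmod R. \<forall>f g. short_exact R A f B g C' \<longrightarrow> B \<in> Filt R \<Delta> J"
      and prems: "B \<in> fgmod R" "short_exact R A f B g C"
    note Bf = prems(1)
    note m = fgmodD(1)[OF Filt_fgmod[OF A]] fgmodD(1)[OF Bf]
      fgmodD(1)[OF Filt_fgmod[OF hyps(2)]] fgmodD(1)[OF Filt_fgmod[OF hyps(3)]]
      fgmodD(1)[OF bspec[OF \<Delta> hyps(1)]]
    note pre = short_exact_preimage[OF m prems(2) hyps(4)]
    let ?B = "B\<lparr>carrier := {x \<in> carrier B. g' (g x) = \<zero>\<^bsub>\<Delta> j\<^esub>}\<rparr>"
    have "?B \<in> Filt R \<Delta> J" using IH pre(2) fgmod_sub[OF Bf pre(1)] by blast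
    then show "B \<in> Filt R \<Delta> J" using Filt_extend[OF _ Bf hyps(1) \<Delta> pre(3)] by blast
  qed
  then show ?thesis using B ex by blast
qed

lemma standard_Filt:
  assumes j: "j \<in> J" and \<Delta>: "\<forall>j\<in>J. \<Delta> j \<in> fgmod R" and X: "X \<in> fgmod R"
    and iso: "isomorphic R (\<Delta> j) X"
  shows "X \<in> Filt R \<Delta> J"
proof -
  note D = bspec[OF \<Delta> j]
  interpret D: rmod R "\<Delta> j" by (rule rmod.intro) (rule fgmodD[OF D])
  let ?id = "\<lambda>x\<in>carrier (\<Delta> j). x"
  have "{x \<in> carrier (\<Delta> j). ?id x = \<zero>\<^bsub>\<Delta> j\<^esub>} = {\<zero>\<^bsub>\<Delta> j\<^esub>}" by auto
  then have "short_exact R (\<Delta> j\<lparr>carrier := {\<zero>\<^bsub>\<Delta> j\<^esub>}\<rparr>) (\<lambda>x\<in>{\<zero>\<^bsub>\<Delta> j\<^esub>}. x) (\<Delta> j) ?id (\<Delta> j)"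
    using short_exact_kernel[OF D.right_module_axioms D.right_module_axioms rhom_id[OF D.right_module_axioms]]
    by auto
  then have "\<Delta> j \<in> Filt R \<Delta> J"
    using Filt_extend[OF zero_module_Filt[OF fgmod_zero_sub[OF D]] D j \<Delta>] by simp
  then show ?thesis by (rule Filt_isomorphic[OF _ \<Delta> X iso])
qed

lemma bisum_Filt:
  assumes b: "bisum R Q A B p q" and Q: "Q \<in> fgmod R" and A: "A \<in> Filt R \<Delta> J" and B: "B \<in> Filt R \<Delta> J"
    and \<Delta>: "\<forall>j\<in>J. \<Delta> j \<in> fgmod R"
  shows "Q \<in> Filt R \<Delta> J"
proof -
  obtain i where "short_exact R A i Q q B"
    using bisum_short_exact(1)[OF b] fgmodD(1) Filt_fgmod Q A B by blast
  then show ?thesis using Filt_extension[OF B _ A Q] \<Delta> by blast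
qed

lemma direct_sum_Filt:
  assumes "finite I" and M: "\<And>i. i \<in> I \<Longrightarrow> M i \<in> Filt R \<Delta> J" and Q: "Q \<in> fgmod R"
    and iso: "isomorphic R Q (direct_sum I M)" and \<Delta>: "\<forall>j\<in>J. \<Delta> j \<in> fgmod R"
  shows "Q \<in> Filt R \<Delta> J"
proof (rule direct_sum_induct[OF assms(1) Filt_fgmod[OF M] Q iso])
  fix Z :: "'a fgm" assume "Z \<in> fgmod R" "carrier Z = {\<zero>\<^bsub>Z\<^esub>}"
  then show "Z \<in> Filt R \<Delta> J" by (rule zero_module_Filt)
next
  fix Q0 Q k p q
  assume "k \<in> I" "Q \<in> fgmod R" "Q0 \<in> Filt R \<Delta> J" "bisum R Q Q0 (M k) p q"
  then show "Q \<in> Filt R \<Delta> J" using bisum_Filt M \<Delta> by blast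
qed

end

section \<open>Vanishing of extensions as a lifting property\<close>

text \<open>For finitely generated \<open>P\<close> and \<open>A\<close> this says that \<open>Ext\<^sup>1(P, A)\<close> vanishes.\<close>

definition lifts :: "'a ring \<Rightarrow> 'a fgm \<Rightarrow> 'a fgm \<Rightarrow> bool" where
  "lifts R P A \<longleftrightarrow> (\<forall>B\<in>fgmod R. \<forall>C\<in>fgmod R. \<forall>f g. short_exact R A f B g C \<longrightarrow>
     (\<forall>h\<in>rhom R P C. \<exists>h'\<in>rhom R P B. \<forall>x\<in>carrier P. g (h' x) = h x))"

lemma liftsD:
  "\<lbrakk>lifts R P A; short_exact R A f B g C; B \<in> fgmod R; C \<in> fgmod R; h \<in> rhom R P C\<rbrakk>
    \<Longrightarrow> \<exists>h'\<in>rhom R P B. \<forall>x\<in>carrier P. g (h' x) = h x"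
  unfolding lifts_def by blast

text \<open>The element e - s (g e) lies in the kernel of g and hence comes from a unique element of
  A, which serves as \<open>\<rho> e\<close>.\<close>

lemma short_exact_retraction:
  assumes A: "right_module R A" and E: "right_module R E" and X: "right_module R X"
    and ex: "short_exact R A f E g X" and s: "s \<in> rhom R X E" "\<And>x. x \<in> carrier X \<Longrightarrow> g (s x) = x"
  shows "\<exists>\<rho>\<in>rhom R E A. (\<forall>e\<in>carrier E. f (\<rho> e) = e \<ominus>\<^bsub>E\<^esub> s (g e)) \<and> (\<forall>a\<in>carrier A. \<rho> (f a) = a)"
proof -
  interpret E: rmod R E by (rule rmod.intro) fact
  interpret X: rmod R X by (rule rmod.intro) fact
  note D = short_exactD[OF ex]
  have h: "(\<lambda>e\<in>carrier E. (\<lambda>e\<in>carrier E. e) e \<ominus>\<^bsub>E\<^esub> (\<lambda>e\<in>carrier E. s (g e)) e) \<in> rhom R E E"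
    by (intro rhom_diff E rhom_id rhom_compose[OF E D(2) s(1)])
  have c: "s (g e) \<in> carrier E" "g e \<in> carrier X" if "e \<in> carrier E" for e
    using rhomD(1)[OF s(1)] rhomD(1)[OF D(2)] that by auto
  have "g (e \<ominus>\<^bsub>E\<^esub> s (g e)) = \<zero>\<^bsub>X\<^esub>" if "e \<in> carrier E" for e
    using that c s(2) by (simp add: rhom_minus[OF D(2) E X] X.minus_self)
  then have im: "e \<ominus>\<^bsub>E\<^esub> s (g e) \<in> f ` carrier A" if "e \<in> carrier E" for e
    using that c D(6)[of "e \<ominus>\<^bsub>E\<^esub> s (g e)"] by auto
  obtain \<rho> where \<rho>: "\<rho> \<in> rhom R E A" "\<And>e. e \<in> carrier E \<Longrightarrow> f (\<rho> e) = e \<ominus>\<^bsub>E\<^esub> s (g e)"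
    using rhom_cofactor[OF A E E D(1,3) h] im by auto
  have "\<rho> (f a) = a" if a: "a \<in> carrier A" for a
  proof -
    have fa: "f a \<in> carrier E" by (rule rhomD(1)[OF D(1) a])
    have "f (\<rho> (f a)) = f a"
      using \<rho>(2)[OF fa] D(5)[OF a] rhom_zero[OF s(1) X E] E.minus_add_cancel[OF fa E.M.zero_closed] fa
      by simp
    then show ?thesis using inj_onD[OF D(3) _ rhomD(1)[OF \<rho>(1) fa] a] by simp
  qed
  then show ?thesis using \<rho> by blast
qed

lemma lifts_zero: "right_module R P \<Longrightarrow> carrier P = {\<zero>\<^bsub>P\<^esub>} \<Longrightarrow> lifts R P A"
  unfolding lifts_def
proof (intro ballI allI impI)
  fix B C :: "'a fgm" and f g h
  assume P: "right_module R P" "carrier P = {\<zero>\<^bsub>P\<^esub>}" and B: "B \<in> fgmod R" and C: "C \<in> fgmod R"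
    and ex: "short_exact R A f B g C" and h: "h \<in> rhom R P C"
  have "g (zero_hom P B \<zero>\<^bsub>P\<^esub>) = h \<zero>\<^bsub>P\<^esub>"
    using P(2) rhom_zero[OF h P(1) fgmodD(1)[OF C]]
      rhom_zero[OF short_exactD(2)[OF ex] fgmodD(1)[OF B] fgmodD(1)[OF C]] by (simp add: zero_hom_def)
  then show "\<exists>h'\<in>rhom R P B. \<forall>x\<in>carrier P. g (h' x) = h x"
    using zero_hom_rhom[OF P(1) fgmodD(1)[OF B]] P(2) by auto
qed

text \<open>A sequence that starts in a zero module makes g bijective, so h can be pulled back along
  it.\<close>

lemma lifts_into_zero:
  assumes P: "right_module R P" and Z: "Z \<in> fgmod R" and zero: "carrier Z = {\<zero>\<^bsub>Z\<^esub>}"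
  shows "lifts R P Z"
  unfolding lifts_def
proof (intro ballI allI impI)
  fix B C :: "'a fgm" and f g h
  assume B: "B \<in> fgmod R" and C: "C \<in> fgmod R" and ex: "short_exact R Z f B g C" and h: "h \<in> rhom R P C"
  note m = fgmodD(1)[OF B] fgmodD(1)[OF C] and D = short_exactD[OF ex]
  have inj: "inj_on g (carrier B)"
    using D(6) zero rhom_zero[OF D(1) fgmodD(1)[OF Z] m(1)] by (intro rhom_inj_onI[OF m D(2)]) auto
  have "h x \<in> g ` carrier B" if "x \<in> carrier P" for x
    using rhomD(1)[OF h that] D(4) by simp
  then show "\<exists>h'\<in>rhom R P B. \<forall>x\<in>carrier P. g (h' x) = h x"
    using rhom_cofactor[OF m P D(2) inj h] by blast
qed

lemma lifts_retract:
  assumes P: "right_module R P" and T: "right_module R T" and s: "s \<in> rhom R P T" and p: "p \<in> rhom R T P"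
    and ps: "\<And>x. x \<in> carrier P \<Longrightarrow> p (s x) = x" and lift: "lifts R T A"
  shows "lifts R P A"
  unfolding lifts_def
proof (intro ballI allI impI)
  fix B C :: "'a fgm" and f g h
  assume B: "B \<in> fgmod R" and C: "C \<in> fgmod R" and ex: "short_exact R A f B g C" and h: "h \<in> rhom R P C"
  obtain l where l: "l \<in> rhom R T B" "\<And>x. x \<in> carrier T \<Longrightarrow> g (l x) = h (p x)"
    using liftsD[OF lift ex B C rhom_compose[OF T p h]] by auto
  then show "\<exists>h'\<in>rhom R P B. \<forall>x\<in>carrier P. g (h' x) = h x"
    using rhom_compose[OF P s l(1)] rhomD(1)[OF s] ps
    by (intro bexI[of _ "\<lambda>x\<in>carrier P. l (s x)"]) auto
qed

lemma lifts_bisum: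
  assumes b: "bisum R Q G Y p q" and m: "right_module R Q" "right_module R G" "right_module R Y"
    and lift: "lifts R G A" "lifts R Y A"
  shows "lifts R Q A"
  unfolding lifts_def
proof (intro ballI allI impI)
  fix B C :: "'a fgm" and f g h
  assume B: "B \<in> fgmod R" and C: "C \<in> fgmod R" and ex: "short_exact R A f B g C" and h: "h \<in> rhom R Q C"
  interpret Q: rmod R Q by (rule rmod.intro) fact
  note D = bisumD[OF b] and E = short_exactD[OF ex]
  obtain i j where i: "i \<in> rhom R G Q" and "\<forall>a\<in>carrier G. p (i a) = a \<and> q (i a) = \<zero>\<^bsub>Y\<^esub>"
    and j: "j \<in> rhom R Y Q" and "\<forall>b\<in>carrier Y. p (j b) = \<zero>\<^bsub>G\<^esub> \<and> q (j b) = b"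
    and ij: "\<forall>x\<in>carrier Q. x = i (p x) \<oplus>\<^bsub>Q\<^esub> j (q x)"
    by (rule bisum_injections[OF b m]) (rule that)
  obtain l1 where l1: "l1 \<in> rhom R G B" "\<And>x. x \<in> carrier G \<Longrightarrow> g (l1 x) = h (i x)"
    using liftsD[OF lift(1) ex B C rhom_compose[OF m(2) i h]] by auto
  obtain l2 where l2: "l2 \<in> rhom R Y B" "\<And>x. x \<in> carrier Y \<Longrightarrow> g (l2 x) = h (j x)"
    using liftsD[OF lift(2) ex B C rhom_compose[OF m(3) j h]] by auto
  let ?h = "\<lambda>x\<in>carrier Q. (\<lambda>x\<in>carrier Q. l1 (p x)) x \<oplus>\<^bsub>B\<^esub> (\<lambda>x\<in>carrier Q. l2 (q x)) x"
  have "?h \<in> rhom R Q B"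
    by (intro rhom_add m fgmodD(1)[OF B] rhom_compose[OF m(1) D(1) l1(1)] rhom_compose[OF m(1) D(2) l2(1)])
  moreover have "g (?h x) = h x" if x: "x \<in> carrier Q" for x
  proof -
    note c = rhomD(1)[OF D(1) x] rhomD(1)[OF D(2) x]
    have "g (?h x) = h (i (p x)) \<oplus>\<^bsub>C\<^esub> h (j (q x))"
      using x c by (simp add: rhomD(2)[OF E(2)] rhomD(1)[OF l1(1)] rhomD(1)[OF l2(1)] l1(2) l2(2))
    also have "\<dots> = h (i (p x) \<oplus>\<^bsub>Q\<^esub> j (q x))"
      using c by (simp add: rhomD(2)[OF h] rhomD(1)[OF i] rhomD(1)[OF j])
    finally show ?thesis using bspec[OF ij x] by simp
  qed
  ultimately show "\<exists>h'\<in>rhom R Q B. \<forall>x\<in>carrier Q. g (h' x) = h x" by blast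
qed

text \<open>The exact piece Hom(G, A) -> Hom(\<Omega>, A) -> Ext^1(X, A) -> Ext^1(G, A). A lift l of
  \<open>h\<close> after \<open>\<pi>\<close> need not descend to X, but on \<open>\<Omega>\<close>
  it takes values in A; subtracting an extension v of this restriction makes it vanish on
  \<open>\<Omega>\<close> without changing its composite with g.\<close>

lemma lifts_presentation:
  assumes \<Omega>: "right_module R \<Omega>" and G: "right_module R G" and X: "right_module R X" and A: "right_module R A"
    and ex: "short_exact R \<Omega> i G \<pi> X" and lift: "lifts R G A"
    and ext: "\<And>u. u \<in> rhom R \<Omega> A \<Longrightarrow> \<exists>v\<in>rhom R G A. \<forall>w\<in>carrier \<Omega>. v (i w) = u w"
  shows "lifts R X A"
  unfolding lifts_def
proof (intro ballI allI impI)
  fix B C :: "'a fgm" and f g h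
  assume B: "B \<in> fgmod R" and C: "C \<in> fgmod R" and exB: "short_exact R A f B g C" and h: "h \<in> rhom R X C"
  note m = fgmodD(1)[OF B] fgmodD(1)[OF C]
  interpret B: rmod R B by (rule rmod.intro) fact
  interpret C: rmod R C by (rule rmod.intro) fact
  note D = short_exactD[OF ex] and E = short_exactD[OF exB]
  obtain l where l: "l \<in> rhom R G B" "\<And>x. x \<in> carrier G \<Longrightarrow> g (l x) = h (\<pi> x)"
    using liftsD[OF lift exB B C rhom_compose[OF G D(2) h]] by auto
  note iw = rhomD(1)[OF D(1)]
  have "l (i w) \<in> f ` carrier A" if w: "w \<in> carrier \<Omega>" for w
  proof -
    have "g (l (i w)) = \<zero>\<^bsub>C\<^esub>" using l(2)[OF iw[OF w]] D(5)[OF w] rhom_zero[OF h X m(2)] by simp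
    then show ?thesis using E(6)[OF rhomD(1)[OF l(1) iw[OF w]]] by auto
  qed
  then obtain u where u: "u \<in> rhom R \<Omega> A" "\<And>w. w \<in> carrier \<Omega> \<Longrightarrow> f (u w) = l (i w)"
    using rhom_cofactor[OF A m(1) \<Omega> E(1,3) rhom_compose[OF \<Omega> D(1) l(1)]] by auto
  obtain v where v: "v \<in> rhom R G A" "\<And>w. w \<in> carrier \<Omega> \<Longrightarrow> v (i w) = u w" using ext[OF u(1)] by blast
  let ?m = "\<lambda>x\<in>carrier G. l x \<ominus>\<^bsub>B\<^esub> (\<lambda>x\<in>carrier G. f (v x)) x"
  have mh: "?m \<in> rhom R G B" by (intro rhom_diff G m l rhom_compose[OF G v(1) E(1)])
  have "?m x = \<zero>\<^bsub>B\<^esub>" if x: "x \<in> carrier G" "\<pi> x = \<zero>\<^bsub>X\<^esub>" for x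
  proof -
    obtain w where w: "w \<in> carrier \<Omega>" "x = i w" using D(6)[OF x] by blast
    then show ?thesis using iw[OF w(1)] u(2)[OF w(1)] v(2)[OF w(1)] rhomD(1)[OF l(1)] by (simp add: B.minus_self)
  qed
  then obtain k where k: "k \<in> rhom R X B" "\<And>x. x \<in> carrier G \<Longrightarrow> k (\<pi> x) = ?m x"
    using rhom_factor[OF G X m(1) D(2,4) mh] by blast
  have "g (k x) = h x" if x: "x \<in> carrier X" for x
  proof -
    obtain y where y: "y \<in> carrier G" "\<pi> y = x" using D(7)[OF x] by blast
    have "g (k x) = g (l y) \<ominus>\<^bsub>C\<^esub> g (f (v y))"
      using k(2)[OF y(1)] y by (simp add: rhom_minus[OF E(2) m] rhomD(1)[OF l(1)] rhomD(1)[OF v(1)] rhomD(1)[OF E(1)])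
    also have "\<dots> = h x \<ominus>\<^bsub>C\<^esub> \<zero>\<^bsub>C\<^esub>" using l(2)[OF y(1)] E(5)[OF rhomD(1)[OF v(1) y(1)]] y by simp
    also have "\<dots> = h x" using C.minus_add_cancel[OF rhomD(1)[OF h x] C.M.zero_closed] rhomD(1)[OF h x] by simp
    finally show ?thesis .
  qed
  then show "\<exists>h'\<in>rhom R X B. \<forall>x\<in>carrier X. g (h' x) = h x" using k(1) by blast
qed

text \<open>Exactness of Ext^1(P, -) in the middle. The surjection from B to C is split into two,
  through the quotient B1 of B by A1: the kernels are A2 and A1, and h is lifted first to B1 and
  then to B.\<close>

lemma lifts_extension:
  fixes R :: "'a ring"
  assumes A1: "A1 \<in> fgmod R" and A: "A \<in> fgmod R" and A2: "A2 \<in> fgmod R"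
    and exA: "short_exact R A1 a A b A2" and lift: "lifts R P A1" "lifts R P A2"
  shows "lifts R P A"
  unfolding lifts_def
proof (intro ballI allI impI)
  fix B C :: "'a fgm" and f g h
  assume B: "B \<in> fgmod R" and C: "C \<in> fgmod R" and ex: "short_exact R A f B g C" and h: "h \<in> rhom R P C"
  note m = fgmodD(1)[OF B] fgmodD(1)[OF C] fgmodD(1)[OF A] fgmodD(1)[OF A1] fgmodD(1)[OF A2]
  interpret A1: rmod R A1 by (rule rmod.intro) fact
  note D = short_exactD[OF exA] and E = short_exactD[OF ex]
  let ?fa = "\<lambda>x\<in>carrier A1. f (a x)"
  have fa: "?fa \<in> rhom R A1 B" by (rule rhom_compose[OF m(4) D(1) E(1)])
  have U: "right_submodule (?fa ` carrier A1) R B"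
    by (rule right_submodule_image[OF m(4,1) fa A1.right_submodule_carrier])
  obtain B1 c where B1: "B1 \<in> fgmod R" and c0: "c \<in> rhom R B B1" "c ` carrier B = carrier B1"
    "\<forall>x\<in>carrier B. c x = \<zero>\<^bsub>B1\<^esub> \<longleftrightarrow> x \<in> ?fa ` carrier A1"
    by (rule fgmod_quotient[OF B U]) (rule that)
  note c = c0(1,2) bspec[OF c0(3)]
  note m1 = fgmodD(1)[OF B1]
  have gfa: "g (f (a x)) = \<zero>\<^bsub>C\<^esub>" if "x \<in> carrier A1" for x using E(5)[OF rhomD(1)[OF D(1) that]] .
  have cfa: "c (f (a x)) = \<zero>\<^bsub>B1\<^esub>" if "x \<in> carrier A1" for x
    using c(3)[of "f (a x)"] rhomD(1)[OF fa that] that by auto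
  have zg: "g x = \<zero>\<^bsub>C\<^esub>" if "x \<in> carrier B" "c x = \<zero>\<^bsub>B1\<^esub>" for x
    using c(3)[OF that(1)] that(2) gfa by auto
  obtain g1 where g1: "g1 \<in> rhom R B1 C" "\<And>x. x \<in> carrier B \<Longrightarrow> g1 (c x) = g x"
    using rhom_factor[OF m(1) m1 m(2) c(1,2) E(2) zg] by auto
  obtain f2 where f2: "f2 \<in> rhom R A2 B1" "\<And>x. x \<in> carrier A \<Longrightarrow> f2 (b x) = c (f x)"
  proof -
    have z: "(\<lambda>x\<in>carrier A. c (f x)) x = \<zero>\<^bsub>B1\<^esub>" if "x \<in> carrier A" "b x = \<zero>\<^bsub>A2\<^esub>" for x
      using D(6)[OF that] cfa that(1) by auto
    show ?thesis using rhom_factor[OF m(3,5) m1 D(2,4) rhom_compose[OF m(3) E(1) c(1)] z] that by auto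
  qed
  have ex1: "short_exact R A1 ?fa B c B1"
  proof (rule short_exactI[OF m(4,1) fa c(1)])
    fix x assume x: "x \<in> carrier A1"
    show "?fa x = \<zero>\<^bsub>B\<^esub> \<Longrightarrow> x = \<zero>\<^bsub>A1\<^esub>"
      using x short_exact_ker[OF ex m(3,1) rhomD(1)[OF D(1) x]] short_exact_ker[OF exA m(4,3) x] by simp
    show "c (?fa x) = \<zero>\<^bsub>B1\<^esub>" using cfa x by simp
  next
    fix y assume "y \<in> carrier B" "c y = \<zero>\<^bsub>B1\<^esub>"
    then have "y \<in> ?fa ` carrier A1" using c(3) by blast
    then obtain x where "x \<in> carrier A1" "y = ?fa x" by (rule imageE)
    then show "\<exists>x\<in>carrier A1. ?fa x = y" by blast
  next
    fix z assume "z \<in> carrier B1"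
    then show "\<exists>y\<in>carrier B. c y = z" using c(2) by (metis imageE)
  qed
  have ex2: "short_exact R A2 f2 B1 g1 C"
  proof (rule short_exactI[OF m(5) m1 f2(1) g1(1)])
    fix x assume x: "x \<in> carrier A2"
    then obtain y where y: "y \<in> carrier A" "b y = x" using D(7) by blast
    note fy = rhomD(1)[OF E(1) y(1)]
    show "g1 (f2 x) = \<zero>\<^bsub>C\<^esub>" using f2(2)[OF y(1)] y(2) g1(2)[OF fy] E(5)[OF y(1)] by simp
    assume "f2 x = \<zero>\<^bsub>B1\<^esub>"
    then have "f y \<in> ?fa ` carrier A1" using f2(2)[OF y(1)] y(2) c(3)[OF fy] by simp
    then obtain w where w: "w \<in> carrier A1" "f y = f (a w)" by auto
    then have "y = a w" using inj_onD[OF E(3) _ y(1) rhomD(1)[OF D(1)]] by blast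
    then show "x = \<zero>\<^bsub>A2\<^esub>" using D(5)[OF w(1)] y by simp
  next
    fix y assume y: "y \<in> carrier B1" "g1 y = \<zero>\<^bsub>C\<^esub>"
    obtain x where x: "x \<in> carrier B" "c x = y" using y(1) c(2) by (metis imageE)
    then obtain z where z: "z \<in> carrier A" "x = f z" using E(6)[OF x(1)] g1(2)[OF x(1)] y(2) by auto
    then show "\<exists>x\<in>carrier A2. f2 x = y" using f2(2)[OF z(1)] x rhomD(1)[OF D(2) z(1)] by auto
  next
    fix z assume "z \<in> carrier C"
    then obtain y where y: "y \<in> carrier B" "g y = z" using E(7) by blast
    then show "\<exists>y\<in>carrier B1. g1 y = z" using g1(2)[OF y(1)] rhomD(1)[OF c(1) y(1)] by auto
  qed
  obtain h1 where h1: "h1 \<in> rhom R P B1" "\<And>x. x \<in> carrier P \<Longrightarrow> g1 (h1 x) = h x"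
    using liftsD[OF lift(2) ex2 B1 C h] by blast
  obtain h' where h': "h' \<in> rhom R P B" "\<And>x. x \<in> carrier P \<Longrightarrow> c (h' x) = h1 x"
    using liftsD[OF lift(1) ex1 B B1 h1(1)] by blast
  have "g (h' x) = h x" if x: "x \<in> carrier P" for x
    using g1(2)[OF rhomD(1)[OF h'(1) x]] h'(2)[OF x] h1(2)[OF x] by simp
  then show "\<exists>h'\<in>rhom R P B. \<forall>x\<in>carrier P. g (h' x) = h x" using h'(1) by blast
qed

text \<open>The pushout of \<open>i\<close> along \<open>u\<close> appears as the quotient \<open>E\<close> of \<open>W = G \<oplus> Y\<close> by the image of
  \<open>d = (i, u)\<close>; hence the inclusion of \<open>G\<close> has to be negated to make the square commute.\<close>

lemma pushout:
  fixes R :: "'a ring"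
  assumes \<Omega>: "\<Omega> \<in> fgmod R" and G: "G \<in> fgmod R" and X: "X \<in> fgmod R" and Y: "Y \<in> fgmod R"
    and ex: "short_exact R \<Omega> i G \<pi> X" and u: "u \<in> rhom R \<Omega> Y"
  obtains W p q d E c j m where "W \<in> fgmod R" "E \<in> fgmod R" "bisum R W G Y p q"
    "\<forall>w\<in>carrier \<Omega>. p (d w) = i w \<and> q (d w) = u w"
    "short_exact R \<Omega> d W c E" "short_exact R Y j E m X"
    "\<forall>x\<in>carrier W. p x = \<zero>\<^bsub>G\<^esub> \<longrightarrow> j (q x) = c x"
proof -
  note m = fgmodD(1)[OF \<Omega>] fgmodD(1)[OF G] fgmodD(1)[OF X] fgmodD(1)[OF Y]
  interpret \<Omega>: rmod R \<Omega> by (rule rmod.intro) fact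
  interpret Y: rmod R Y by (rule rmod.intro) fact
  interpret G: rmod R G by (rule rmod.intro) fact
  note D = short_exactD[OF ex]
  obtain W p q where W: "W \<in> fgmod R" and b: "bisum R W G Y p q" using bisum_exists[OF G Y] by blast
  note mW = fgmodD(1)[OF W] and S = bisumD[OF b]
  interpret W: rmod R W by (rule rmod.intro) fact
  obtain iF iA where i0: "iF \<in> rhom R G W" "\<forall>x\<in>carrier G. p (iF x) = x \<and> q (iF x) = \<zero>\<^bsub>Y\<^esub>"
    "iA \<in> rhom R Y W" "\<forall>x\<in>carrier Y. p (iA x) = \<zero>\<^bsub>G\<^esub> \<and> q (iA x) = x"
    and "\<forall>x\<in>carrier W. x = iF (p x) \<oplus>\<^bsub>W\<^esub> iA (q x)"
    by (rule bisum_injections[OF b mW m(2,4)]) (rule that)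
  note iF = i0(1) bspec[OF i0(2)] and iA = i0(3) bspec[OF i0(4)]
  note cl = rhomD(1)[OF D(1)] rhomD(1)[OF u] rhomD(1)[OF iF(1)] rhomD(1)[OF iA(1)]
    rhomD(1)[OF S(1)] rhomD(1)[OF S(2)]
  obtain d where d: "d \<in> rhom R \<Omega> W" "\<And>w. w \<in> carrier \<Omega> \<Longrightarrow> p (d w) = i w \<and> q (d w) = u w"
    using bisum_pairing[OF b mW m(1) D(1) u] by blast
  have U: "right_submodule (d ` carrier \<Omega>) R W"
    by (rule right_submodule_image[OF m(1) mW d(1) \<Omega>.right_submodule_carrier])
  obtain E c where E: "E \<in> fgmod R" and c0: "c \<in> rhom R W E" "c ` carrier W = carrier E"
    "\<forall>x\<in>carrier W. c x = \<zero>\<^bsub>E\<^esub> \<longleftrightarrow> x \<in> d ` carrier \<Omega>"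
    by (rule fgmod_quotient[OF W U]) (rule that)
  note c = c0(1,2) bspec[OF c0(3)]
  note mE = fgmodD(1)[OF E]
  interpret E: rmod R E by (rule rmod.intro) fact
  have cd: "c (d w) = \<zero>\<^bsub>E\<^esub>" if "w \<in> carrier \<Omega>" for w using c(3)[OF rhomD(1)[OF d(1) that]] that by simp
  have exW: "short_exact R \<Omega> d W c E"
  proof (rule short_exactI[OF m(1) mW d(1) c(1) _ cd])
    fix x assume x: "x \<in> carrier \<Omega>" "d x = \<zero>\<^bsub>W\<^esub>"
    then have "i x = \<zero>\<^bsub>G\<^esub>" using d(2)[OF x(1)] rhom_zero[OF S(1) mW m(2)] by simp
    then show "x = \<zero>\<^bsub>\<Omega>\<^esub>" by (rule short_exact_ker[OF ex m(1,2) x(1)])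
  next
    fix y assume "y \<in> carrier W" "c y = \<zero>\<^bsub>E\<^esub>"
    then have "y \<in> d ` carrier \<Omega>" using c(3) by simp
    then show "\<exists>x\<in>carrier \<Omega>. d x = y" by auto
  next
    fix z assume "z \<in> carrier E"
    then show "\<exists>y\<in>carrier W. c y = z" using c(2) by (metis imageE)
  qed
  obtain \<pi>E where \<pi>E: "\<pi>E \<in> rhom R E X" "\<And>x. x \<in> carrier W \<Longrightarrow> \<pi>E (c x) = \<pi> (p x)"
  proof -
    have z: "(\<lambda>x\<in>carrier W. \<pi> (p x)) x = \<zero>\<^bsub>X\<^esub>" if "x \<in> carrier W" "c x = \<zero>\<^bsub>E\<^esub>" for x
      using c(3)[OF that(1)] that d(2) D(5) by auto
    show ?thesis using rhom_factor[OF mW mE m(3) c(1,2) rhom_compose[OF mW S(1) D(2)] z] that by auto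
  qed
  let ?j = "\<lambda>x\<in>carrier Y. c (iA x)"
  have j: "?j \<in> rhom R Y E" by (rule rhom_compose[OF m(4) iA(1) c(1)])
  have iAq: "iA (q x) = x" if x: "x \<in> carrier W" "p x = \<zero>\<^bsub>G\<^esub>" for x
    by (rule S(3)) (use x cl iA(2) in auto)
  have exE: "short_exact R Y ?j E \<pi>E X"
  proof (rule short_exactI[OF m(4) mE j \<pi>E(1)])
    fix x assume x: "x \<in> carrier Y"
    show "\<pi>E (?j x) = \<zero>\<^bsub>X\<^esub>"
      using x \<pi>E(2)[OF cl(4)[OF x]] iA(2)[OF x] rhom_zero[OF D(2) m(2,3)] by simp
    assume "?j x = \<zero>\<^bsub>E\<^esub>"
    then have "iA x \<in> d ` carrier \<Omega>" using x c(3)[OF cl(4)[OF x]] by simp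
    then obtain w where w: "w \<in> carrier \<Omega>" "iA x = d w" by (metis imageE)
    have "i w = \<zero>\<^bsub>G\<^esub>" using d(2)[OF w(1)] iA(2)[OF x] w(2) by simp
    then have "w = \<zero>\<^bsub>\<Omega>\<^esub>" by (rule short_exact_ker[OF ex m(1,2) w(1)])
    then have "q (iA x) = q \<zero>\<^bsub>W\<^esub>" using w(2) rhom_zero[OF d(1) m(1) mW] by simp
    then show "x = \<zero>\<^bsub>Y\<^esub>" using iA(2)[OF x] rhom_zero[OF S(2) mW m(4)] by simp
  next
    fix y assume y: "y \<in> carrier E" "\<pi>E y = \<zero>\<^bsub>X\<^esub>"
    obtain x where x: "x \<in> carrier W" "c x = y" using y(1) c(2) by (metis imageE)
    then have "\<pi> (p x) = \<zero>\<^bsub>X\<^esub>" using \<pi>E(2) y(2) by auto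
    then obtain w where w: "w \<in> carrier \<Omega>" "p x = i w" using D(6)[OF cl(5)[OF x(1)]] by blast
    \<comment> \<open>Subtracting \<open>d w\<close> does not change the class in E and makes the
      G-component zero, so the difference comes from Y.\<close>
    let ?x = "x \<ominus>\<^bsub>W\<^esub> d w"
    have dW: "d w \<in> carrier W" by (rule rhomD(1)[OF d(1) w(1)])
    have xW: "?x \<in> carrier W" using x dW by simp
    have "p ?x = \<zero>\<^bsub>G\<^esub>" using x(1) dW w d(2) cl(1)
      by (simp add: rhom_minus[OF S(1) mW m(2)] G.minus_self)
    then have "iA (q ?x) = ?x" by (rule iAq[OF xW])
    moreover have "c ?x = y"
      using x dW cd[OF w(1)] E.minus_add_cancel[OF y(1) E.M.zero_closed] y(1)
      by (simp add: rhom_minus[OF c(1) mW mE])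
    ultimately show "\<exists>x\<in>carrier Y. ?j x = y" using cl(6)[OF xW]
      by (intro bexI[of _ "q ?x"]) simp_all
  next
    fix z assume "z \<in> carrier X"
    then obtain y where y: "y \<in> carrier G" "\<pi> y = z" using D(7) by blast
    then show "\<exists>y\<in>carrier E. \<pi>E y = z"
      using \<pi>E(2)[OF cl(3)[OF y(1)]] iF(2)[OF y(1)] rhomD(1)[OF c(1) cl(3)[OF y(1)]] by auto
  qed
  have "?j (q x) = c x" if "x \<in> carrier W" "p x = \<zero>\<^bsub>G\<^esub>" for x
    using iAq[OF that] cl(6)[OF that(1)] by simp
  then show ?thesis using d(2) by (intro that[OF W E b _ exW exE]) simp_all
qed

text \<open>Converse to \<open>lifts_presentation\<close>: if Ext^1(X, A) vanishes, every
  homomorphism from \<open>\<Omega>\<close> to A extends to F. The pushout of i along u is an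
  extension of X by A and splits; its retraction, composed with the map from F to the pushout,
  extends u up to sign.\<close>

lemma lifts_extend:
  fixes R :: "'a ring"
  assumes \<Omega>: "\<Omega> \<in> fgmod R" and F: "F \<in> fgmod R" and X: "X \<in> fgmod R" and A: "A \<in> fgmod R"
    and ex: "short_exact R \<Omega> i F \<pi> X" and lift: "lifts R X A" and u: "u \<in> rhom R \<Omega> A"
  shows "\<exists>v\<in>rhom R F A. \<forall>w\<in>carrier \<Omega>. v (i w) = u w"
proof -
  note m = fgmodD(1)[OF \<Omega>] fgmodD(1)[OF F] fgmodD(1)[OF X] fgmodD(1)[OF A]
  interpret A: rmod R A by (rule rmod.intro) fact
  obtain W p q d E c j \<pi>E where W: "W \<in> fgmod R" and E: "E \<in> fgmod R" and b: "bisum R W F A p q"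
    and d: "\<forall>w\<in>carrier \<Omega>. p (d w) = i w \<and> q (d w) = u w"
    and exW: "short_exact R \<Omega> d W c E" and exE: "short_exact R A j E \<pi>E X"
    and jq: "\<forall>x\<in>carrier W. p x = \<zero>\<^bsub>F\<^esub> \<longrightarrow> j (q x) = c x"
    by (rule pushout[OF \<Omega> F X A ex u]) (rule that)
  note mW = fgmodD(1)[OF W] and mE = fgmodD(1)[OF E] and S = bisumD[OF b]
  interpret E: rmod R E by (rule rmod.intro) fact
  obtain iF iA where ij: "iF \<in> rhom R F W" "\<forall>x\<in>carrier F. p (iF x) = x \<and> q (iF x) = \<zero>\<^bsub>A\<^esub>"
    "iA \<in> rhom R A W" "\<forall>x\<in>carrier A. p (iA x) = \<zero>\<^bsub>F\<^esub> \<and> q (iA x) = x"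
    "\<forall>x\<in>carrier W. x = iF (p x) \<oplus>\<^bsub>W\<^esub> iA (q x)"
    by (rule bisum_injections[OF b mW m(2,4)]) (rule that)
  note D = short_exactD[OF ex] and DW = short_exactD[OF exW] and DE = short_exactD[OF exE]
  obtain s where s: "s \<in> rhom R X E" "\<And>x. x \<in> carrier X \<Longrightarrow> \<pi>E (s x) = x"
    using liftsD[OF lift exE E X rhom_id[OF m(3)]] by auto
  obtain \<rho> where \<rho>: "\<rho> \<in> rhom R E A" "\<And>a. a \<in> carrier A \<Longrightarrow> \<rho> (j a) = a"
    using short_exact_retraction[OF m(4) mE m(3) exE s] by auto
  \<comment> \<open>The sign is forced: c kills the image of d, so the F-part of \<open>d w\<close>
    and its A-part \<open>j (u w)\<close> are negatives of each other in E.\<close>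
  let ?v = "\<lambda>x\<in>carrier F. zero_hom F A x \<ominus>\<^bsub>A\<^esub> (\<lambda>x\<in>carrier F. \<rho> ((\<lambda>x\<in>carrier F. c (iF x)) x)) x"
  have "?v \<in> rhom R F A"
    by (intro rhom_diff m zero_hom_rhom rhom_compose[OF m(2) _ \<rho>(1)] rhom_compose[OF m(2) ij(1) DW(2)])
  moreover have "?v (i w) = u w" if w: "w \<in> carrier \<Omega>" for w
  proof -
    note iw = rhomD(1)[OF D(1) w] and uw = rhomD(1)[OF u w] and dw = rhomD(1)[OF DW(1) w]
    note cl = rhomD(1)[OF ij(1) iw] rhomD(1)[OF ij(3) uw]
    have cuw: "c (iA (u w)) = j (u w)"
      using bspec[OF jq cl(2)] bspec[OF ij(4) uw] by simp
    have "c (iF (i w)) \<oplus>\<^bsub>E\<^esub> j (u w) = c (d w)"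
      using bspec[OF ij(5) dw] bspec[OF d w] cl cuw by (metis rhomD(2)[OF DW(2)])
    then have "\<rho> (c (iF (i w)) \<oplus>\<^bsub>E\<^esub> j (u w)) = \<zero>\<^bsub>A\<^esub>"
      using DW(5)[OF w] rhom_zero[OF \<rho>(1) mE m(4)] by simp
    then have "\<rho> (c (iF (i w))) \<oplus>\<^bsub>A\<^esub> u w = \<zero>\<^bsub>A\<^esub>"
      using rhomD(1)[OF DW(2) cl(1)] rhomD(1)[OF DE(1) uw] \<rho>(2)[OF uw] by (simp add: rhomD(2)[OF \<rho>(1)])
    then have "\<ominus>\<^bsub>A\<^esub> \<rho> (c (iF (i w))) = u w"
      using A.M.minus_equality[of "u w" "\<rho> (c (iF (i w)))"] uw rhomD(1)[OF \<rho>(1) rhomD(1)[OF DW(2) cl(1)]]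
      by (simp add: A.M.a_comm)
    then show ?thesis using iw uw rhomD(1)[OF \<rho>(1) rhomD(1)[OF DW(2) cl(1)]]
      by (simp add: zero_hom_def A.M.minus_eq)
  qed
  ultimately show ?thesis by blast
qed

context right_noetherian_ring
begin

text \<open>An arbitrary sequence is pulled back along h. The fibre product of P and B over C is an
  extension of P by A, and a section of it, followed by the projection to B, lifts h.\<close>

lemma lifts_if_split:
  assumes P: "P \<in> fgmod R" and A: "A \<in> fgmod R"
    and split: "\<And>E f g. E \<in> fgmod R \<Longrightarrow> short_exact R A f E g P \<Longrightarrow>
      \<exists>s\<in>rhom R P E. \<forall>x\<in>carrier P. g (s x) = x"
  shows "lifts R P A"
  unfolding lifts_def
proof (intro ballI allI impI)
  fix B C :: "'a fgm" and f g h
  assume B: "B \<in> fgmod R" and C: "C \<in> fgmod R" and ex: "short_exact R A f B g C" and h: "h \<in> rhom R P C"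
  note m = fgmodD(1)[OF P] fgmodD(1)[OF A] fgmodD(1)[OF B] fgmodD(1)[OF C]
  interpret C: rmod R C by (rule rmod.intro) fact
  note D = short_exactD[OF ex]
  obtain W p q where W: "W \<in> fgmod R" and b: "bisum R W P B p q" using bisum_exists[OF P B] by blast
  note mW = fgmodD(1)[OF W] and S = bisumD[OF b]
  interpret W: rmod R W by (rule rmod.intro) fact
  note cl = rhomD(1)[OF S(1)] rhomD(1)[OF S(2)]
  define k where "k = (\<lambda>x\<in>carrier W. (\<lambda>x\<in>carrier W. h (p x)) x \<ominus>\<^bsub>C\<^esub> (\<lambda>x\<in>carrier W. g (q x)) x)"
  have k: "k \<in> rhom R W C" unfolding k_def
    by (intro rhom_diff mW m rhom_compose[OF mW S(1) h] rhom_compose[OF mW S(2) D(2)])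
  define U where "U = {x \<in> carrier W. k x = \<zero>\<^bsub>C\<^esub>}"
  have U: "right_submodule U R W" unfolding U_def by (rule right_submodule_kernel[OF mW m(4) k])
  have Ui: "x \<in> U \<longleftrightarrow> x \<in> carrier W \<and> h (p x) = g (q x)" for x
    using cl rhomD(1)[OF h] rhomD(1)[OF D(2)] by (auto simp: U_def k_def C.minus_eq_zero_iff)
  let ?E = "W\<lparr>carrier := U\<rparr>"
  have E: "?E \<in> fgmod R" by (rule fgmod_sub[OF W U])
  obtain f1 where f1: "f1 \<in> rhom R A W" "\<And>x. x \<in> carrier A \<Longrightarrow> p (f1 x) = \<zero>\<^bsub>P\<^esub> \<and> q (f1 x) = f x"
    using bisum_pairing[OF b mW m(2) zero_hom_rhom[OF m(2,1)] D(1)] by (auto simp: zero_hom_def)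
  have f1U: "f1 x \<in> U" if "x \<in> carrier A" for x
    using f1(2)[OF that] D(5)[OF that] rhomD(1)[OF f1(1) that] rhom_zero[OF h m(1,4)] by (simp add: Ui)
  have pU: "(\<lambda>x\<in>carrier ?E. p x) \<in> rhom R ?E P"
    by (rule rhom_restrictI[OF fgmodD(1)[OF E]]) (simp_all add: Ui rhomD[OF S(1)])
  have "short_exact R A f1 ?E (\<lambda>x\<in>carrier ?E. p x) P"
  proof (rule short_exactI[OF m(2) fgmodD(1)[OF E] rhom_into_sub[OF f1(1) f1U] pU])
    fix x assume x: "x \<in> carrier A"
    show "(\<lambda>x\<in>carrier ?E. p x) (f1 x) = \<zero>\<^bsub>P\<^esub>" using f1U f1(2) x by simp
    assume "f1 x = \<zero>\<^bsub>?E\<^esub>"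
    then have "f x = q \<zero>\<^bsub>W\<^esub>" using f1(2)[OF x] by simp
    then show "x = \<zero>\<^bsub>A\<^esub>" using short_exact_ker[OF ex m(2,3) x] rhom_zero[OF S(2) mW m(3)] by simp
  next
    fix y assume y: "y \<in> carrier ?E" "(\<lambda>x\<in>carrier ?E. p x) y = \<zero>\<^bsub>P\<^esub>"
    then have y': "y \<in> carrier W" "p y = \<zero>\<^bsub>P\<^esub>" "g (q y) = \<zero>\<^bsub>C\<^esub>"
      using rhom_zero[OF h m(1,4)] by (auto simp: Ui)
    obtain x where x: "x \<in> carrier A" "q y = f x" using D(6)[OF cl(2)[OF y'(1)] y'(3)] by blast
    have "f1 x = y" by (rule S(3)) (use x y' f1(2) rhomD(1)[OF f1(1)] in auto)
    then show "\<exists>x\<in>carrier A. f1 x = y" using x by blast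
  next
    fix z assume z: "z \<in> carrier P"
    obtain y where y: "y \<in> carrier B" "g y = h z" using D(7)[OF rhomD(1)[OF h z]] by blast
    obtain w where "w \<in> carrier W" "p w = z" "q w = y" using S(4)[OF z y(1)] by blast
    then show "\<exists>y\<in>carrier ?E. (\<lambda>x\<in>carrier ?E. p x) y = z" using y by (intro bexI[of _ w]) (auto simp: Ui)
  qed
  from split[OF E this] obtain s where s: "s \<in> rhom R P ?E"
    "\<And>x. x \<in> carrier P \<Longrightarrow> (\<lambda>x\<in>carrier ?E. p x) (s x) = x" by blast
  have sU: "s x \<in> U" if "x \<in> carrier P" for x using rhomD(1)[OF s(1) that] by simp
  have sW: "s \<in> rhom R P W" using s(1) sU unfolding rhom_def by (auto simp: PiE_iff Ui)
  have "g (q (s x)) = h x" if "x \<in> carrier P" for x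
    using sU[OF that] s(2)[OF that] by (simp add: Ui)
  then show "\<exists>h'\<in>rhom R P B. \<forall>x\<in>carrier P. g (h' x) = h x"
    using rhom_compose[OF m(1) sW S(2)] by (intro bexI[of _ "\<lambda>x\<in>carrier P. q (s x)"]) auto
qed

lemma lifts_direct_sum:
  assumes "finite I" and M: "\<And>i. i \<in> I \<Longrightarrow> M i \<in> fgmod R" and Q: "Q \<in> fgmod R"
    and iso: "isomorphic R Q (direct_sum I M)" and lift: "\<And>i. i \<in> I \<Longrightarrow> lifts R (M i) A"
  shows "lifts R Q A"
proof (rule direct_sum_induct[OF assms(1) M Q iso])
  fix Z :: "'a fgm" assume "Z \<in> fgmod R" "carrier Z = {\<zero>\<^bsub>Z\<^esub>}"
  then show "lifts R Z A" by (intro lifts_zero fgmodD(1))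
next
  fix Q0 Q k p q
  assume "k \<in> I" "Q0 \<in> fgmod R" "Q \<in> fgmod R" "lifts R Q0 A" "bisum R Q Q0 (M k) p q"
  then show "lifts R Q A" using lifts_bisum fgmodD(1) lift M by blast
qed

lemma lifts_Filt:
  assumes A: "A \<in> Filt R \<Delta> J" and \<Delta>: "\<forall>j\<in>J. \<Delta> j \<in> fgmod R" and P: "P \<in> fgmod R"
    and lift: "\<And>j. j \<in> J \<Longrightarrow> lifts R P (\<Delta> j)"
  shows "lifts R P A"
proof (rule Filt_induct[OF A \<Delta>])
  fix Z :: "'a fgm" assume "Z \<in> fgmod R" "carrier Z = {\<zero>\<^bsub>Z\<^esub>}"
  then show "lifts R P Z" by (rule lifts_into_zero[OF fgmodD(1)[OF P]])
next
  fix A B j f g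
  assume "j \<in> J" "A \<in> Filt R \<Delta> J" "B \<in> Filt R \<Delta> J" "lifts R P A" "short_exact R A f B g (\<Delta> j)"
  then show "lifts R P B" using lifts_extension Filt_fgmod lift bspec[OF \<Delta>] by metis
qed

end

section \<open>Generators\<close>

lemma compose_eq_iff:
  assumes "h \<in> extensional A"
  shows "compose A g f = h \<longleftrightarrow> (\<forall>x\<in>A. g (f x) = h x)"
proof
  assume "\<forall>x\<in>A. g (f x) = h x"
  then show "compose A g f = h"
    by (intro extensionalityI[OF compose_extensional assms]) (simp add: compose_eq)
qed (auto simp: compose_eq)

text \<open>Says that some finite power of P maps onto X, without forming the power. In this form
  transitivity amounts to composing two finite families, where powers of powers would call for
  reindexing.\<close>

definition generated_by :: "'a ring \<Rightarrow> ('a, 'b) rmodule \<Rightarrow> ('a, 'c) rmodule \<Rightarrow> bool" where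
  "generated_by R P X \<longleftrightarrow> (\<exists>H. finite H \<and> H \<subseteq> rhom R P X \<and>
     (\<forall>U. right_submodule U R X \<longrightarrow> (\<forall>h\<in>H. \<forall>x\<in>carrier P. h x \<in> U) \<longrightarrow> U = carrier X))"

lemma generated_byE:
  assumes "generated_by R P X"
  obtains H where "finite H" "H \<subseteq> rhom R P X"
    "\<forall>U. right_submodule U R X \<longrightarrow> (\<forall>h\<in>H. \<forall>x\<in>carrier P. h x \<in> U) \<longrightarrow> U = carrier X"
  using assms unfolding generated_by_def by (elim exE conjE) (rule that)

lemma generated_byI:
  assumes "finite H" "H \<subseteq> rhom R P X"
    "\<And>U. right_submodule U R X \<Longrightarrow> (\<And>h x. h \<in> H \<Longrightarrow> x \<in> carrier P \<Longrightarrow> h x \<in> U) \<Longrightarrow> U = carrier X"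
  shows "generated_by R P X"
  unfolding generated_by_def using assms by (intro exI[of _ H]) simp

lemma generated_by_quotient:
  assumes P: "right_module R P" and Q: "right_module R Q" and X: "right_module R X"
    and gen: "generated_by R P Q" and g: "g \<in> rhom R Q X" "g ` carrier Q = carrier X"
  shows "generated_by R P X"
proof -
  interpret X: rmod R X by (rule rmod.intro) fact
  obtain H where H0: "finite H" "H \<subseteq> rhom R P Q"
    "\<forall>U. right_submodule U R Q \<longrightarrow> (\<forall>h\<in>H. \<forall>x\<in>carrier P. h x \<in> U) \<longrightarrow> U = carrier Q"
    by (rule generated_byE[OF gen]) (rule that)
  note H = H0(1,2) H0(3)[rule_format]
  show ?thesis
  proof (rule generated_byI)
    show "finite ((\<lambda>h. \<lambda>x\<in>carrier P. g (h x)) ` H)" using H(1) by simp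
    show "(\<lambda>h. \<lambda>x\<in>carrier P. g (h x)) ` H \<subseteq> rhom R P X"
      by (intro image_subsetI rhom_compose[OF P _ g(1)]) (use H(2) in blast)
    fix U assume U: "right_submodule U R X"
      and sub: "\<And>k x. k \<in> (\<lambda>h. \<lambda>x\<in>carrier P. g (h x)) ` H \<Longrightarrow> x \<in> carrier P \<Longrightarrow> k x \<in> U"
    have "{x \<in> carrier Q. g x \<in> U} = carrier Q"
    proof (rule H(3)[OF right_submodule_vimage[OF Q X g(1) U]])
      fix h x assume h: "h \<in> H" and x: "x \<in> carrier P"
      have "h \<in> rhom R P Q" using H(2) h by blast
      then show "h x \<in> {x \<in> carrier Q. g x \<in> U}" using sub[OF imageI[OF h] x] x rhomD(1) by auto
    qed
    then have "g ` carrier Q \<subseteq> U" by auto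
    then show "U = carrier X" using g(2) X.right_submoduleD(1)[OF U] by auto
  qed
qed

lemma generated_by_trans:
  assumes P: "right_module R P" and Q: "right_module R Q" and X: "right_module R X"
    and PQ: "generated_by R P Q" and QX: "generated_by R Q X"
  shows "generated_by R P X"
proof -
  obtain H where H0: "finite H" "H \<subseteq> rhom R P Q"
    "\<forall>U. right_submodule U R Q \<longrightarrow> (\<forall>h\<in>H. \<forall>x\<in>carrier P. h x \<in> U) \<longrightarrow> U = carrier Q"
    by (rule generated_byE[OF PQ]) (rule that)
  note H = H0(1,2) H0(3)[rule_format]
  obtain G where G0: "finite G" "G \<subseteq> rhom R Q X"
    "\<forall>U. right_submodule U R X \<longrightarrow> (\<forall>h\<in>G. \<forall>x\<in>carrier Q. h x \<in> U) \<longrightarrow> U = carrier X"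
    by (rule generated_byE[OF QX]) (rule that)
  note G = G0(1,2) G0(3)[rule_format]
  let ?c = "\<lambda>z. \<lambda>x\<in>carrier P. fst z (snd z x)"
  show ?thesis
  proof (rule generated_byI)
    show "finite (?c ` (G \<times> H))" using G(1) H(1) by simp
    show "?c ` (G \<times> H) \<subseteq> rhom R P X"
      by (intro image_subsetI rhom_compose[OF P]) (use G(2) H(2) in auto)
    fix U assume U: "right_submodule U R X"
      and sub: "\<And>k x. k \<in> ?c ` (G \<times> H) \<Longrightarrow> x \<in> carrier P \<Longrightarrow> k x \<in> U"
    show "U = carrier X"
    proof (rule G(3)[OF U])
      fix g y assume g: "g \<in> G" and y: "y \<in> carrier Q"
      then have gr: "g \<in> rhom R Q X" using G(2) by auto
      have "{x \<in> carrier Q. g x \<in> U} = carrier Q"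
      proof (rule H(3)[OF right_submodule_vimage[OF Q X gr U]])
        fix h x assume h: "h \<in> H" and x: "x \<in> carrier P"
        have "h \<in> rhom R P Q" using H(2) h by blast
        moreover have "?c (g, h) x \<in> U" by (intro sub imageI x) (use g h in simp)
        ultimately show "h x \<in> {x \<in> carrier Q. g x \<in> U}" using x rhomD(1) by auto
      qed
      then show "g y \<in> U" using y by blast
    qed
  qed
qed

context right_noetherian_ring
begin

lemma generated_by_power:
  assumes "finite I" and P: "P \<in> fgmod R" and Q: "Q \<in> fgmod R"
    and iso: "isomorphic R Q (direct_sum I (\<lambda>_. P))"
  shows "generated_by R P Q"
proof (rule direct_sum_induct[OF assms(1) P Q iso])
  fix Z :: "'a fgm" assume Z: "Z \<in> fgmod R" "carrier Z = {\<zero>\<^bsub>Z\<^esub>}"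
  interpret Z: rmod R Z by (rule rmod.intro) (rule fgmodD[OF Z(1)])
  have "U = carrier Z" if U: "right_submodule U R Z" for U
  proof -
    have "x = \<zero>\<^bsub>Z\<^esub>" if "x \<in> U" for x using Z.right_submoduleD(1)[OF U that] by (simp add: Z(2))
    then have "U = {\<zero>\<^bsub>Z\<^esub>}" using Z.right_submoduleD(2)[OF U] by blast
    then show ?thesis using Z(2) by simp
  qed
  then show "generated_by R P Z" by (intro generated_byI[of "{}"]) simp_all
next
  fix Q0 Q :: "'a fgm" and p q
  assume Q0: "Q0 \<in> fgmod R" and Q: "Q \<in> fgmod R" and gen: "generated_by R P Q0" and b: "bisum R Q Q0 P p q"
  note m = fgmodD(1)[OF Q] fgmodD(1)[OF Q0] fgmodD(1)[OF P]
  interpret Q: rmod R Q by (rule rmod.intro) (rule m)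
  note D = bisumD[OF b]
  obtain i j where ij: "i \<in> rhom R Q0 Q" "\<forall>a\<in>carrier Q0. p (i a) = a \<and> q (i a) = \<zero>\<^bsub>P\<^esub>"
    "j \<in> rhom R P Q" "\<forall>b\<in>carrier P. p (j b) = \<zero>\<^bsub>Q0\<^esub> \<and> q (j b) = b"
    "\<forall>x\<in>carrier Q. x = i (p x) \<oplus>\<^bsub>Q\<^esub> j (q x)"
    by (rule bisum_injections[OF b m]) (rule that)
  obtain H where H0: "finite H" "H \<subseteq> rhom R P Q0"
    "\<forall>U. right_submodule U R Q0 \<longrightarrow> (\<forall>h\<in>H. \<forall>x\<in>carrier P. h x \<in> U) \<longrightarrow> U = carrier Q0"
    by (rule generated_byE[OF gen]) (rule that)
  note H = H0(1,2) H0(3)[rule_format]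
  show "generated_by R P Q"
  proof (rule generated_byI)
    show "finite (insert j ((\<lambda>h. \<lambda>x\<in>carrier P. i (h x)) ` H))" using H(1) by simp
    show "insert j ((\<lambda>h. \<lambda>x\<in>carrier P. i (h x)) ` H) \<subseteq> rhom R P Q"
      by (intro insert_subsetI ij(3) image_subsetI rhom_compose[OF m(3) _ ij(1)]) (use H(2) in blast)
    fix U assume U: "right_submodule U R Q"
      and sub: "\<And>k x. k \<in> insert j ((\<lambda>h. \<lambda>x\<in>carrier P. i (h x)) ` H) \<Longrightarrow> x \<in> carrier P \<Longrightarrow> k x \<in> U"
    have "{x \<in> carrier Q0. i x \<in> U} = carrier Q0"
    proof (rule H(3)[OF right_submodule_vimage[OF m(2,1) ij(1) U]])
      fix h x assume h: "h \<in> H" and x: "x \<in> carrier P"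
      have "h \<in> rhom R P Q0" using H(2) h by blast
      then show "h x \<in> {x \<in> carrier Q0. i x \<in> U}"
        using sub[OF insertI2[OF imageI[OF h]] x] x rhomD(1) by auto
    qed
    then have iU: "i x \<in> U" if "x \<in> carrier Q0" for x using that by blast
    have jU: "j x \<in> U" if "x \<in> carrier P" for x using sub[OF insertI1] that by blast
    have "x \<in> U" if x: "x \<in> carrier Q" for x
    proof -
      have "i (p x) \<oplus>\<^bsub>Q\<^esub> j (q x) \<in> U"
        by (intro Q.right_submoduleD(3)[OF U] iU jU rhomD(1)[OF D(1) x] rhomD(1)[OF D(2) x])
      then show ?thesis using bspec[OF ij(5) x] by simp
    qed
    then show "U = carrier Q" using Q.right_submoduleD(1)[OF U] by blast
  qed
qed

lemma generated_by_cover: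
  assumes P: "P \<in> fgmod R" and X: "X \<in> fgmod R" and gen: "generated_by R P X"
  shows "\<exists>r>0. \<exists>Q\<in>fgmod R. isomorphic R Q (direct_sum {1..r::nat} (\<lambda>_. P)) \<and>
    (\<exists>g\<in>rhom R Q X. g ` carrier Q = carrier X)"
proof -
  note m = fgmodD(1)[OF P] fgmodD(1)[OF X]
  obtain H where H0: "finite H" "H \<subseteq> rhom R P X"
    "\<forall>U. right_submodule U R X \<longrightarrow> (\<forall>h\<in>H. \<forall>x\<in>carrier P. h x \<in> U) \<longrightarrow> U = carrier X"
    by (rule generated_byE[OF gen]) (rule that)
  note H = H0(1,2) H0(3)[rule_format]
  have "\<exists>r>0. \<exists>Q\<in>fgmod R. isomorphic R Q (direct_sum {1..r::nat} (\<lambda>_. P)) \<and>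
    (\<exists>g\<in>rhom R Q X. \<forall>h\<in>H. h ` carrier P \<subseteq> g ` carrier Q)"
    using H(1,2)
  proof (induction H rule: finite_induct)
    case empty
    \<comment> \<open>The construction starts from one copy of P with the zero map, because the
      exponent has to be positive even if H is empty.\<close>
    obtain Q where "Q \<in> fgmod R" "isomorphic R Q (direct_sum {1..1::nat} (\<lambda>_. P))"
      using direct_sum_exists[of "{1..1::nat}" "\<lambda>_. P", OF _ P P] by auto
    then show ?case using zero_hom_rhom[OF fgmodD(1) m(2)]
      by (intro exI[of _ 1]) auto
  next
    case (insert h H)
    have "H \<subseteq> rhom R P X" using insert.prems by simp
    from insert.IH[OF this] obtain r Q g where r: "r > 0" and Q: "Q \<in> fgmod R"
        "isomorphic R Q (direct_sum {1..r::nat} (\<lambda>_. P))"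
      and g: "g \<in> rhom R Q X" "\<forall>h\<in>H. h ` carrier P \<subseteq> g ` carrier Q"
      by (elim exE conjE bexE) (rule that; assumption)
    have h: "h \<in> rhom R P X" using insert.prems by simp
    obtain Q' p q where Q': "Q' \<in> fgmod R" and b: "bisum R Q' Q P p q" using bisum_exists[OF Q(1) P] by blast
    note m' = fgmodD(1)[OF Q'] fgmodD(1)[OF Q(1)]
    interpret X: rmod R X by (rule rmod.intro) (rule m)
    note D = bisumD[OF b]
    obtain i j where ij: "i \<in> rhom R Q Q'" "\<forall>a\<in>carrier Q. p (i a) = a \<and> q (i a) = \<zero>\<^bsub>P\<^esub>"
      "j \<in> rhom R P Q'" "\<forall>b\<in>carrier P. p (j b) = \<zero>\<^bsub>Q\<^esub> \<and> q (j b) = b"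
      "\<forall>x\<in>carrier Q'. x = i (p x) \<oplus>\<^bsub>Q'\<^esub> j (q x)"
      by (rule bisum_injections[OF b m' m(1)]) (rule that)
    have "isomorphic R Q' (direct_sum (insert (Suc r) {1..r}) (\<lambda>_. P))"
      by (rule isomorphic_direct_sum_insert[OF m'(1) b Q(2)]) simp
    moreover have "insert (Suc r) {1..r} = {1..Suc r}" by auto
    ultimately have iso: "isomorphic R Q' (direct_sum {1..Suc r} (\<lambda>_. P))" by simp
    let ?g = "\<lambda>x\<in>carrier Q'. (\<lambda>x\<in>carrier Q'. g (p x)) x \<oplus>\<^bsub>X\<^esub> (\<lambda>x\<in>carrier Q'. h (q x)) x"
    have gr: "?g \<in> rhom R Q' X"
      by (intro rhom_add m' m rhom_compose[OF m'(1) D(1) g(1)] rhom_compose[OF m'(1) D(2) h])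
    have gi: "?g (i x) = g x" if x: "x \<in> carrier Q" for x
      using x rhomD(1)[OF ij(1) x] bspec[OF ij(2) x] rhom_zero[OF h m] rhomD(1)[OF g(1) x] by simp
    have gj: "?g (j x) = h x" if x: "x \<in> carrier P" for x
      using x rhomD(1)[OF ij(3) x] bspec[OF ij(4) x] rhom_zero[OF g(1) m'(2) m(2)] rhomD(1)[OF h x] by simp
    have gQ: "g ` carrier Q \<subseteq> ?g ` carrier Q'"
    proof
      fix y assume "y \<in> g ` carrier Q"
      then obtain x where x: "x \<in> carrier Q" "y = g x" by blast
      show "y \<in> ?g ` carrier Q'"
        by (rule image_eqI[of _ _ "i x"]) (simp_all only: x gi rhomD(1)[OF ij(1)])
    qed
    have hP: "h ` carrier P \<subseteq> ?g ` carrier Q'"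
    proof
      fix y assume "y \<in> h ` carrier P"
      then obtain x where x: "x \<in> carrier P" "y = h x" by blast
      show "y \<in> ?g ` carrier Q'"
        by (rule image_eqI[of _ _ "j x"]) (simp_all only: x gj rhomD(1)[OF ij(3)])
    qed
    have "\<forall>k\<in>insert h H. k ` carrier P \<subseteq> ?g ` carrier Q'"
    proof
      fix k assume "k \<in> insert h H"
      then consider "k = h" | "k \<in> H" by blast
      then show "k ` carrier P \<subseteq> ?g ` carrier Q'"
      proof cases
        case 1 then show ?thesis using hP by (simp only:)
      next
        case 2 then show ?thesis by (rule subset_trans[OF bspec[OF g(2)] gQ])
      qed
    qed
    then have "\<exists>g\<in>rhom R Q' X. \<forall>k\<in>insert h H. k ` carrier P \<subseteq> g ` carrier Q'" by (rule bexI[OF _ gr])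
    then show ?case using Q' iso by (intro exI[of _ "Suc r"] conjI bexI[of _ Q']) simp_all
  qed
  then obtain r Q g where r: "r > 0" and Q: "Q \<in> fgmod R" "isomorphic R Q (direct_sum {1..r::nat} (\<lambda>_. P))"
    and g: "g \<in> rhom R Q X" "\<forall>h\<in>H. h ` carrier P \<subseteq> g ` carrier Q"
    by (elim exE conjE bexE) (rule that; assumption)
  interpret Q: rmod R Q by (rule rmod.intro) (rule fgmodD[OF Q(1)])
  have "g ` carrier Q = carrier X"
    by (rule H(3)[OF right_submodule_image[OF fgmodD(1)[OF Q(1)] m(2) g(1) Q.right_submodule_carrier]])
      (use g(2) in blast)
  then show ?thesis using r Q g(1) by blast
qed

text \<open>In \<open>fgmod R\<close> the kernel of a surjection from a power of P is automatically
  an object, so generation is about surjections alone. In a \<open>Filt\<close> the kernel is a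
  genuine part of the demand.\<close>

lemma projective_generator_fgmod_iff:
  assumes P: "P \<in> fgmod R"
  shows "projective_generator R (fgmod R) P \<longleftrightarrow>
    (\<forall>A\<in>fgmod R. lifts R P A) \<and> (\<forall>X\<in>fgmod R. generated_by R P X)"
proof -
  have comp: "compose (carrier P) g h' = h \<longleftrightarrow> (\<forall>x\<in>carrier P. g (h' x) = h x)"
    if "h \<in> rhom R P C" for C :: "'a fgm" and h and g :: "'x \<Rightarrow> _" and h'
    by (rule compose_eq_iff[OF rhomD(4)[OF that]])
  have "projective_object R (fgmod R) P \<longleftrightarrow> (\<forall>A\<in>fgmod R. lifts R P A)"
    unfolding projective_object_def lifts_def using P by (simp add: comp cong: ball_cong bex_cong)
  moreover have "(\<exists>r::nat. r > 0 \<and> (\<exists>N\<in>fgmod R. \<exists>Q\<in>fgmod R. isomorphic R Q (direct_sum {1..r} (\<lambda>_. P)) \<and>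
      (\<exists>f g. short_exact R N f Q g X))) \<longleftrightarrow> generated_by R P X" if X: "X \<in> fgmod R" for X
  proof
    assume "\<exists>r::nat. r > 0 \<and> (\<exists>N\<in>fgmod R. \<exists>Q\<in>fgmod R. isomorphic R Q (direct_sum {1..r} (\<lambda>_. P)) \<and>
      (\<exists>f g. short_exact R N f Q g X))"
    then obtain r N Q f g where "N \<in> fgmod R" and Q: "Q \<in> fgmod R" "isomorphic R Q (direct_sum {1..r::nat} (\<lambda>_. P))"
      and ex: "short_exact R N f Q g X" by blast
    have "generated_by R P Q" by (rule generated_by_power[OF _ P Q]) simp
    then show "generated_by R P X"
      using generated_by_quotient[OF fgmodD(1)[OF P] fgmodD(1)[OF Q(1)] fgmodD(1)[OF X]]
        short_exactD(2,4)[OF ex] by blast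
  next
    assume "generated_by R P X"
    then obtain r Q g where r: "r > 0" and Q: "Q \<in> fgmod R" "isomorphic R Q (direct_sum {1..r::nat} (\<lambda>_. P))"
      and g: "g \<in> rhom R Q X" "g ` carrier Q = carrier X" using generated_by_cover[OF P X] by blast
    let ?U = "{x \<in> carrier Q. g x = \<zero>\<^bsub>X\<^esub>}"
    note m = fgmodD(1)[OF Q(1)] fgmodD(1)[OF X]
    have "Q\<lparr>carrier := ?U\<rparr> \<in> fgmod R" by (rule fgmod_sub[OF Q(1) right_submodule_kernel[OF m g(1)]])
    then show "\<exists>r::nat. r > 0 \<and> (\<exists>N\<in>fgmod R. \<exists>Q\<in>fgmod R. isomorphic R Q (direct_sum {1..r} (\<lambda>_. P)) \<and>
      (\<exists>f g. short_exact R N f Q g X))"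
      using r Q short_exact_kernel[OF m g] by blast
  qed
  ultimately show ?thesis unfolding projective_generator_def by (simp cong: ball_cong)
qed

end

context artin_alg
begin

lemma regular_copy:
  obtains F where "F \<in> fgmod R" "\<forall>A\<in>fgmod R. lifts R F A" "\<forall>X\<in>fgmod R. generated_by R F X"
proof -
  interpret ring R by (rule artin_algebraD(4))
  interpret Reg: rmod R "restricted_module id R"
    by (rule rmod.intro, rule right_module_regular[OF ring_axioms])
  obtain F \<theta> where F: "F \<in> fgmod R" "\<theta> \<in> riso R (restricted_module id R) F"
    using Reg.fgmod_copy[OF regular_fg] by blast
  note Fm = fgmodD(1)[OF F(1)]
  interpret F: rmod R F by (rule rmod.intro) fact
  obtain \<eta> where \<eta>: "\<eta> \<in> riso R F (restricted_module id R)"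
    "\<forall>x\<in>carrier (restricted_module id R). \<eta> (\<theta> x) = x" "\<forall>y\<in>carrier F. \<theta> (\<eta> y) = y"
    using riso_inv[OF Reg.right_module_axioms Fm F(2)] by blast
  have \<theta>r: "\<theta> \<in> rhom R (restricted_module id R) F" and \<eta>r: "\<eta> \<in> rhom R F (restricted_module id R)"
    using F \<eta> by (auto simp: riso_def)
  \<comment> \<open>\<open>e\<close> is the free generator of F, and \<open>\<eta>\<close> reads off
    the coordinate with respect to it; homomorphisms out of F are then prescribed by the image of
    \<open>e\<close>.\<close>
  define e where "e = \<theta> \<one>\<^bsub>R\<^esub>"
  have e: "e \<in> carrier F" "\<eta> e = \<one>\<^bsub>R\<^esub>"
    using rhomD(1)[OF \<theta>r] \<eta>(2) by (simp_all add: e_def restricted_module_def)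
  have \<eta>c: "\<eta> y \<in> carrier R" if "y \<in> carrier F" for y
    using rhomD(1)[OF \<eta>r that] by (simp add: restricted_module_def)
  have ye: "e \<lhd>\<^bsub>F\<^esub> \<eta> y = y" if y: "y \<in> carrier F" for y
  proof -
    have "\<theta> (\<one>\<^bsub>R\<^esub> \<lhd>\<^bsub>restricted_module id R\<^esub> \<eta> y) = \<theta> \<one>\<^bsub>R\<^esub> \<lhd>\<^bsub>F\<^esub> \<eta> y"
      by (rule rhomD(3)[OF \<theta>r]) (use \<eta>c[OF y] in \<open>simp_all add: restricted_module_def\<close>)
    then show ?thesis using \<eta>(3) y \<eta>c[OF y] by (simp add: e_def restricted_module_def)
  qed
  have mult: "(\<lambda>y\<in>carrier F. x \<lhd>\<^bsub>X\<^esub> \<eta> y) \<in> rhom R F X" if X: "X \<in> fgmod R" and x: "x \<in> carrier X" for X :: "'a fgm" and x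
  proof -
    interpret X: rmod R X by (rule rmod.intro) (rule fgmodD[OF X])
    show ?thesis
      by (rule rhom_restrictI[OF Fm])
        (use x \<eta>c in \<open>simp_all add: X.ract_closed rhomD(2,3)[OF \<eta>r] restricted_module_def
          X.ract_ring_add X.ract_assoc\<close>)
  qed
  have lift: "lifts R F A" for A
    unfolding lifts_def
  proof (intro ballI allI impI)
    fix B C :: "'a fgm" and f g h
    assume B: "B \<in> fgmod R" and C: "C \<in> fgmod R" and ex: "short_exact R A f B g C" and h: "h \<in> rhom R F C"
    obtain b where b: "b \<in> carrier B" "g b = h e" using short_exactD(7)[OF ex rhomD(1)[OF h e(1)]] by blast
    have "g (b \<lhd>\<^bsub>B\<^esub> \<eta> y) = h y" if y: "y \<in> carrier F" for y
      using rhomD(3)[OF short_exactD(2)[OF ex] b(1) \<eta>c[OF y]] rhomD(3)[OF h e(1) \<eta>c[OF y]] b(2) ye[OF y] by simp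
    then show "\<exists>h'\<in>rhom R F B. \<forall>x\<in>carrier F. g (h' x) = h x"
      using mult[OF B b(1)] by (intro bexI[of _ "\<lambda>y\<in>carrier F. b \<lhd>\<^bsub>B\<^esub> \<eta> y"]) simp_all
  qed
  have gen: "generated_by R F X" if X: "X \<in> fgmod R" for X
  proof -
    interpret X: rmod R X by (rule rmod.intro) (rule fgmodD[OF X])
    obtain G where G: "finite G" "G \<subseteq> carrier X"
      "\<And>U. right_submodule U R X \<Longrightarrow> G \<subseteq> U \<Longrightarrow> U = carrier X"
      using fgmodD(2)[OF X] by (auto simp: finitely_generated_def)
    show ?thesis
    proof (rule generated_byI)
      show "finite ((\<lambda>x. \<lambda>y\<in>carrier F. x \<lhd>\<^bsub>X\<^esub> \<eta> y) ` G)" using G(1) by simp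
      show "(\<lambda>x. \<lambda>y\<in>carrier F. x \<lhd>\<^bsub>X\<^esub> \<eta> y) ` G \<subseteq> rhom R F X"
        by (intro image_subsetI mult X) (use G(2) in blast)
      fix U assume U: "right_submodule U R X"
        and sub: "\<And>k y. k \<in> (\<lambda>x. \<lambda>y\<in>carrier F. x \<lhd>\<^bsub>X\<^esub> \<eta> y) ` G \<Longrightarrow> y \<in> carrier F \<Longrightarrow> k y \<in> U"
      have "x \<in> U" if x: "x \<in> G" for x
      proof -
        have "x \<in> carrier X" using G(2) x by blast
        then show ?thesis using sub[OF imageI[OF x] e(1)] e X.ract_one by simp
      qed
      then show "U = carrier X" by (intro G(3)[OF U] subsetI)
    qed
  qed
  show ?thesis by (intro that[OF F(1)] ballI lift gen)
qed

lemma free_cover: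
  assumes X: "X \<in> fgmod R"
  shows "\<exists>F\<in>fgmod R. (\<forall>A\<in>fgmod R. lifts R F A) \<and> (\<exists>\<pi>\<in>rhom R F X. \<pi> ` carrier F = carrier X)"
proof -
  obtain F where F: "F \<in> fgmod R" "\<forall>A\<in>fgmod R. lifts R F A" "\<forall>X\<in>fgmod R. generated_by R F X"
    by (rule regular_copy) (rule that)
  obtain r Q g where Q: "Q \<in> fgmod R" "isomorphic R Q (direct_sum {1..r::nat} (\<lambda>_. F))"
    and g: "g \<in> rhom R Q X" "g ` carrier Q = carrier X"
    using generated_by_cover[OF F(1) X bspec[OF F(3) X]] by blast
  have "lifts R Q A" if "A \<in> fgmod R" for A
    by (rule lifts_direct_sum[OF _ F(1) Q]) (use F(2) that in auto)
  then show ?thesis using Q(1) g by blast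
qed

end

section \<open>Yoneda extensions\<close>

lemma extensions_iff:
  "(f, E, g) \<in> extensions R X Y \<longleftrightarrow> E \<in> fgmod R \<and> short_exact R Y f E g X"
  by (simp add: extensions_def)

lemma Ext1_zero_iff:
  "(f, E, g) \<in> Ext1_zero R X Y \<longleftrightarrow> (f, E, g) \<in> extensions R X Y \<and>
     (\<exists>s\<in>rhom R X E. \<forall>x\<in>carrier X. g (s x) = x)"
  by (simp add: Ext1_zero_def compose_eq_iff)

lemma ext_equiv_refl:
  assumes "e \<in> extensions R X Y"
  shows "(e, e) \<in> ext_equiv R X Y"
proof -
  obtain f E g where e: "e = (f, E, g)" by (cases e)
  have E: "E \<in> fgmod R" and ex: "short_exact R Y f E g X" using assms e by (auto simp: extensions_iff)
  note D = short_exactD[OF ex]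
  have i: "(\<lambda>x\<in>carrier E. x) \<in> riso R E E"
    using rhom_id[OF fgmodD(1)[OF E]] by (auto simp: riso_def bij_betw_def inj_on_def)
  have "compose (carrier Y) (\<lambda>x\<in>carrier E. x) f = f"
    using rhomD(1)[OF D(1)] by (subst compose_eq_iff[OF rhomD(4)[OF D(1)]]) simp
  moreover have "compose (carrier E) g (\<lambda>x\<in>carrier E. x) = g"
    by (subst compose_eq_iff[OF rhomD(4)[OF D(2)]]) simp
  ultimately show ?thesis using assms i by (auto simp: ext_equiv_def e)
qed

text \<open>The sections decompose both middle terms as Y plus X. Sending e to f' (\<rho> e) + s' (g
  e) matches the decompositions, so the split extensions lie in one class.\<close>

lemma split_extensions_equiv:
  assumes X: "X \<in> fgmod R" and Y: "Y \<in> fgmod R"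
    and z: "(f, E, g) \<in> Ext1_zero R X Y" "(f', E', g') \<in> Ext1_zero R X Y"
  shows "((f, E, g), (f', E', g')) \<in> ext_equiv R X Y"
proof -
  have E: "E \<in> fgmod R" and ex: "short_exact R Y f E g X"
    and E': "E' \<in> fgmod R" and ex': "short_exact R Y f' E' g' X"
    using z by (auto simp: Ext1_zero_iff extensions_iff)
  obtain s where s: "s \<in> rhom R X E" "\<And>x. x \<in> carrier X \<Longrightarrow> g (s x) = x"
    using z(1) by (auto simp: Ext1_zero_iff)
  obtain s' where s': "s' \<in> rhom R X E'" "\<And>x. x \<in> carrier X \<Longrightarrow> g' (s' x) = x"
    using z(2) by (auto simp: Ext1_zero_iff)
  note m = fgmodD(1)[OF X] fgmodD(1)[OF Y] fgmodD(1)[OF E] fgmodD(1)[OF E']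
  interpret X: rmod R X by (rule rmod.intro) (rule m)
  interpret Y: rmod R Y by (rule rmod.intro) (rule m)
  interpret E: rmod R E by (rule rmod.intro) (rule m)
  interpret E': rmod R E' by (rule rmod.intro) (rule m)
  note D = short_exactD[OF ex] and D' = short_exactD[OF ex']
  obtain \<rho> where \<rho>: "\<rho> \<in> rhom R E Y" "\<And>e. e \<in> carrier E \<Longrightarrow> f (\<rho> e) = e \<ominus>\<^bsub>E\<^esub> s (g e)"
    "\<And>a. a \<in> carrier Y \<Longrightarrow> \<rho> (f a) = a"
    using short_exact_retraction[OF m(2,3,1) ex s] by auto
  let ?h = "\<lambda>e\<in>carrier E. (\<lambda>e\<in>carrier E. f' (\<rho> e)) e \<oplus>\<^bsub>E'\<^esub> (\<lambda>e\<in>carrier E. s' (g e)) e"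
  have h: "?h \<in> rhom R E E'"
    by (intro rhom_add m rhom_compose[OF m(3) \<rho>(1) D'(1)] rhom_compose[OF m(3) D(2) s'(1)])
  note cl = rhomD(1)[OF \<rho>(1)] rhomD(1)[OF D(2)] rhomD(1)[OF D(1)] rhomD(1)[OF D'(1)] rhomD(1)[OF s'(1)]
    rhomD(1)[OF D'(2)] rhomD(1)[OF s(1)]
  have hf: "?h (f y) = f' y" if "y \<in> carrier Y" for y
    using that cl D(5) \<rho>(3) rhom_zero[OF s'(1) m(1,4)] by simp
  have gh: "g' (?h e) = g e" if "e \<in> carrier E" for e
    using that cl s'(2) D'(5) by (simp add: rhomD(2)[OF D'(2)])
  have "inj_on ?h (carrier E)"
  proof (rule rhom_inj_onI[OF m(3,4) h])
    fix e assume e: "e \<in> carrier E" "?h e = \<zero>\<^bsub>E'\<^esub>"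
    then have ge: "g e = \<zero>\<^bsub>X\<^esub>" using gh[OF e(1)] rhom_zero[OF D'(2) m(4,1)] by simp
    then obtain y where y: "y \<in> carrier Y" "e = f y" using D(6) e(1) by blast
    have "f' y = \<zero>\<^bsub>E'\<^esub>" using hf[OF y(1)] e y by simp
    then have "y = \<zero>\<^bsub>Y\<^esub>" by (rule short_exact_ker[OF ex' m(2,4) y(1)])
    then show "e = \<zero>\<^bsub>E\<^esub>" using y(2) rhom_zero[OF D(1) m(2,3)] by simp
  qed
  moreover have "?h ` carrier E = carrier E'"
  proof (intro equalityI subsetI)
    fix v assume v: "v \<in> carrier E'"
    have gv: "g' v \<in> carrier X" by (rule cl(6)[OF v])
    have "g' (v \<ominus>\<^bsub>E'\<^esub> s' (g' v)) = \<zero>\<^bsub>X\<^esub>"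
      using v gv cl s'(2) by (simp add: rhom_minus[OF D'(2) m(4,1)] X.minus_self)
    then obtain y where y: "y \<in> carrier Y" "v \<ominus>\<^bsub>E'\<^esub> s' (g' v) = f' y"
      using D'(6)[of "v \<ominus>\<^bsub>E'\<^esub> s' (g' v)"] v gv cl by auto
    let ?e = "f y \<oplus>\<^bsub>E\<^esub> s (g' v)"
    have e: "?e \<in> carrier E" "s (g' v) \<in> carrier E" using y gv cl by auto
    have "\<rho> (s (g' v)) = \<zero>\<^bsub>Y\<^esub>"
    proof -
      have "f (\<rho> (s (g' v))) = \<zero>\<^bsub>E\<^esub>" using \<rho>(2)[OF e(2)] s(2)[OF gv] e(2) by (simp add: E.minus_self)
      then show ?thesis by (rule short_exact_ker[OF ex m(2,3) cl(1)[OF e(2)]])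
    qed
    then have "\<rho> ?e = y" using y e cl \<rho>(3) rhomD(2)[OF \<rho>(1)] by simp
    moreover have "g ?e = g' v" using y gv e cl s(2) D(5) by (simp add: rhomD(2)[OF D(2)])
    ultimately have "?h ?e = (v \<ominus>\<^bsub>E'\<^esub> s' (g' v)) \<oplus>\<^bsub>E'\<^esub> s' (g' v)" using e y(2) by simp
    then have "?h ?e = v" using E'.minus_add_cancel[OF v] cl(5)[OF gv] by simp
    from this[symmetric] e(1) show "v \<in> ?h ` carrier E" by (rule image_eqI)
  qed (use rhomD(1)[OF h] in auto)
  ultimately have hiso: "?h \<in> riso R E E'" using h by (simp add: riso_def bij_betw_def)
  have "compose (carrier Y) ?h f = f'"
    by (subst compose_eq_iff[OF rhomD(4)[OF D'(1)]]) (use hf in blast)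
  moreover have "compose (carrier E) g' ?h = g"
    by (subst compose_eq_iff[OF rhomD(4)[OF D(2)]]) (use gh in blast)
  ultimately show ?thesis using hiso z unfolding ext_equiv_def by (auto simp: Ext1_zero_iff)
qed

text \<open>Vanishing directly says that extensions of X by Y split, that is, that the identity of X
  lifts. \<open>lifts_if_split\<close> turns this into lifting along arbitrary sequences that start
  in Y.\<close>

lemma (in right_noetherian_ring) Ext1_vanishes_iff:
  assumes X: "X \<in> fgmod R" and Y: "Y \<in> fgmod R"
  shows "Ext1 R X Y = {Ext1_zero R X Y} \<longleftrightarrow> lifts R X Y"
proof
  assume vanish: "Ext1 R X Y = {Ext1_zero R X Y}"
  show "lifts R X Y"
  proof (rule lifts_if_split[OF X Y])
    fix E f g assume E: "E \<in> fgmod R" "short_exact R Y f E g X"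
    then have e: "(f, E, g) \<in> extensions R X Y" by (simp add: extensions_iff)
    then have "ext_equiv R X Y `` {(f, E, g)} \<in> Ext1 R X Y" unfolding Ext1_def by (rule quotientI)
    then have "(f, E, g) \<in> Ext1_zero R X Y" using vanish ext_equiv_refl[OF e] by auto
    then show "\<exists>s\<in>rhom R X E. \<forall>x\<in>carrier X. g (s x) = x" by (simp add: Ext1_zero_iff)
  qed
next
  assume lift: "lifts R X Y"
  have split: "e \<in> Ext1_zero R X Y" if "e \<in> extensions R X Y" for e
  proof -
    obtain f E g where e: "e = (f, E, g)" by (cases e)
    then have "E \<in> fgmod R" "short_exact R Y f E g X" using that by (auto simp: extensions_iff)
    then have "\<exists>s\<in>rhom R X E. \<forall>x\<in>carrier X. g (s x) = x"
      using liftsD[OF lift _ _ X rhom_id[OF fgmodD(1)[OF X]]] by auto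
    then show ?thesis using that e by (simp add: Ext1_zero_iff)
  qed
  have cls: "ext_equiv R X Y `` {e} = Ext1_zero R X Y" if e: "e \<in> extensions R X Y" for e
  proof (intro equalityI subsetI)
    fix e' assume "e' \<in> ext_equiv R X Y `` {e}"
    then have "e' \<in> extensions R X Y" by (auto simp: ext_equiv_def)
    then show "e' \<in> Ext1_zero R X Y" by (rule split)
  next
    fix e' assume e': "e' \<in> Ext1_zero R X Y"
    then show "e' \<in> ext_equiv R X Y `` {e}"
      using split_extensions_equiv[OF X Y] split[OF e] by (cases e; cases e') auto
  qed
  \<comment> \<open>The direct sum shows that there is an extension at all; otherwise the set of
    classes would be empty and not a singleton.\<close>
  obtain Q p q where Q: "Q \<in> fgmod R" "bisum R Q Y X p q" using bisum_exists[OF Y X] by blast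
  obtain i where "short_exact R Y i Q q X"
    using bisum_short_exact(1)[OF Q(2)] fgmodD(1) Q(1) X Y by blast
  then have e0: "(i, Q, q) \<in> extensions R X Y" using Q(1) by (simp add: extensions_iff)
  show "Ext1 R X Y = {Ext1_zero R X Y}"
  proof (intro equalityI subsetI)
    fix c assume "c \<in> Ext1 R X Y"
    then obtain e where "e \<in> extensions R X Y" "c = ext_equiv R X Y `` {e}"
      unfolding Ext1_def by (rule quotientE)
    then show "c \<in> {Ext1_zero R X Y}" using cls by simp
  next
    fix c assume "c \<in> {Ext1_zero R X Y}"
    then have "c = ext_equiv R X Y `` {(i, Q, q)}" using cls[OF e0] by simp
    then show "c \<in> Ext1 R X Y" unfolding Ext1_def using quotientI[OF e0] by simp
  qed
qed

section \<open>Projective generators of filtered modules\<close>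

context right_noetherian_ring
begin

lemma Filt_standard:
  assumes "j \<in> J" and \<Delta>: "\<forall>j\<in>J. \<Delta> j \<in> fgmod R"
  shows "\<Delta> j \<in> Filt R \<Delta> J"
  using standard_Filt[OF assms(1) \<Delta> bspec[OF \<Delta> assms(1)] isomorphic_refl] fgmodD(1) bspec[OF \<Delta> assms(1)] by blast

text \<open>The horseshoe construction adds one summand of \<open>Q\<close> for each factor of a filtration.\<close>

lemma Filt_cover:
  fixes n :: nat
  assumes \<Delta>: "\<forall>j\<in>J. \<Delta> j \<in> fgmod R" and Q: "Q \<in> Filt R \<Delta> J"
    and lift: "\<forall>A\<in>Filt R \<Delta> J. lifts R Q A"
    and cover: "\<And>j. j \<in> J \<Longrightarrow> \<exists>N\<in>Filt R \<Delta> J. \<exists>f g. short_exact R N f Q g (\<Delta> j)"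
    and X: "X \<in> Filt R \<Delta> J"
  shows "\<exists>r>0. \<exists>N\<in>Filt R \<Delta> J. \<exists>T\<in>Filt R \<Delta> J. isomorphic R T (direct_sum {1..r::nat} (\<lambda>_. Q)) \<and>
    (\<exists>f g. short_exact R N f T g X)"
proof (rule Filt_induct[OF X \<Delta>])
  note Qf = Filt_fgmod[OF Q]
  fix Z :: "'a fgm" assume Z: "Z \<in> fgmod R" "carrier Z = {\<zero>\<^bsub>Z\<^esub>}"
  obtain T where T: "T \<in> fgmod R" "isomorphic R T (direct_sum {1..1::nat} (\<lambda>_. Q))"
    using direct_sum_exists[of "{1..1::nat}" "\<lambda>_. Q", OF _ Qf Qf] by auto
  have TF: "T \<in> Filt R \<Delta> J" by (rule direct_sum_Filt[OF _ Q T \<Delta>]) simp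
  note m = fgmodD(1)[OF T(1)] fgmodD(1)[OF Z(1)]
  interpret T: rmod R T by (rule rmod.intro) (rule m)
  \<comment> \<open>The exponent has to be positive, so a zero module is covered by one copy of Q,
    with all of it as kernel.\<close>
  have "short_exact R T (\<lambda>x\<in>carrier T. x) T (zero_hom T Z) Z"
    using Z(2) by (intro short_exactI m rhom_id zero_hom_rhom) (auto simp: zero_hom_def intro!: exI[of _ "\<zero>\<^bsub>T\<^esub>"])
  then show "\<exists>r>0. \<exists>N\<in>Filt R \<Delta> J. \<exists>T\<in>Filt R \<Delta> J. isomorphic R T (direct_sum {1..r::nat} (\<lambda>_. Q)) \<and>
    (\<exists>f g. short_exact R N f T g Z)"
    using TF T(2) by (intro exI[of _ "1::nat"] conjI bexI[of _ T] exI) auto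
next
  note Qf = Filt_fgmod[OF Q]
  fix A B j f g
  assume j: "j \<in> J" and A: "A \<in> Filt R \<Delta> J" and B: "B \<in> Filt R \<Delta> J" and ex: "short_exact R A f B g (\<Delta> j)"
    and IH: "\<exists>r>0. \<exists>N\<in>Filt R \<Delta> J. \<exists>T\<in>Filt R \<Delta> J. isomorphic R T (direct_sum {1..r::nat} (\<lambda>_. Q)) \<and>
      (\<exists>f g. short_exact R N f T g A)"
  from IH obtain r N T a b where r: "r > 0" and N: "N \<in> Filt R \<Delta> J" and T: "T \<in> Filt R \<Delta> J"
      "isomorphic R T (direct_sum {1..r::nat} (\<lambda>_. Q))" and exA: "short_exact R N a T b A"
    by (elim exE conjE bexE) (rule that; assumption)
  from cover[OF j] obtain N' c d where N': "N' \<in> Filt R \<Delta> J" and exj: "short_exact R N' c Q d (\<Delta> j)" by blast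
  note Df = bspec[OF \<Delta> j]
  obtain S p q where S: "S \<in> fgmod R" and bs: "bisum R S T Q p q" using bisum_exists[OF Filt_fgmod[OF T(1)] Qf] by blast
  have SF: "S \<in> Filt R \<Delta> J" by (rule bisum_Filt[OF bs S T(1) Q \<Delta>])
  note m = fgmodD(1)[OF S] fgmodD(1)[OF Filt_fgmod[OF T(1)]] fgmodD(1)[OF Qf]
    fgmodD(1)[OF Filt_fgmod[OF A]] fgmodD(1)[OF Filt_fgmod[OF B]] fgmodD(1)[OF Df]
    fgmodD(1)[OF Filt_fgmod[OF N]] fgmodD(1)[OF Filt_fgmod[OF N']]
  interpret S: rmod R S by (rule rmod.intro) (rule m)
  interpret T: rmod R T by (rule rmod.intro) (rule m)
  interpret Q: rmod R Q by (rule rmod.intro) (rule m)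
  interpret B: rmod R B by (rule rmod.intro) (rule m)
  interpret D: rmod R "\<Delta> j" by (rule rmod.intro) (rule m)
  have "isomorphic R S (direct_sum (insert (Suc r) {1..r}) (\<lambda>_. Q))"
    by (rule isomorphic_direct_sum_insert[OF m(1) bs T(2)]) simp
  moreover have "insert (Suc r) {1..r} = {1..Suc r}" by auto
  ultimately have iso: "isomorphic R S (direct_sum {1..Suc r} (\<lambda>_. Q))" by simp
  note E = short_exactD[OF ex] and EA = short_exactD[OF exA] and Ej = short_exactD[OF exj] and W = bisumD[OF bs]
  \<comment> \<open>The kernel A of g is filtered, so the cover d of \<open>\<Delta> j\<close> lifts
    to B. Together with the cover of A it gives the map from the sum S.\<close>
  obtain l where l: "l \<in> rhom R Q B" "\<And>x. x \<in> carrier Q \<Longrightarrow> g (l x) = d x"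
    using liftsD[OF bspec[OF lift A] ex Filt_fgmod[OF B] Df Ej(2)] by blast
  let ?h = "\<lambda>x\<in>carrier S. (\<lambda>x\<in>carrier S. (\<lambda>x\<in>carrier T. f (b x)) (p x)) x \<oplus>\<^bsub>B\<^esub> (\<lambda>x\<in>carrier S. l (q x)) x"
  have h: "?h \<in> rhom R S B"
    by (intro rhom_add m rhom_compose[OF m(1) W(1)] rhom_compose[OF m(2) EA(2) E(1)] rhom_compose[OF m(1) W(2) l(1)])
  note cl = rhomD(1)[OF W(1)] rhomD(1)[OF W(2)] rhomD(1)[OF EA(2)] rhomD(1)[OF E(1)] rhomD(1)[OF l(1)]
    rhomD(1)[OF E(2)] rhomD(1)[OF Ej(2)] rhomD(1)[OF Ej(1)] rhomD(1)[OF EA(1)]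
  have hx: "?h x = f (b (p x)) \<oplus>\<^bsub>B\<^esub> l (q x)" if "x \<in> carrier S" for x using that cl by simp
  have gh: "g (?h x) = d (q x)" if x: "x \<in> carrier S" for x
    using x cl l(2) E(5) by (simp add: rhomD(2)[OF E(2)])
  have surj: "?h ` carrier S = carrier B"
  proof (intro equalityI subsetI)
    fix y assume y: "y \<in> carrier B"
    obtain u where u: "u \<in> carrier Q" "d u = g y" using Ej(7)[OF cl(6)[OF y]] by blast
    have "g (y \<ominus>\<^bsub>B\<^esub> l u) = \<zero>\<^bsub>\<Delta> j\<^esub>"
      using y u cl l(2) by (simp add: rhom_minus[OF E(2) m(5,6)] D.minus_self)
    then obtain v where v: "v \<in> carrier A" "y \<ominus>\<^bsub>B\<^esub> l u = f v" using E(6)[of "y \<ominus>\<^bsub>B\<^esub> l u"] y u cl by auto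
    obtain t where t: "t \<in> carrier T" "b t = v" using EA(7)[OF v(1)] by blast
    obtain x where x: "x \<in> carrier S" "p x = t" "q x = u" using W(4)[OF t(1) u(1)] by blast
    have "?h x = (y \<ominus>\<^bsub>B\<^esub> l u) \<oplus>\<^bsub>B\<^esub> l u" using hx[OF x(1)] x t v by simp
    then have "?h x = y" using B.minus_add_cancel[OF y cl(5)[OF u(1)]] by simp
    from this[symmetric] x(1) show "y \<in> ?h ` carrier S" by (rule image_eqI)
  qed (use rhomD(1)[OF h] in auto)
  \<comment> \<open>By the snake lemma this kernel is an extension of N' by N and therefore
    filtered; the two maps of that extension are constructed next.\<close>
  define U where "U = {x \<in> carrier S. ?h x = \<zero>\<^bsub>B\<^esub>}"
  let ?K = "S\<lparr>carrier := U\<rparr>"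
  have U: "right_submodule U R S" unfolding U_def by (rule right_submodule_kernel[OF m(1,5) h])
  have K: "?K \<in> fgmod R" by (rule fgmod_sub[OF S U])
  have exK: "short_exact R ?K (\<lambda>x\<in>U. x) S ?h B"
    unfolding U_def by (rule short_exact_kernel[OF m(1,5) h surj])
  have Ui: "x \<in> U \<longleftrightarrow> x \<in> carrier S \<and> f (b (p x)) \<oplus>\<^bsub>B\<^esub> l (q x) = \<zero>\<^bsub>B\<^esub>" for x
    using hx by (auto simp: U_def)
  obtain i k where ik: "i \<in> rhom R T S" "\<forall>x\<in>carrier T. p (i x) = x \<and> q (i x) = \<zero>\<^bsub>Q\<^esub>"
    "k \<in> rhom R Q S" "\<forall>x\<in>carrier Q. p (k x) = \<zero>\<^bsub>T\<^esub> \<and> q (k x) = x"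
    "\<forall>x\<in>carrier S. x = i (p x) \<oplus>\<^bsub>S\<^esub> k (q x)"
    by (rule bisum_injections[OF bs m(1,2,3)]) (rule that)
  let ?u = "\<lambda>x\<in>carrier N. i (a x)"
  have u: "?u \<in> rhom R N S" by (rule rhom_compose[OF m(7) EA(1) ik(1)])
  have ux: "p (?u x) = a x" "q (?u x) = \<zero>\<^bsub>Q\<^esub>" if "x \<in> carrier N" for x
    using that ik(2) cl(9) by auto
  have uU: "?u x \<in> U" if x: "x \<in> carrier N" for x
    using ux[OF x] rhomD(1)[OF u x] EA(5)[OF x] rhom_zero[OF E(1) m(4,5)] rhom_zero[OF l(1) m(3,5)]
    unfolding Ui by simp
  have qK: "(\<lambda>x\<in>carrier ?K. q x) \<in> rhom R ?K Q"
    by (rule rhom_restrictI[OF fgmodD(1)[OF K]]) (simp_all add: Ui rhomD[OF W(2)])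
  have dq: "d (q x) = \<zero>\<^bsub>\<Delta> j\<^esub>" if "x \<in> U" for x
  proof -
    have x: "x \<in> carrier S \<and> ?h x = \<zero>\<^bsub>B\<^esub>"
      using that unfolding U_def mem_Collect_eq .
    show ?thesis using gh[OF conjunct1[OF x]] rhom_zero[OF E(2) m(5,6)] unfolding conjunct2[OF x] by simp
  qed
  have "(\<lambda>x\<in>carrier ?K. q x) x \<in> c ` carrier N'" if "x \<in> carrier ?K" for x
  proof -
    have x: "x \<in> U" "x \<in> carrier S" using that by (auto simp: Ui)
    then show ?thesis using Ej(6)[OF cl(2)[OF x(2)] dq[OF x(1)]] by auto
  qed
  from rhom_cofactor[OF m(8,3) fgmodD(1)[OF K] Ej(1,3) qK this]
  obtain w where w: "w \<in> rhom R ?K N'" "\<And>x. x \<in> U \<Longrightarrow> c (w x) = q x" by auto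
  have "short_exact R N ?u ?K w N'"
  proof (rule short_exactI[OF m(7) fgmodD(1)[OF K] rhom_into_sub[OF u uU] w(1)])
    fix x assume x: "x \<in> carrier N"
    show "w (?u x) = \<zero>\<^bsub>N'\<^esub>"
    proof (rule short_exact_ker[OF exj m(8,3)])
      show "w (?u x) \<in> carrier N'" using rhomD(1)[OF w(1), of "?u x"] uU[OF x] by simp
      show "c (w (?u x)) = \<zero>\<^bsub>Q\<^esub>" using w(2)[OF uU[OF x]] ux(2)[OF x] by metis
    qed
    assume "?u x = \<zero>\<^bsub>?K\<^esub>"
    then have "a x = \<zero>\<^bsub>T\<^esub>" using ux(1)[OF x] rhom_zero[OF W(1) m(1,2)] by simp
    then show "x = \<zero>\<^bsub>N\<^esub>" by (rule short_exact_ker[OF exA m(7,2) x])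
  next
    fix y assume y: "y \<in> carrier ?K" "w y = \<zero>\<^bsub>N'\<^esub>"
    then have yU: "y \<in> U" "y \<in> carrier S" by (auto simp: Ui)
    have qy: "q y = \<zero>\<^bsub>Q\<^esub>" using w(2)[OF yU(1)] y(2) rhom_zero[OF Ej(1) m(8,3)] by simp
    have "f (b (p y)) = \<zero>\<^bsub>B\<^esub>"
      using yU(1) qy rhom_zero[OF l(1) m(3,5)] cl yU(2) unfolding Ui by simp
    then have "b (p y) = \<zero>\<^bsub>A\<^esub>" by (rule short_exact_ker[OF ex m(4,5) cl(3)[OF cl(1)[OF yU(2)]]])
    then obtain x where x: "x \<in> carrier N" "p y = a x" using EA(6)[OF cl(1)[OF yU(2)]] by blast
    have "?u x = y"
      by (rule W(3)[OF rhomD(1)[OF u x(1)] yU(2)]) (simp_all only: ux[OF x(1)] x(2) qy)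
    then show "\<exists>x\<in>carrier N. ?u x = y" using x(1) by blast
  next
    fix z assume z: "z \<in> carrier N'"
    have cz: "c z \<in> carrier Q" "d (c z) = \<zero>\<^bsub>\<Delta> j\<^esub>" using cl(8)[OF z] Ej(5)[OF z] by auto
    then have "g (l (c z)) = \<zero>\<^bsub>\<Delta> j\<^esub>" using l(2) by simp
    then obtain v where v: "v \<in> carrier A" "l (c z) = f v" using E(6)[OF cl(5)[OF cz(1)]] by blast
    obtain t where t: "t \<in> carrier T" "b t = v" using EA(7)[OF v(1)] by blast
    \<comment> \<open>With this sign the T-component contributes -f v, which cancels l (c z) = f v
      and puts x into the kernel.\<close>
    have mt: "\<ominus>\<^bsub>T\<^esub> t \<in> carrier T" using t by simp
    obtain x where x: "x \<in> carrier S" "p x = \<ominus>\<^bsub>T\<^esub> t" "q x = c z" using W(4)[OF mt cz(1)] by blast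
    have "f (b (\<ominus>\<^bsub>T\<^esub> t)) = \<ominus>\<^bsub>B\<^esub> f v"
      using t v(1) by (simp add: rhom_neg[OF EA(2) m(2,4)] rhom_neg[OF E(1) m(4,5)])
    then have xU: "x \<in> U" using x v cl(4)[OF v(1)] unfolding Ui by (simp add: B.M.l_neg)
    then have "w x = z"
      using w(2)[OF xU] x(3) inj_onD[OF Ej(3) _ _ z] rhomD(1)[OF w(1), of x] by simp
    then show "\<exists>y\<in>carrier ?K. w y = z" using xU by auto
  qed
  then have "?K \<in> Filt R \<Delta> J" by (rule Filt_extension[OF N' \<Delta> N K])
  then show "\<exists>r>0. \<exists>N\<in>Filt R \<Delta> J. \<exists>T\<in>Filt R \<Delta> J. isomorphic R T (direct_sum {1..r::nat} (\<lambda>_. Q)) \<and>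
    (\<exists>f g. short_exact R N f T g B)"
    using SF iso exK by (intro exI[of _ "Suc r"] conjI bexI[of _ ?K] bexI[of _ S] exI) simp_all
qed

end

context right_noetherian_ring
begin

text \<open>Shared by both directions of the theorem: the P i come from the highest weight structure
  in one and from universal extensions in the other. The second conclusion exceeds projectivity
  among the filtered modules, as only the left term of a sequence has to be filtered.\<close>

lemma standard_sum_projective_generator:
  fixes n :: nat and \<Delta> :: "nat \<Rightarrow> 'a fgm"
  defines "J \<equiv> {1..n}"
  assumes \<Delta>: "\<forall>j\<in>J. \<Delta> j \<in> fgmod R"
    and seq: "\<forall>i\<in>J. P i \<in> fgmod R \<and> U i \<in> Filt R \<Delta> {i+1..n} \<and> short_exact R (U i) (f i) (P i) (g i) (\<Delta> i)"
    and lift: "\<forall>i\<in>J. \<forall>j\<in>J. lifts R (P i) (\<Delta> j)"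
    and Q: "Q \<in> fgmod R" and iso: "isomorphic R Q (direct_sum J P)"
  shows "Q \<in> Filt R \<Delta> J" "\<forall>A\<in>Filt R \<Delta> J. lifts R Q A" "projective_generator R (Filt R \<Delta> J) Q"
proof -
  have Pf: "P i \<in> fgmod R" and Uf': "U i \<in> Filt R \<Delta> {i+1..n}"
    and ex: "short_exact R (U i) (f i) (P i) (g i) (\<Delta> i)" if "i \<in> J" for i
    using seq that by auto
  have Uf: "U i \<in> Filt R \<Delta> J" if "i \<in> J" for i
    using Uf'[OF that] Filt_mono[of "{i+1..n}" J \<Delta>] that by (auto simp: J_def)
  have PF: "P i \<in> Filt R \<Delta> J" if "i \<in> J" for i
    by (rule Filt_extension[OF Filt_standard[OF that \<Delta>] \<Delta> Uf[OF that] Pf[OF that] ex[OF that]])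
  have fin: "finite J" by (simp add: J_def)
  show QF: "Q \<in> Filt R \<Delta> J" by (rule direct_sum_Filt[OF fin PF Q iso \<Delta>])
  have "lifts R Q (\<Delta> j)" if "j \<in> J" for j
    by (rule lifts_direct_sum[OF fin Pf Q iso]) (use lift that in auto)
  then show liftQ: "\<forall>A\<in>Filt R \<Delta> J. lifts R Q A" using lifts_Filt[OF _ \<Delta> Q] by blast
  \<comment> \<open>Q projects onto its summand \<open>P j\<close> and further onto
    \<open>\<Delta> j\<close>. The kernel is an extension of \<open>U j\<close> by the remaining
    summands, all of which are filtered.\<close>
  have cover: "\<exists>N\<in>Filt R \<Delta> J. \<exists>f g. short_exact R N f Q g (\<Delta> j)" if j: "j \<in> J" for j
  proof -
    have "isomorphic R Q (direct_sum (insert j (J - {j})) P)" using iso j by (simp add: insert_absorb)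
    from direct_sum_insertD[OF Q Pf[OF j] this] Pf
    obtain Q0 p q where Q0: "Q0 \<in> fgmod R" "isomorphic R Q0 (direct_sum (J - {j}) P)"
      and b: "bisum R Q Q0 (P j) p q" by auto
    have Q0F: "Q0 \<in> Filt R \<Delta> J"
      by (rule direct_sum_Filt[OF _ _ Q0 \<Delta>]) (use fin PF in auto)
    note m = fgmodD(1)[OF Q0(1)] fgmodD(1)[OF Q] fgmodD(1)[OF Filt_fgmod[OF Uf[OF j]]]
      fgmodD(1)[OF Pf[OF j]] fgmodD(1)[OF bspec[OF \<Delta> j]]
    obtain a where "short_exact R Q0 a Q q (P j)" using bisum_short_exact(1)[OF b m(2,1,4)] by blast
    note pre = short_exact_preimage[OF m this ex[OF j]]
    let ?N = "Q\<lparr>carrier := {x \<in> carrier Q. g j (q x) = \<zero>\<^bsub>\<Delta> j\<^esub>}\<rparr>"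
    have Nf: "?N \<in> fgmod R" by (rule fgmod_sub[OF Q pre(1)])
    obtain l where "short_exact R Q0 a ?N l (U j)" using pre(2) by blast
    then have "?N \<in> Filt R \<Delta> J" by (rule Filt_extension[OF Uf[OF j] \<Delta> Q0F Nf])
    then show ?thesis using pre(3) by blast
  qed
  have "projective_object R (Filt R \<Delta> J) Q"
    unfolding projective_object_def
  proof (intro conjI QF ballI allI impI)
    fix A B C f g h
    assume A: "A \<in> Filt R \<Delta> J" and B: "B \<in> Filt R \<Delta> J" and C: "C \<in> Filt R \<Delta> J"
      and ex: "short_exact R A f B g C" and h: "h \<in> rhom R Q C"
    obtain h' where "h' \<in> rhom R Q B" "\<forall>x\<in>carrier Q. g (h' x) = h x"
      using liftsD[OF bspec[OF liftQ A] ex Filt_fgmod[OF B] Filt_fgmod[OF C] h] by blast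
    then show "\<exists>h'\<in>rhom R Q B. compose (carrier Q) g h' = h"
      using compose_eq_iff[OF rhomD(4)[OF h]] by blast
  qed
  then show "projective_generator R (Filt R \<Delta> J) Q"
    unfolding projective_generator_def using Filt_cover[OF \<Delta> QF liftQ cover] by blast
qed

text \<open>Left exactness of Hom(-, Y): a homomorphism that vanishes on A factors through
  \<open>\<Delta> j\<close>, where it is zero.\<close>

lemma Filt_rhom_zero:
  assumes X: "X \<in> Filt R \<Delta> J" and \<Delta>: "\<forall>j\<in>J. \<Delta> j \<in> fgmod R" and Y: "Y \<in> fgmod R"
    and zero: "\<And>j. j \<in> J \<Longrightarrow> rhom R (\<Delta> j) Y = {zero_hom (\<Delta> j) Y}"
  shows "\<forall>h\<in>rhom R X Y. \<forall>x\<in>carrier X. h x = \<zero>\<^bsub>Y\<^esub>"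
proof (rule Filt_induct[OF X \<Delta>])
  fix Z :: "'a fgm" assume Z: "Z \<in> fgmod R" "carrier Z = {\<zero>\<^bsub>Z\<^esub>}"
  show "\<forall>h\<in>rhom R Z Y. \<forall>x\<in>carrier Z. h x = \<zero>\<^bsub>Y\<^esub>"
  proof (intro ballI)
    fix h x assume h: "h \<in> rhom R Z Y" and "x \<in> carrier Z"
    then have "x = \<zero>\<^bsub>Z\<^esub>" using Z(2) by simp
    then show "h x = \<zero>\<^bsub>Y\<^esub>" using rhom_zero[OF h fgmodD(1)[OF Z(1)] fgmodD(1)[OF Y]] by simp
  qed
next
  fix A B j f g
  assume j: "j \<in> J" and A: "A \<in> Filt R \<Delta> J" and B: "B \<in> Filt R \<Delta> J"
    and IH: "\<forall>h\<in>rhom R A Y. \<forall>x\<in>carrier A. h x = \<zero>\<^bsub>Y\<^esub>" and ex: "short_exact R A f B g (\<Delta> j)"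
  note m = fgmodD(1)[OF Filt_fgmod[OF A]] fgmodD(1)[OF Filt_fgmod[OF B]] fgmodD(1)[OF bspec[OF \<Delta> j]] fgmodD(1)[OF Y]
  note D = short_exactD[OF ex]
  show "\<forall>h\<in>rhom R B Y. \<forall>x\<in>carrier B. h x = \<zero>\<^bsub>Y\<^esub>"
  proof (intro ballI)
    fix h x assume h: "h \<in> rhom R B Y" and x: "x \<in> carrier B"
    have "h y = \<zero>\<^bsub>Y\<^esub>" if y: "y \<in> carrier B" "g y = \<zero>\<^bsub>\<Delta> j\<^esub>" for y
    proof -
      obtain a where a: "a \<in> carrier A" "y = f a" using D(6)[OF y] by blast
      then show ?thesis using bspec[OF bspec[OF IH rhom_compose[OF m(1) D(1) h]] a(1)] by simp
    qed
    then obtain k where k: "k \<in> rhom R (\<Delta> j) Y" "\<And>x. x \<in> carrier B \<Longrightarrow> k (g x) = h x"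
      using rhom_factor[OF m(2,3,4) D(2,4) h] by blast
    then have "k = zero_hom (\<Delta> j) Y" using zero[OF j] by auto
    then show "h x = \<zero>\<^bsub>Y\<^esub>" using k(2)[OF x] rhomD(1)[OF D(2) x] by (simp add: zero_hom_def)
  qed
qed

end

section \<open>Universal extensions\<close>

text \<open>K acts on homomorphisms because its image in R is central; the action of a general
  element of R would not preserve R-linearity.\<close>

definition hom_module :: "('k \<Rightarrow> 'a) \<Rightarrow> 'a ring \<Rightarrow> ('a, 'b) rmodule \<Rightarrow> ('a, 'c) rmodule \<Rightarrow> ('k, 'b \<Rightarrow> 'c) rmodule" where
  "hom_module \<phi> R M N = \<lparr>carrier = rhom R M N, mult = undefined, one = undefined, zero = zero_hom M N,
     add = (\<lambda>f g. \<lambda>x\<in>carrier M. f x \<oplus>\<^bsub>N\<^esub> g x), ract = (\<lambda>f c. \<lambda>x\<in>carrier M. f x \<lhd>\<^bsub>N\<^esub> \<phi> c)\<rparr>"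

lemma hom_module_simps [simp]:
  "carrier (hom_module \<phi> R M N) = rhom R M N"
  "zero (hom_module \<phi> R M N) = zero_hom M N"
  "add (hom_module \<phi> R M N) f g = (\<lambda>x\<in>carrier M. f x \<oplus>\<^bsub>N\<^esub> g x)"
  "ract (hom_module \<phi> R M N) f c = (\<lambda>x\<in>carrier M. f x \<lhd>\<^bsub>N\<^esub> \<phi> c)"
  by (simp_all add: hom_module_def)

context artin_alg
begin

lemma rhom_scalar:
  assumes M: "right_module R M" and N: "right_module R N" and f: "f \<in> rhom R M N" and c: "c \<in> carrier K"
  shows "(\<lambda>x\<in>carrier M. f x \<lhd>\<^bsub>N\<^esub> \<phi> c) \<in> rhom R M N"
proof -
  interpret N: rmod R N by (rule rmod.intro) fact
  have pc: "\<phi> c \<in> carrier R" using c artin_algebraD(5) by (rule ring_hom_closed[rotated])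
  show ?thesis
    by (rule rhom_restrictI[OF M])
      (simp_all add: rhomD[OF f] N.ract_closed N.ract_add N.ract_assoc[symmetric] pc artin_algebraD(6)[OF c])
qed

lemma right_module_hom:
  assumes M: "right_module R M" and N: "right_module R N"
  shows "right_module K (hom_module \<phi> R M N)"
proof -
  interpret M: rmod R M by (rule rmod.intro) fact
  interpret N: rmod R N by (rule rmod.intro) fact
  interpret K: ring K by (rule artin_algebraD(3))
  note \<phi> = artin_algebraD(5)
  have ext: "(\<lambda>x\<in>carrier M. e x) = f" if "f \<in> rhom R M N" "\<And>x. x \<in> carrier M \<Longrightarrow> e x = f x" for e f
    by (rule extensionalityI[OF restrict_extensional rhomD(4)[OF that(1)]]) (simp add: that(2))
  have "abelian_group (hom_module \<phi> R M N)"
  proof (rule abelian_groupI, goal_cases)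
    case (1 f g) then show ?case by (simp add: rhom_add[OF M N])
  next
    case 2 then show ?case by (simp add: zero_hom_rhom[OF M N])
  next
    case (3 f g h) then show ?case by (auto simp: rhomD(1) N.M.a_assoc intro!: restrict_ext)
  next
    case (4 f g) then show ?case by (auto simp: rhomD(1) N.M.a_comm intro!: restrict_ext)
  next
    case (5 f) then show ?case by (auto simp: rhomD(1) zero_hom_def intro!: ext)
  next
    case (6 f)
    then have f: "f \<in> rhom R M N" by simp
    let ?g = "\<lambda>x\<in>carrier M. zero_hom M N x \<ominus>\<^bsub>N\<^esub> f x"
    have g: "?g \<in> rhom R M N" by (rule rhom_diff[OF M N zero_hom_rhom[OF M N] f])
    have "(\<lambda>x\<in>carrier M. ?g x \<oplus>\<^bsub>N\<^esub> f x) = zero_hom M N"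
      by (rule ext[OF zero_hom_rhom[OF M N]]) (simp add: zero_hom_def N.minus_add_cancel rhomD(1)[OF f])
    then show ?case unfolding hom_module_simps by (rule bexI[OF _ g])
  qed
  then show ?thesis
  proof (intro right_module.intro K.ring_axioms right_module_axioms.intro, goal_cases)
    case (2 f c) then show ?case by (simp add: rhom_scalar[OF M N])
  next
    case (3 f g c) then show ?case
      by (auto simp: rhomD(1) N.ract_add ring_hom_closed[OF \<phi>] intro!: restrict_ext)
  next
    case (4 f b c) then show ?case
      by (auto simp: rhomD(1) N.ract_ring_add ring_hom_closed[OF \<phi>] ring_hom_add[OF \<phi>] intro!: restrict_ext)
  next
    case (5 f b c) then show ?case
      by (auto simp: rhomD(1) N.ract_assoc ring_hom_closed[OF \<phi>] ring_hom_mult[OF \<phi>] intro!: restrict_ext)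
  next
    case (6 f) then show ?case
      by (auto simp: rhomD(1) N.ract_one ring_hom_one[OF \<phi>] intro!: ext)
  qed
qed

text \<open>A homomorphism is determined by its values on generators, so the module of homomorphisms
  embeds into a finite power of the target.\<close>

lemma finitely_generated_hom:
  assumes M: "right_module R M" "finitely_generated R M" and N: "right_module R N" "finitely_generated R N"
  shows "finitely_generated K (hom_module \<phi> R M N)"
proof -
  interpret M: rmod R M by (rule rmod.intro) fact
  interpret N: rmod R N by (rule rmod.intro) fact
  interpret H: rmod K "hom_module \<phi> R M N" by (rule rmod.intro, rule right_module_hom) fact+
  interpret NK: rmod K "restrict_scalars \<phi> N"
    by (rule rmod.intro, rule right_module_restrict_scalars[OF N(1) artin_algebraD(3,5)])
  note \<phi> = artin_algebraD(5)
  \<comment> \<open>The homomorphisms that vanish on E. On \<open>?A E\<close>, evaluation at x has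
    kernel \<open>?A (insert x E)\<close> and values in N, so the chain condition passes from
    \<open>?A G\<close>, which is zero, to \<open>?A {}\<close>, which is everything, one generator
    at a time.\<close>
  let ?A = "\<lambda>E. {f \<in> rhom R M N. \<forall>x\<in>E. f x = \<zero>\<^bsub>N\<^esub>}"
  have sub: "right_submodule (?A E) K (hom_module \<phi> R M N)" if "E \<subseteq> carrier M" for E
  proof (rule H.right_submoduleI, goal_cases)
    case 1 show ?case by auto
  next
    case 2 show ?case using that zero_hom_rhom[OF M(1) N(1)] by (auto simp: zero_hom_def)
  next
    case (3 f g) then show ?case using that by (auto simp: rhom_add[OF M(1) N(1)])
  next
    case (4 f c) then show ?case using that
      by (auto simp: rhom_scalar[OF M(1) N(1)] N.zero_ract ring_hom_closed[OF \<phi>])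
  qed
  have step: "wf (submod_asc K (hom_module \<phi> R M N) (?A E))"
    if "finite G" "wf (submod_asc K (hom_module \<phi> R M N) (?A (E \<union> G)))" "E \<subseteq> carrier M" "G \<subseteq> carrier M" for E G
    using that
  proof (induction G arbitrary: E rule: finite_induct)
    case (insert x G)
    have x: "x \<in> carrier M" and G: "G \<subseteq> carrier M" using insert.prems by auto
    have w: "wf (submod_asc K (hom_module \<phi> R M N) (?A (insert x E)))"
      by (rule insert.IH) (use insert.prems in simp_all)
    let ?e = "\<lambda>f\<in>carrier (hom_module \<phi> R M N). f x"
    have e: "?e \<in> rhom K (hom_module \<phi> R M N) (restrict_scalars \<phi> N)"
      by (rule rhom_restrictI[OF H.right_module_axioms])
        (auto simp: x rhomD(1) rhom_add[OF M(1) N(1)] rhom_scalar[OF M(1) N(1)])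
    show ?case
    proof (rule H.wf_submod_asc_hom[OF NK.right_module_axioms e sub[OF insert.prems(2)]])
      have "{f \<in> ?A E. ?e f = \<zero>\<^bsub>restrict_scalars \<phi> N\<^esub>} = ?A (insert x E)" by auto
      then show "wf (submod_asc K (hom_module \<phi> R M N) {f \<in> ?A E. ?e f = \<zero>\<^bsub>restrict_scalars \<phi> N\<^esub>})"
        using w by simp
      show "wf (submod_asc K (restrict_scalars \<phi> N) (?e ` ?A E))"
        by (rule wf_submod_asc_mono[OF wf_submod_asc_scalars[OF N]]) (auto simp: x rhomD(1))
    qed
  qed simp
  obtain G where G: "finite G" "G \<subseteq> carrier M"
    "\<And>U. right_submodule U R M \<Longrightarrow> G \<subseteq> U \<Longrightarrow> U = carrier M"
    using M(2) by (auto simp: finitely_generated_def)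
  have "f = zero_hom M N" if f: "f \<in> ?A G" for f
  proof -
    have fr: "f \<in> rhom R M N" using f by simp
    have "{x \<in> carrier M. f x = \<zero>\<^bsub>N\<^esub>} = carrier M"
      by (rule G(3)[OF right_submodule_kernel[OF M(1) N(1) fr]]) (use f G(2) in auto)
    then show ?thesis
      by (intro rhom_eqI[OF fr zero_hom_rhom[OF M(1) N(1)]]) (auto simp: zero_hom_def)
  qed
  then have "?A G \<subseteq> {\<zero>\<^bsub>hom_module \<phi> R M N\<^esub>}" by auto
  moreover have "submod_asc K (hom_module \<phi> R M N) {\<zero>\<^bsub>hom_module \<phi> R M N\<^esub>} = {}"
    using H.right_submoduleD(2) by (force simp: submod_asc_def submod_desc_def)
  ultimately have "wf (submod_asc K (hom_module \<phi> R M N) (?A G))"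
    using wf_submod_asc_mono[of K "hom_module \<phi> R M N" "{\<zero>\<^bsub>hom_module \<phi> R M N\<^esub>}"] by simp
  then have "wf (submod_asc K (hom_module \<phi> R M N) (?A {}))" using step[OF G(1), of "{}"] G(2) by simp
  then have "wf (submod_asc K (hom_module \<phi> R M N) (carrier (hom_module \<phi> R M N)))" by simp
  from H.finitely_generated_sub[OF this H.right_submodule_carrier] show ?thesis
    by (simp del: hom_module_simps)
qed

text \<open>Let \<open>\<Omega>\<close> be the kernel of a free cover of \<open>X\<close>. Pushouts along generators of \<open>Hom(\<Omega>, \<Delta> k)\<close>, one at a
  time, adjoin copies of \<open>\<Delta> k\<close> to \<open>X\<close> until every homomorphism from \<open>\<Omega>\<close> to \<open>\<Delta> k\<close> extends to the
  module that \<open>\<Omega>\<close> is embedded in.\<close>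

lemma universal_extension:
  assumes X: "X \<in> fgmod R" and Y: "\<Delta> k \<in> fgmod R" and T: "\<T> \<subseteq> fgmod R"
    and XT: "\<forall>A\<in>\<T>. lifts R X A" and YT: "\<forall>A\<in>insert (\<Delta> k) \<T>. lifts R (\<Delta> k) A"
  shows "\<exists>E\<in>fgmod R. \<exists>V\<in>Filt R \<Delta> {k}. \<exists>f g. short_exact R V f E g X \<and>
    (\<forall>A\<in>insert (\<Delta> k) \<T>. lifts R E A)"
proof -
  let ?Y = "\<Delta> k"
  have \<Delta>: "\<forall>j\<in>{k}. \<Delta> j \<in> fgmod R" using Y by simp
  have YF: "?Y \<in> Filt R \<Delta> {k}" by (rule Filt_standard[OF _ \<Delta>]) simp
  obtain F \<pi> where F: "F \<in> fgmod R" "\<forall>A\<in>fgmod R. lifts R F A" and \<pi>: "\<pi> \<in> rhom R F X" "\<pi> ` carrier F = carrier X"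
    using free_cover[OF X] by blast
  note Fm = fgmodD(1)[OF F(1)] and Xm = fgmodD(1)[OF X] and Ym = fgmodD(1)[OF Y]
  interpret X: rmod R X by (rule rmod.intro) fact
  interpret Y: rmod R ?Y by (rule rmod.intro) fact
  define \<Omega> where "\<Omega> = F\<lparr>carrier := {x \<in> carrier F. \<pi> x = \<zero>\<^bsub>X\<^esub>}\<rparr>"
  have \<Omega>: "\<Omega> \<in> fgmod R" unfolding \<Omega>_def by (rule fgmod_sub[OF F(1) right_submodule_kernel[OF Fm Xm \<pi>(1)]])
  note \<Omega>m = fgmodD(1)[OF \<Omega>]
  obtain \<iota> where ex0: "short_exact R \<Omega> \<iota> F \<pi> X"
    unfolding \<Omega>_def using short_exact_kernel[OF Fm Xm \<pi>] by blast
  interpret H: rmod K "hom_module \<phi> R \<Omega> ?Y" by (rule rmod.intro, rule right_module_hom) fact+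
  obtain H where H: "finite H" "H \<subseteq> rhom R \<Omega> ?Y"
    and Hgen: "\<And>S. right_submodule S K (hom_module \<phi> R \<Omega> ?Y) \<Longrightarrow> H \<subseteq> S \<Longrightarrow> S = rhom R \<Omega> ?Y"
    using finitely_generated_hom[OF \<Omega>m fgmodD(2)[OF \<Omega>] Ym fgmodD(2)[OF Y]]
    by (auto simp: finitely_generated_def)
  let ?ext = "\<lambda>i G A u. \<exists>v\<in>rhom R G A. \<forall>w\<in>carrier \<Omega>. v (i w) = u w"
  \<comment> \<open>Induction over the generators in H. Besides the extension property for those
    already treated, the invariant keeps the lifting property of G and the extension property for
    members of \<open>\<T>\<close>, so that nothing achieved against earlier standard objects is
    lost.\<close>
  have "\<exists>G\<in>fgmod R. \<exists>E\<in>fgmod R. \<exists>V\<in>Filt R \<Delta> {k}. \<exists>i p f g.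
      short_exact R \<Omega> i G p E \<and> short_exact R V f E g X \<and> (\<forall>A\<in>insert ?Y \<T>. lifts R G A) \<and>
      (\<forall>A\<in>\<T>. \<forall>u\<in>rhom R \<Omega> A. ?ext i G A u) \<and> (\<forall>u\<in>H. ?ext i G ?Y u)"
    using H
  proof (induction H rule: finite_induct)
    case empty
    let ?Z = "X\<lparr>carrier := {\<zero>\<^bsub>X\<^esub>}\<rparr>"
    have Z: "?Z \<in> Filt R \<Delta> {k}" by (rule zero_module_Filt[OF fgmod_zero_sub[OF X]]) simp
    have "{x \<in> carrier X. (\<lambda>x\<in>carrier X. x) x = \<zero>\<^bsub>X\<^esub>} = {\<zero>\<^bsub>X\<^esub>}" by auto
    then have "short_exact R ?Z (\<lambda>x\<in>{\<zero>\<^bsub>X\<^esub>}. x) X (\<lambda>x\<in>carrier X. x) X"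
      using short_exact_kernel[OF Xm Xm rhom_id[OF Xm]] by auto
    \<comment> \<open>At the start G is the free cover and E is X, and Ext^1(X, A) = 0 for A in
      \<open>\<T>\<close> is turned into extendability from \<open>\<Omega>\<close> to F.\<close>
    moreover have "\<forall>A\<in>\<T>. \<forall>u\<in>rhom R \<Omega> A. ?ext \<iota> F A u"
      using lifts_extend[OF \<Omega> F(1) X _ ex0] T XT by blast
    moreover have "\<forall>A\<in>insert ?Y \<T>. lifts R F A" using F(2) T Y by blast
    ultimately show ?case using ex0 F(1) X Z
      by (intro bexI[of _ F] bexI[of _ X] bexI[of _ ?Z] exI conjI) auto
  next
    case (insert h H)
    have "H \<subseteq> rhom R \<Omega> ?Y" and h: "h \<in> rhom R \<Omega> ?Y" using insert.prems by auto
    from insert.IH[OF this(1)] obtain G E V i p f g where G: "G \<in> fgmod R" and E: "E \<in> fgmod R" and V: "V \<in> Filt R \<Delta> {k}"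
      and exG: "short_exact R \<Omega> i G p E" and exV: "short_exact R V f E g X"
      and GT: "\<forall>A\<in>insert ?Y \<T>. lifts R G A" and eT: "\<forall>A\<in>\<T>. \<forall>u\<in>rhom R \<Omega> A. ?ext i G A u"
      and eH: "\<forall>u\<in>H. ?ext i G ?Y u"
      by (elim exE conjE bexE) (rule that; assumption)
    obtain W p' q' d E' c j m' where W: "W \<in> fgmod R" and E': "E' \<in> fgmod R" and b: "bisum R W G ?Y p' q'"
      and d: "\<forall>w\<in>carrier \<Omega>. p' (d w) = i w \<and> q' (d w) = h w"
      and exW: "short_exact R \<Omega> d W c E'" and exE: "short_exact R ?Y j E' m' E"
      and "\<forall>x\<in>carrier W. p' x = \<zero>\<^bsub>G\<^esub> \<longrightarrow> j (q' x) = c x"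
      by (rule pushout[OF \<Omega> G E Y exG h]) (rule that)
    note m = Ym fgmodD(1)[OF E'] fgmodD(1)[OF Filt_fgmod[OF V]] fgmodD(1)[OF E] Xm
    note Wm = fgmodD(1)[OF W] and Gm = fgmodD(1)[OF G] and S = bisumD[OF b] and dW = rhomD(1)[OF short_exactD(1)[OF exW]]
    note pre = short_exact_preimage[OF m exE exV]
    let ?V = "E'\<lparr>carrier := {x \<in> carrier E'. g (m' x) = \<zero>\<^bsub>X\<^esub>}\<rparr>"
    obtain l where "short_exact R ?Y j ?V l V" using pre(2) by blast
    then have V': "?V \<in> Filt R \<Delta> {k}" by (rule Filt_extension[OF V \<Delta> YF fgmod_sub[OF E' pre(1)]])
    \<comment> \<open>W is G plus one copy of \<open>\<Delta> k\<close>, so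
      Ext^1(\<open>\<Delta> k\<close>, A) must vanish; the case where A is \<open>\<Delta> k\<close>
      itself is the absence of self-extensions.\<close>
    have WT: "\<forall>A\<in>insert ?Y \<T>. lifts R W A"
      using lifts_bisum[OF b Wm Gm Ym] GT YT by blast
    have old: "?ext d W A u" if "?ext i G A u" for A :: "'a fgm" and u
    proof -
      obtain v where v: "v \<in> rhom R G A" "\<forall>w\<in>carrier \<Omega>. v (i w) = u w" using \<open>?ext i G A u\<close> by blast
      show ?thesis
        by (rule bexI[OF _ rhom_compose[OF Wm S(1) v(1)]]) (use v(2) d dW in auto)
    qed
    \<comment> \<open>h is the second coordinate of d, so the projection of W to the new summand
      extends it.\<close>
    have new: "?ext d W ?Y h" using S(2) d by blast
    have "\<forall>A\<in>\<T>. \<forall>u\<in>rhom R \<Omega> A. ?ext d W A u"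
      by (intro ballI) (rule old[OF bspec[OF bspec[OF eT]]])
    moreover have "\<forall>u\<in>insert h H. ?ext d W ?Y u"
    proof
      fix u assume "u \<in> insert h H"
      then consider "u = h" | "u \<in> H" by blast
      then show "?ext d W ?Y u"
      proof cases
        case 1 then show ?thesis using new by (simp only:)
      next
        case 2 then show ?thesis by (rule old[OF bspec[OF eH]])
      qed
    qed
    ultimately show ?case using W E' V' exW pre(3) WT
      by (intro bexI[of _ W] bexI[of _ E'] bexI[of _ ?V] exI conjI) assumption+
  qed
  then obtain G E V i p f g where G: "G \<in> fgmod R" and E: "E \<in> fgmod R" and V: "V \<in> Filt R \<Delta> {k}"
    and exG: "short_exact R \<Omega> i G p E" and exV: "short_exact R V f E g X"
    and GT: "\<forall>A\<in>insert ?Y \<T>. lifts R G A" and eT: "\<forall>A\<in>\<T>. \<forall>u\<in>rhom R \<Omega> A. ?ext i G A u"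
    and eH: "\<forall>u\<in>H. ?ext i G ?Y u"
    by (elim exE conjE bexE) (rule that; assumption)
  note Gm = fgmodD(1)[OF G] and Em = fgmodD(1)[OF E] and iw = rhomD(1)[OF short_exactD(1)[OF exG]]
  \<comment> \<open>The extendable homomorphisms form a K-submodule, and it contains the generators
    H. Hence all homomorphisms from \<open>\<Omega>\<close> to \<open>\<Delta> k\<close> extend to
    G.\<close>
  have "{u \<in> rhom R \<Omega> ?Y. ?ext i G ?Y u} = rhom R \<Omega> ?Y"
  proof (rule Hgen)
    show "H \<subseteq> {u \<in> rhom R \<Omega> ?Y. ?ext i G ?Y u}" using H(2) eH by blast
    show "right_submodule {u \<in> rhom R \<Omega> ?Y. ?ext i G ?Y u} K (hom_module \<phi> R \<Omega> ?Y)"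
    proof (rule H.right_submoduleI, goal_cases)
      case 1 show ?case by auto
    next
      case 2
      have "\<forall>w\<in>carrier \<Omega>. zero_hom G ?Y (i w) = zero_hom \<Omega> ?Y w" using iw by (simp add: zero_hom_def)
      then show ?case using zero_hom_rhom[OF Gm Ym] zero_hom_rhom[OF \<Omega>m Ym] by auto
    next
      case (3 u u')
      then obtain v v' where v: "v \<in> rhom R G ?Y" "\<forall>w\<in>carrier \<Omega>. v (i w) = u w"
        "v' \<in> rhom R G ?Y" "\<forall>w\<in>carrier \<Omega>. v' (i w) = u' w" by blast
      have "?ext i G ?Y (\<lambda>x\<in>carrier \<Omega>. u x \<oplus>\<^bsub>?Y\<^esub> u' x)"
        by (rule bexI[OF _ rhom_add[OF Gm Ym v(1,3)]]) (use v iw in auto)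
      then show ?case using 3 rhom_add[OF \<Omega>m Ym] by simp
    next
      case (4 u a)
      then obtain v where v: "v \<in> rhom R G ?Y" "\<forall>w\<in>carrier \<Omega>. v (i w) = u w" by blast
      have "?ext i G ?Y (\<lambda>x\<in>carrier \<Omega>. u x \<lhd>\<^bsub>?Y\<^esub> \<phi> a)"
        by (rule bexI[OF _ rhom_scalar[OF Gm Ym v(1) 4(2)]]) (use v iw in auto)
      then show ?case using 4 rhom_scalar[OF \<Omega>m Ym] by simp
    qed
  qed
  then have eY: "?ext i G ?Y u" if "u \<in> rhom R \<Omega> ?Y" for u using that by blast
  have "lifts R E A" if A: "A \<in> insert ?Y \<T>" for A
  proof (rule lifts_presentation[OF \<Omega>m Gm Em _ exG bspec[OF GT A]])
    show "right_module R A" using A T Y fgmodD(1) by blast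
    fix u assume u: "u \<in> rhom R \<Omega> A"
    from A consider "A = ?Y" | "A \<in> \<T>" by blast
    then show "?ext i G A u"
    proof cases
      case 1 then show ?thesis using u eY by (simp only:)
    next
      case 2 then show ?thesis by (rule bspec[OF bspec[OF eT] u])
    qed
  qed
  then show ?thesis using E V exV by blast
qed

text \<open>Iterating universal extensions by \<open>\<Delta> (i+1), \<dots>, \<Delta> n\<close> turns \<open>\<Delta> i\<close> into a projective of the
  exact category of filtered modules.\<close>

lemma standard_projective_cover:
  fixes n :: nat and \<Delta> :: "nat \<Rightarrow> 'a fgm"
  assumes \<Delta>: "\<forall>j\<in>{1..n}. \<Delta> j \<in> fgmod R"
    and lift: "\<forall>i\<in>{1..n}. \<forall>j\<in>{1..n}. i \<ge> j \<longrightarrow> lifts R (\<Delta> i) (\<Delta> j)" and i: "i \<in> {1..n}"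
  shows "\<exists>P\<in>fgmod R. \<exists>U\<in>Filt R \<Delta> {i+1..n}. \<exists>f g. short_exact R U f P g (\<Delta> i) \<and>
    (\<forall>j\<in>{1..n}. lifts R P (\<Delta> j))"
proof -
  have "i \<le> n" "1 \<le> i" using i by auto
  note Di = bspec[OF \<Delta> i]
  note Dm = fgmodD(1)[OF Di]
  \<comment> \<open>After stage m there are no extensions of P by \<open>\<Delta> 1\<close>, ...,
    \<open>\<Delta> m\<close>. At m = i, P is \<open>\<Delta> i\<close> itself, for which this is
    the hypothesis on Ext^1.\<close>
  have "m \<le> n \<Longrightarrow> \<exists>P\<in>fgmod R. \<exists>U\<in>Filt R \<Delta> {i+1..m}. \<exists>f g. short_exact R U f P g (\<Delta> i) \<and>
    (\<forall>j\<in>{1..m}. lifts R P (\<Delta> j))" if "i \<le> m" for m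
    using that
  proof (induction m rule: dec_induct)
    case base
    interpret D: rmod R "\<Delta> i" by (rule rmod.intro) fact
    let ?Z = "\<Delta> i\<lparr>carrier := {\<zero>\<^bsub>\<Delta> i\<^esub>}\<rparr>"
    have Z: "?Z \<in> Filt R \<Delta> {i+1..i}" by (rule zero_module_Filt[OF fgmod_zero_sub[OF Di]]) simp
    have "{x \<in> carrier (\<Delta> i). (\<lambda>x\<in>carrier (\<Delta> i). x) x = \<zero>\<^bsub>\<Delta> i\<^esub>} = {\<zero>\<^bsub>\<Delta> i\<^esub>}" by auto
    then have "short_exact R ?Z (\<lambda>x\<in>{\<zero>\<^bsub>\<Delta> i\<^esub>}. x) (\<Delta> i) (\<lambda>x\<in>carrier (\<Delta> i). x) (\<Delta> i)"
      using short_exact_kernel[OF Dm Dm rhom_id[OF Dm]] by auto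
    moreover have "\<forall>j\<in>{1..i}. lifts R (\<Delta> i) (\<Delta> j)" using lift i by auto
    ultimately show ?case using Di Z by blast
  next
    case (step m)
    then have "m \<le> n" by simp
    from step.IH[OF this] obtain P U f g where P: "P \<in> fgmod R" and U: "U \<in> Filt R \<Delta> {i+1..m}"
      and ex: "short_exact R U f P g (\<Delta> i)" and PT: "\<forall>j\<in>{1..m}. lifts R P (\<Delta> j)"
      by (elim exE conjE bexE) (rule that; assumption)
    have k: "Suc m \<in> {1..n}" using step.prems by simp
    \<comment> \<open>The order of the stages matters: copies of \<open>\<Delta> (m+1)\<close> may
      be adjoined without creating extensions by earlier standard objects, since
      Ext^1(\<open>\<Delta> (m+1)\<close>, \<open>\<Delta> j\<close>) = 0 for j \<le> m+1.\<close>
    have "\<exists>E\<in>fgmod R. \<exists>V\<in>Filt R \<Delta> {Suc m}. \<exists>f g. short_exact R V f E g P \<and>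
        (\<forall>A\<in>insert (\<Delta> (Suc m)) (\<Delta> ` {1..m}). lifts R E A)"
    proof (rule universal_extension[where \<Delta> = \<Delta> and k = "Suc m" and \<T> = "\<Delta> ` {1..m}", OF P bspec[OF \<Delta> k]])
      show "\<Delta> ` {1..m} \<subseteq> fgmod R" using \<Delta> \<open>m \<le> n\<close> by auto
      show "\<forall>A\<in>\<Delta> ` {1..m}. lifts R P A" using PT by auto
      show "\<forall>A\<in>insert (\<Delta> (Suc m)) (\<Delta> ` {1..m}). lifts R (\<Delta> (Suc m)) A" using lift k by auto
    qed
    then obtain E V f' g' where E: "E \<in> fgmod R" and V: "V \<in> Filt R \<Delta> {Suc m}"
      and exE: "short_exact R V f' E g' P" and ET: "\<forall>A\<in>insert (\<Delta> (Suc m)) (\<Delta> ` {1..m}). lifts R E A"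
      by (elim exE conjE bexE) (rule that; assumption)
    note ms = fgmodD(1)[OF Filt_fgmod[OF V]] fgmodD(1)[OF E] fgmodD(1)[OF Filt_fgmod[OF U]] fgmodD(1)[OF P] Dm
    note pre = short_exact_preimage[OF ms exE ex]
    let ?U = "E\<lparr>carrier := {x \<in> carrier E. g (g' x) = \<zero>\<^bsub>\<Delta> i\<^esub>}\<rparr>"
    obtain l where exU: "short_exact R V f' ?U l U" using pre(2) by blast
    have "{Suc m} \<subseteq> {i+1..Suc m}" "{i+1..m} \<subseteq> {i+1..Suc m}" using step.hyps by auto
    then have VU: "V \<in> Filt R \<Delta> {i+1..Suc m}" "U \<in> Filt R \<Delta> {i+1..Suc m}" using V U Filt_mono by blast+
    have "\<forall>j\<in>{i+1..Suc m}. \<Delta> j \<in> fgmod R" using \<Delta> \<open>1 \<le> i\<close> k by auto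
    then have U': "?U \<in> Filt R \<Delta> {i+1..Suc m}"
      by (rule Filt_extension[OF VU(2) _ VU(1) fgmod_sub[OF E pre(1)] exU])
    have "lifts R E (\<Delta> j)" if "j \<in> {1..Suc m}" for j
    proof (rule bspec[OF ET])
      show "\<Delta> j \<in> insert (\<Delta> (Suc m)) (\<Delta> ` {1..m})" using that by (cases "j = Suc m") auto
    qed
    then show ?case using E U' pre(3) by blast
  qed
  from this[OF \<open>i \<le> n\<close>] show ?thesis by simp
qed

end

section \<open>Highest weight categories\<close>

context artin_alg
begin

lemma highest_weight_category_imp:
  assumes "highest_weight_category R"
  shows "\<exists>(n::nat) \<Delta>.
       (\<forall>i\<in>{1..n}. \<Delta> i \<in> fgmod R) \<and>
       (\<forall>i\<in>{1..n}. division_ring (end_ring R (\<Delta> i))) \<and>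
       (\<forall>i\<in>{1..n}. \<forall>j\<in>{1..n}. i > j \<longrightarrow> rhom R (\<Delta> i) (\<Delta> j) = {zero_hom (\<Delta> i) (\<Delta> j)}) \<and>
       (\<forall>i\<in>{1..n}. \<forall>j\<in>{1..n}. i \<ge> j \<longrightarrow> Ext1 R (\<Delta> i) (\<Delta> j) = {Ext1_zero R (\<Delta> i) (\<Delta> j)}) \<and>
       (\<forall>P. projective_generator R (Filt R \<Delta> {1..n}) P \<longrightarrow> projective_generator R (fgmod R) P)"
proof -
  obtain n :: nat and U P \<Delta> f g where
    seq: "\<forall>i\<in>{1..n}. U i \<in> fgmod R \<and> P i \<in> fgmod R \<and> \<Delta> i \<in> fgmod R \<and>
      short_exact R (U i) (f i) (P i) (g i) (\<Delta> i)"
    and div: "\<forall>i\<in>{1..n}. division_ring (end_ring R (\<Delta> i))"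
    and hom: "\<forall>i\<in>{1..n}. \<forall>j\<in>{1..n}. i > j \<longrightarrow> rhom R (\<Delta> i) (\<Delta> j) = {zero_hom (\<Delta> i) (\<Delta> j)}"
    and UF: "\<forall>i\<in>{1..n}. U i \<in> Filt R \<Delta> {i+1..n}"
    and gen: "\<exists>Q\<in>fgmod R. isomorphic R Q (direct_sum {1..n} P) \<and> projective_generator R (fgmod R) Q"
    using assms unfolding highest_weight_category_def by (elim exE conjE) (rule that; assumption)
  obtain Q where Q: "Q \<in> fgmod R" "isomorphic R Q (direct_sum {1..n} P)" "projective_generator R (fgmod R) Q"
    using gen by blast
  have QL: "\<forall>A\<in>fgmod R. lifts R Q A" and QG: "\<forall>X\<in>fgmod R. generated_by R Q X"
    using Q(3) projective_generator_fgmod_iff[OF Q(1)] by auto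
  have \<Delta>: "\<forall>j\<in>{1..n}. \<Delta> j \<in> fgmod R" using seq by blast
  have PL: "lifts R (P i) A" if i: "i \<in> {1..n}" and A: "A \<in> fgmod R" for i A
  proof -
    have Pi: "P i \<in> fgmod R" using seq i by blast
    have "isomorphic R Q (direct_sum (insert i ({1..n} - {i})) P)" using Q(2) i by (simp add: insert_absorb)
    from direct_sum_insertD[OF Q(1) Pi this] seq obtain Q0 p q where
      Q0: "Q0 \<in> fgmod R" and b: "bisum R Q Q0 (P i) p q" by auto
    note m = fgmodD(1)[OF Q(1)] fgmodD(1)[OF Q0] fgmodD(1)[OF Pi]
    obtain s where "s \<in> rhom R (P i) Q" "\<And>x. x \<in> carrier (P i) \<Longrightarrow> q (s x) = x"
      using bisum_pairing[OF b m(1,3) zero_hom_rhom[OF m(3,2)] rhom_id[OF m(3)]] by auto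
    then show ?thesis by (rule lifts_retract[OF m(3,1) _ bisumD(2)[OF b] _ bspec[OF QL A]])
  qed
  have "lifts R (\<Delta> i) (\<Delta> j)" if i: "i \<in> {1..n}" and j: "j \<in> {1..n}" and le: "j \<le> i" for i j
  proof -
    have m: "right_module R (U i)" "right_module R (P i)" "right_module R (\<Delta> i)" "right_module R (\<Delta> j)"
      using seq i j fgmodD(1) by blast+
    have ex: "short_exact R (U i) (f i) (P i) (g i) (\<Delta> i)" and Dj: "\<Delta> j \<in> fgmod R" using seq i j by blast+
    have z: "\<forall>h\<in>rhom R (U i) (\<Delta> j). \<forall>x\<in>carrier (U i). h x = \<zero>\<^bsub>\<Delta> j\<^esub>"
      by (rule Filt_rhom_zero[OF bspec[OF UF i] _ Dj]) (use \<Delta> hom i j le in auto)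
    show ?thesis
    proof (rule lifts_presentation[OF m(1,2,3,4) ex PL[OF i Dj]])
      fix u assume u: "u \<in> rhom R (U i) (\<Delta> j)"
      have "\<forall>w\<in>carrier (U i). zero_hom (P i) (\<Delta> j) (f i w) = u w"
        using bspec[OF z u] rhomD(1)[OF short_exactD(1)[OF ex]] by (simp add: zero_hom_def)
      then show "\<exists>v\<in>rhom R (P i) (\<Delta> j). \<forall>w\<in>carrier (U i). v (f i w) = u w"
        by (rule bexI[OF _ zero_hom_rhom[OF m(2,4)]])
    qed
  qed
  then have ext: "\<forall>i\<in>{1..n}. \<forall>j\<in>{1..n}. i \<ge> j \<longrightarrow> Ext1 R (\<Delta> i) (\<Delta> j) = {Ext1_zero R (\<Delta> i) (\<Delta> j)}"
    using \<Delta> Ext1_vanishes_iff by simp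
  have seq': "\<forall>i\<in>{1..n}. P i \<in> fgmod R \<and> U i \<in> Filt R \<Delta> {i+1..n} \<and> short_exact R (U i) (f i) (P i) (g i) (\<Delta> i)"
    using seq UF by blast
  have lift: "\<forall>i\<in>{1..n}. \<forall>j\<in>{1..n}. lifts R (P i) (\<Delta> j)" using PL \<Delta> by blast
  note std = standard_sum_projective_generator[OF \<Delta> seq' lift Q(1,2)]
  have "projective_generator R (fgmod R) P'" if pg: "projective_generator R (Filt R \<Delta> {1..n}) P'" for P'
  proof -
    have po: "projective_object R (Filt R \<Delta> {1..n}) P'" using pg by (simp add: projective_generator_def)
    then have PF: "P' \<in> Filt R \<Delta> {1..n}" by (simp add: projective_object_def)
    note Pf = Filt_fgmod[OF PF]
    note Pm = fgmodD(1)[OF Pf]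
    obtain r N S a b where S: "S \<in> Filt R \<Delta> {1..n}" "isomorphic R S (direct_sum {1..r::nat} (\<lambda>_. Q))"
      and N: "N \<in> Filt R \<Delta> {1..n}" and ex: "short_exact R N a S b P'"
      using std(3) PF unfolding projective_generator_def by blast
    note Sm = fgmodD(1)[OF Filt_fgmod[OF S(1)]]
    \<comment> \<open>The kernel N is filtered as well, so the cover of P' is an exact sequence of
      filtered modules and splits by projectivity of P' among them.\<close>
    obtain s where s: "s \<in> rhom R P' S" "compose (carrier P') b s = (\<lambda>x\<in>carrier P'. x)"
      using po N S(1) PF ex rhom_id[OF Pm] unfolding projective_object_def by blast
    have bs: "b (s x) = x" if "x \<in> carrier P'" for x using fun_cong[OF s(2), of x] that by (simp add: compose_eq)
    have L: "lifts R P' A" if A: "A \<in> fgmod R" for A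
    proof -
      have SL: "lifts R S A" by (rule lifts_direct_sum[OF _ Q(1) Filt_fgmod[OF S(1)] S(2)]) (use QL A in auto)
      show ?thesis by (rule lifts_retract[OF Pm Sm s(1) short_exactD(2)[OF ex] _ SL]) (rule bs)
    qed
    \<comment> \<open>Q is itself filtered, so a power of P' maps onto it; through Q, P' then
      generates all finitely generated modules.\<close>
    obtain r' N' S' a' b' where "N' \<in> Filt R \<Delta> {1..n}" and S': "S' \<in> Filt R \<Delta> {1..n}" "isomorphic R S' (direct_sum {1..r'::nat} (\<lambda>_. P'))"
      and ex': "short_exact R N' a' S' b' Q"
      using pg std(1) unfolding projective_generator_def by blast
    have "generated_by R P' S'" by (rule generated_by_power[OF _ Pf Filt_fgmod[OF S'(1)] S'(2)]) simp
    then have PQ: "generated_by R P' Q"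
      by (rule generated_by_quotient[OF Pm fgmodD(1)[OF Filt_fgmod[OF S'(1)]] fgmodD(1)[OF Q(1)] _
        short_exactD(2,4)[OF ex']])
    have "generated_by R P' X" if X: "X \<in> fgmod R" for X
      by (rule generated_by_trans[OF Pm fgmodD(1)[OF Q(1)] fgmodD(1)[OF X] PQ bspec[OF QG X]])
    then show ?thesis using L projective_generator_fgmod_iff[OF Pf] by blast
  qed
  then show ?thesis using \<Delta> div hom ext by (intro exI[of _ n] exI[of _ \<Delta>] conjI) blast+
qed

lemma highest_weight_category_if:
  fixes n :: nat
  assumes \<Delta>: "\<forall>i\<in>{1..n}. \<Delta> i \<in> fgmod R"
    and div: "\<forall>i\<in>{1..n}. division_ring (end_ring R (\<Delta> i))"
    and hom: "\<forall>i\<in>{1..n}. \<forall>j\<in>{1..n}. i > j \<longrightarrow> rhom R (\<Delta> i) (\<Delta> j) = {zero_hom (\<Delta> i) (\<Delta> j)}"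
    and ext: "\<forall>i\<in>{1..n}. \<forall>j\<in>{1..n}. i \<ge> j \<longrightarrow> Ext1 R (\<Delta> i) (\<Delta> j) = {Ext1_zero R (\<Delta> i) (\<Delta> j)}"
    and gen: "\<forall>P. projective_generator R (Filt R \<Delta> {1..n}) P \<longrightarrow> projective_generator R (fgmod R) P"
  shows "highest_weight_category R"
proof -
  have lift: "\<forall>i\<in>{1..n}. \<forall>j\<in>{1..n}. i \<ge> j \<longrightarrow> lifts R (\<Delta> i) (\<Delta> j)"
    using ext \<Delta> Ext1_vanishes_iff by simp
  \<comment> \<open>The range condition is placed under the existential, so that the choice yields
    total functions of i.\<close>
  have "\<exists>P U f g. i \<in> {1..n} \<longrightarrow> P \<in> fgmod R \<and> U \<in> Filt R \<Delta> {i+1..n} \<and> short_exact R U f P g (\<Delta> i) \<and>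
    (\<forall>j\<in>{1..n}. lifts R P (\<Delta> j))" for i
    using standard_projective_cover[OF \<Delta> lift, of i] by blast
  then obtain P U f g where PU: "\<And>i. i \<in> {1..n} \<longrightarrow> P i \<in> fgmod R \<and> U i \<in> Filt R \<Delta> {i+1..n} \<and>
    short_exact R (U i) (f i) (P i) (g i) (\<Delta> i) \<and> (\<forall>j\<in>{1..n}. lifts R (P i) (\<Delta> j))"
    by metis
  \<comment> \<open>Any member of \<open>fgmod R\<close> will do here: it guarantees that the sum of
    the P i exists for n = 0 too.\<close>
  obtain F where F: "F \<in> fgmod R" by (rule regular_copy)
  obtain Q where Q: "Q \<in> fgmod R" "isomorphic R Q (direct_sum {1..n} P)"
    using direct_sum_exists[OF _ _ F, of "{1..n}" P] PU by auto
  have seq: "\<forall>i\<in>{1..n}. P i \<in> fgmod R \<and> U i \<in> Filt R \<Delta> {i+1..n} \<and> short_exact R (U i) (f i) (P i) (g i) (\<Delta> i)"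
    and PL: "\<forall>i\<in>{1..n}. \<forall>j\<in>{1..n}. lifts R (P i) (\<Delta> j)" using PU by blast+
  have "projective_generator R (Filt R \<Delta> {1..n}) Q"
    by (rule standard_sum_projective_generator(3)[OF \<Delta> seq PL Q])
  then have pg: "projective_generator R (fgmod R) Q" using gen by blast
  have "\<forall>i\<in>{1..n}. U i \<in> fgmod R \<and> P i \<in> fgmod R \<and> \<Delta> i \<in> fgmod R \<and>
      short_exact R (U i) (f i) (P i) (g i) (\<Delta> i)" using PU \<Delta> Filt_fgmod by blast
  moreover have "\<forall>i\<in>{1..n}. U i \<in> Filt R \<Delta> {i+1..n}" using PU by blast
  ultimately show ?thesis unfolding highest_weight_category_def
    using length_category finitely_many_simples div hom Q pg
    by (intro conjI exI[of _ n] exI[of _ U] exI[of _ P] exI[of _ \<Delta>] exI[of _ f] exI[of _ g] bexI[of _ Q]) assumption+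
qed

end

theorem theorem1p1:
  fixes K :: "'k ring" and \<phi> :: "'k \<Rightarrow> 'a" and R :: "'a ring"
  assumes "artin_algebra K \<phi> R"
  shows "highest_weight_category R \<longleftrightarrow>
    (\<exists>(n::nat) \<Delta>.
       (\<forall>i\<in>{1..n}. \<Delta> i \<in> fgmod R) \<and>
       (\<forall>i\<in>{1..n}. division_ring (end_ring R (\<Delta> i))) \<and>
       (\<forall>i\<in>{1..n}. \<forall>j\<in>{1..n}. i > j \<longrightarrow> rhom R (\<Delta> i) (\<Delta> j) = {zero_hom (\<Delta> i) (\<Delta> j)}) \<and>
       (\<forall>i\<in>{1..n}. \<forall>j\<in>{1..n}. i \<ge> j \<longrightarrow> Ext1 R (\<Delta> i) (\<Delta> j) = {Ext1_zero R (\<Delta> i) (\<Delta> j)}) \<and>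
       (\<forall>P. projective_generator R (Filt R \<Delta> {1..n}) P \<longrightarrow> projective_generator R (fgmod R) P))"
proof -
  interpret artin_alg K \<phi> R by (rule artin_alg.intro) fact
  show ?thesis
    using highest_weight_category_imp highest_weight_category_if by (intro iffI) (assumption | elim exE conjE)+
qed

end
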